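(* Let $d\ge 1$, let $\Omega\subset\mathbb{R}^d$ be a non-empty bounded open set, let $\theta\in\mathcal{S}$, and let $u\in W_\theta(\Omega)=W_{-\theta}(\Omega)$. (1) There exists a directional trace $g:\partial\Omega\to\mathbb{R}$ of $u$ in the direction $\theta$ (resp. a directional trace $g_-:\partial\Omega\to\mathbb{R}$ of $u$ in the direction $-\theta$) which moreover is measurable for the Borel $\sigma$-algebra. (2) Moreover, any function $\widetilde g:\partial\Omega\to\mathbb{R}$ (resp. $\widetilde g_-:\partial\Omega\to\mathbb{R}$) is a directional trace of $u$ in the direction $\theta$ (resp. $-\theta$) if and only if $\widetilde g(z)=g(z)$ for $\mu_\theta$-a.e. $z\in\partial\Omega$ (resp. $\widetilde g_-(z)=g_-(z)$ for $\mu_{-\theta}$-a.e. $z\in\partial\Omega$). (3) Therefore the directional trace $\gamma_\theta u$ (resp. $\gamma_{-\theta}u$), defined as the set of all directional traces of $u$ in the direction $\theta$ (resp. $-\theta$), is an equivalence class, for the relation of $\mu_\theta$-a.e. (resp. $\mu_{-\theta}$-a.e.) equality, of a measurable function for the Borel $\sigma$-algebra.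
   Context: $\Omega\subset\mathbb{R}^d$ is a non-empty bounded open set, $\partial\Omega=\overline\Omega\setminus\Omega$, $\mathcal{S}=\{x\in\mathbb{R}^d: |x|=1\}$ (Euclidean norm), and $]a,b[$ denotes an open interval. For $\theta\in\mathcal{S}$ and $x\in\Omega$, $\delta_\theta(x)=\sup\{s\in[0,+\infty):\ \forall t\in[0,s[,\ x+t\theta\in\Omega\}$ and $z_\theta(x)=x+\delta_\theta(x)\theta\in\partial\Omega$. Directional measure: $\mu_\theta$ is the finite measure on the Borel sets of $\partial\Omega$ given by $\mu_\theta(A)=\int_\Omega\chi_A(z_\theta(x))\,\mathrm{d}x$, where $\chi_A$ is the characteristic function of $A$. A set is negligible for a measure if it is included in a measurable (here Borel) set of measure zero; two functions are a.e. equal if the set where they differ is negligible. $H_\theta$ is the hyperplane through $0$ orthogonal to $\theta$, $\mathcal{P}_\theta(x)=x-(x\cdot\theta)\theta$ is the orthogonal projection onto $H_\theta$, and $\lambda^{d-1}$ is the $(d-1)$-dimensional Lebesgue measure on $H_\theta$. For $y\in H_\theta$, $\omega_\theta(y)=\{s\in\mathbb{R}: s\theta+y\in\Omega\}$; for $y\in\mathcal{P}_\theta(\Omega)$, $\mathcal{I}_\theta(y)$ is the (non-empty, countable) set of disjoint bounded open intervals whose union is $\omega_\theta(y)$ (its connected components). For $u\in L^2(\Omega)$, $\partial_\theta u\in L^2(\Omega)$ means that there is $v\in L^2(\Omega)$ (then unique, denoted $\partial_\theta u$) with $\int_\Omega u\,(\theta\cdot\nabla\varphi)\,\mathrm{d}x=-\int_\Omega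 v\varphi\,\mathrm{d}x$ for all $\varphi\in C_c^\infty(\Omega)$. $W_\theta(\Omega)=\{u\in L^2(\Omega):\partial_\theta u\in L^2(\Omega)\}$. Directional trace: for $u\in W_\theta(\Omega)$, a function $g:\partial\Omega\to\mathbb{R}$ is a directional trace of $u$ in the direction $\theta$ if there exist a representative of $u$ (still denoted $u$) and a set $A\subset\mathcal{P}_\theta(\Omega)$ such that $\mathcal{P}_\theta(\Omega)\setminus A$ is $\lambda^{d-1}$-negligible and, for any $y\in A$ and any $]\alpha,\beta[\in\mathcal{I}_\theta(y)$, the function $f:]\alpha,\beta[\to\mathbb{R}$, $s\mapsto u(s\theta+y)$ belongs to $H^1(]\alpha,\beta[)$ and $g(\beta\theta+y)=T_\beta(f)$, where $T_\beta(f)$ is the value at $\beta$ of the representative of $f$ which belongs to $C^0([\alpha,\beta])$. The same definitions apply with $\theta$ replaced by $-\theta$. *)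

theory Defs
  imports "HOL-Analysis.Analysis"
begin

text \<open>
  The space \<open>\<real>\<^sup>d\<close> is an arbitrary type of class \<^class>\<open>euclidean_space\<close>, so that \<open>d \<ge> 1\<close> is automatic
  and the one-dimensional notions are the instance \<^typ>\<open>real\<close> of the general ones.  The boundary of an
  open set \<open>\<Omega>\<close> is \<open>frontier \<Omega> = closure \<Omega> - \<Omega>\<close>.
\<close>

definition exit_time :: "'a::euclidean_space \<Rightarrow> 'a set \<Rightarrow> 'a \<Rightarrow> real" where
  "exit_time \<theta> \<Omega> x = Sup {s. 0 \<le> s \<and> (\<forall>t\<in>{0..<s}. x + t *\<^sub>R \<theta> \<in> \<Omega>)}"

definition exit_point :: "'a::euclidean_space \<Rightarrow> 'a set \<Rightarrow> 'a \<Rightarrow> 'a" where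
  "exit_point \<theta> \<Omega> x = x + exit_time \<theta> \<Omega> x *\<^sub>R \<theta>"

definition directional_measure :: "'a::euclidean_space \<Rightarrow> 'a set \<Rightarrow> 'a measure" where
  "directional_measure \<theta> \<Omega> =
     measure_of (frontier \<Omega>) (sets (restrict_space borel (frontier \<Omega>)))
       (\<lambda>A. \<integral>\<^sup>+ x. indicator A (exit_point \<theta> \<Omega> x) \<partial>restrict_space lborel \<Omega>)"

definition hyperplane :: "'a::euclidean_space \<Rightarrow> 'a set" where
  "hyperplane \<theta> = {y. y \<bullet> \<theta> = 0}"

definition hyper_proj :: "'a::euclidean_space \<Rightarrow> 'a \<Rightarrow> 'a" where
  "hyper_proj \<theta> x = x - (x \<bullet> \<theta>) *\<^sub>R \<theta>"

definition orthonormal_basis_of :: "'a::euclidean_space set \<Rightarrow> 'a set \<Rightarrow> bool" where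
  "orthonormal_basis_of V B \<longleftrightarrow>
     B \<subseteq> V \<and> pairwise orthogonal B \<and> (\<forall>b\<in>B. norm b = 1) \<and> span B = V"

text \<open>
  The \<open>(d-1)\<close>-dimensional Lebesgue measure on the hyperplane, constructed from an orthonormal basis in
  the same way as \<^const>\<open>lborel\<close> is constructed from \<^const>\<open>Basis\<close>; by rotation invariance the choice of
  the orthonormal basis is irrelevant.  For \<open>d = 1\<close> it is the unit point mass on \<open>{0}\<close>.  As for
  \<^const>\<open>lborel\<close>, the measure lives on the Borel sets, which does not affect the negligible sets.
\<close>

definition hyperplane_lborel :: "'a::euclidean_space \<Rightarrow> 'a measure" where
  "hyperplane_lborel \<theta> =
     (let B = (SOME B. orthonormal_basis_of (hyperplane \<theta>) B)
      in distr (\<Pi>\<^sub>M b\<in>B. lborel) (restrict_space borel (hyperplane \<theta>)) (\<lambda>f. \<Sum>b\<in>B. f b *\<^sub>R b))"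

definition negligible_for :: "'a measure \<Rightarrow> 'a set \<Rightarrow> bool" where
  "negligible_for M S \<longleftrightarrow> (\<exists>N\<in>null_sets M. S \<subseteq> N)"

definition line_section :: "'a::euclidean_space \<Rightarrow> 'a set \<Rightarrow> 'a \<Rightarrow> real set" where
  "line_section \<theta> \<Omega> y = {s. s *\<^sub>R \<theta> + y \<in> \<Omega>}"

text \<open>
  Elements of \<open>L\<^sup>2(\<Omega>)\<close> are represented by functions on the whole space, of which only the values on
  \<open>\<Omega>\<close> matter; representatives of the same class are functions that agree a.e. in \<open>\<Omega>\<close>.
\<close>

definition L2_space :: "'a::euclidean_space set \<Rightarrow> ('a \<Rightarrow> real) set" where
  "L2_space \<Omega> = {u \<in> borel_measurable (lebesgue_on \<Omega>). integrable (lebesgue_on \<Omega>) (\<lambda>x. (u x)\<^sup>2)}"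

fun C_k :: "nat \<Rightarrow> ('a::euclidean_space \<Rightarrow> real) \<Rightarrow> bool" where
  "C_k 0 f \<longleftrightarrow> continuous_on UNIV f"
| "C_k (Suc k) f \<longleftrightarrow>
     (\<forall>x. f differentiable (at x)) \<and> (\<forall>b\<in>Basis. C_k k (\<lambda>x. frechet_derivative f (at x) b))"

text \<open>Functions in \<open>C\<^sub>c\<^sup>\<infinity>(\<Omega>)\<close> are identified with their extension by zero.\<close>

definition test_functions :: "'a::euclidean_space set \<Rightarrow> ('a \<Rightarrow> real) set" where
  "test_functions \<Omega> =
     {\<phi>. (\<forall>k. C_k k \<phi>) \<and> compact (closure {x. \<phi> x \<noteq> 0}) \<and> closure {x. \<phi> x \<noteq> 0} \<subseteq> \<Omega>}"

definition gradient :: "('a::euclidean_space \<Rightarrow> real) \<Rightarrow> 'a \<Rightarrow> 'a" where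
  "gradient \<phi> x = (\<Sum>b\<in>Basis. frechet_derivative \<phi> (at x) b *\<^sub>R b)"

definition weak_dir_deriv :: "'a::euclidean_space \<Rightarrow> 'a set \<Rightarrow> ('a \<Rightarrow> real) \<Rightarrow> ('a \<Rightarrow> real) \<Rightarrow> bool" where
  "weak_dir_deriv \<theta> \<Omega> u v \<longleftrightarrow>
     (\<forall>\<phi>\<in>test_functions \<Omega>.
        (\<integral>x. u x * (\<theta> \<bullet> gradient \<phi> x) \<partial>lebesgue_on \<Omega>) = - (\<integral>x. v x * \<phi> x \<partial>lebesgue_on \<Omega>))"

definition W_space :: "'a::euclidean_space \<Rightarrow> 'a set \<Rightarrow> ('a \<Rightarrow> real) set" where
  "W_space \<theta> \<Omega> = {u \<in> L2_space \<Omega>. \<exists>v\<in>L2_space \<Omega>. weak_dir_deriv \<theta> \<Omega> u v}"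

definition H1_interval :: "real \<Rightarrow> real \<Rightarrow> (real \<Rightarrow> real) set" where
  "H1_interval \<alpha> \<beta> = W_space 1 {\<alpha><..<\<beta>}"

definition end_trace :: "real \<Rightarrow> real \<Rightarrow> (real \<Rightarrow> real) \<Rightarrow> real" where
  "end_trace \<alpha> \<beta> f =
     (THE c. \<exists>F. continuous_on {\<alpha>..\<beta>} F \<and> (AE s in lebesgue_on {\<alpha><..<\<beta>}. F s = f s) \<and> c = F \<beta>)"

text \<open>
  Functions \<open>\<partial>\<Omega> \<rightarrow> \<real>\<close> are the elements of \<open>frontier \<Omega> \<rightarrow>\<^sub>E UNIV\<close>, so that sets of such functions
  (in particular equivalence classes) are meaningful.
\<close>

definition directional_trace ::
    "'a::euclidean_space \<Rightarrow> 'a set \<Rightarrow> ('a \<Rightarrow> real) \<Rightarrow> ('a \<Rightarrow> real) \<Rightarrow> bool" where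
  "directional_trace \<theta> \<Omega> u g \<longleftrightarrow>
     g \<in> frontier \<Omega> \<rightarrow>\<^sub>E UNIV \<and>
     (\<exists>u' A. (AE x in lebesgue_on \<Omega>. u' x = u x) \<and>
        A \<subseteq> hyper_proj \<theta> ` \<Omega> \<and>
        negligible_for (hyperplane_lborel \<theta>) (hyper_proj \<theta> ` \<Omega> - A) \<and>
        (\<forall>y\<in>A. \<forall>\<alpha> \<beta>. {\<alpha><..<\<beta>} \<in> components (line_section \<theta> \<Omega> y) \<longrightarrow>
           (\<lambda>s. u' (s *\<^sub>R \<theta> + y)) \<in> H1_interval \<alpha> \<beta> \<and>
           g (\<beta> *\<^sub>R \<theta> + y) = end_trace \<alpha> \<beta> (\<lambda>s. u' (s *\<^sub>R \<theta> + y))))"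

definition trace_class :: "'a::euclidean_space \<Rightarrow> 'a set \<Rightarrow> ('a \<Rightarrow> real) \<Rightarrow> ('a \<Rightarrow> real) set" where
  "trace_class \<theta> \<Omega> u = {g. directional_trace \<theta> \<Omega> u g}"

definition ae_eq_rel :: "'a measure \<Rightarrow> (('a \<Rightarrow> real) \<times> ('a \<Rightarrow> real)) set" where
  "ae_eq_rel M =
     {(g, h). g \<in> space M \<rightarrow>\<^sub>E UNIV \<and> h \<in> space M \<rightarrow>\<^sub>E UNIV \<and> negligible_for M {z \<in> space M. g z \<noteq> h z}}"


subsection \<open>Consistency of the definitions\<close>

lemma negligible_for_iff_AE:
  assumes "S \<subseteq> space M"
  shows "negligible_for M S \<longleftrightarrow> (AE z in M. z \<notin> S)"
proof -
  have "{z \<in> space M. \<not> z \<notin> S} = S"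
    using assms by auto
  then show ?thesis
    unfolding negligible_for_def eventually_ae_filter by auto
qed

lemma ae_eq_rel_iff:
  "(g, h) \<in> ae_eq_rel M \<longleftrightarrow>
     g \<in> space M \<rightarrow>\<^sub>E UNIV \<and> h \<in> space M \<rightarrow>\<^sub>E UNIV \<and> (AE z in M. g z = h z)"
  unfolding ae_eq_rel_def negligible_for_def eventually_ae_filter by auto

lemma equiv_ae_eq_rel: "equiv (space M \<rightarrow>\<^sub>E UNIV) (ae_eq_rel M)"
proof (rule equivI)
  show "ae_eq_rel M \<subseteq> (space M \<rightarrow>\<^sub>E UNIV) \<times> (space M \<rightarrow>\<^sub>E UNIV)"
    by (auto simp: ae_eq_rel_def)
  show "refl_on (space M \<rightarrow>\<^sub>E UNIV) (ae_eq_rel M)"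
    by (rule refl_onI) (simp add: ae_eq_rel_iff)
  show "sym (ae_eq_rel M)"
    by (rule symI) (auto simp: ae_eq_rel_iff eq_commute)
  show "trans (ae_eq_rel M)"
  proof (rule transI)
    fix f g h assume fg: "(f, g) \<in> ae_eq_rel M" and gh: "(g, h) \<in> ae_eq_rel M"
    have "AE z in M. f z = g z" "AE z in M. g z = h z"
      using fg gh unfolding ae_eq_rel_iff by auto
    then have "AE z in M. f z = h z" by eventually_elim simp
    then show "(f, h) \<in> ae_eq_rel M"
      using fg gh unfolding ae_eq_rel_iff by auto
  qed
qed

lemma L2_space_uminus: "v \<in> L2_space \<Omega> \<Longrightarrow> (\<lambda>x. - v x) \<in> L2_space \<Omega>"
  by (auto simp: L2_space_def)

lemma weak_dir_deriv_uminus: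
  assumes "weak_dir_deriv \<theta> \<Omega> u v"
  shows "weak_dir_deriv (- \<theta>) \<Omega> u (\<lambda>x. - v x)"
  using assms by (simp add: weak_dir_deriv_def)

lemma W_space_uminus: "W_space (- \<theta>) \<Omega> = W_space \<theta> \<Omega>"
proof -
  have "W_space \<theta> \<Omega> \<subseteq> W_space (- \<theta>) \<Omega>" for \<theta> :: 'a
    unfolding W_space_def using L2_space_uminus weak_dir_deriv_uminus by blast
  from this[of \<theta>] this[of "- \<theta>"] show ?thesis by auto
qed

lemma orthonormal_basis_of_hyperplane:
  "\<exists>B. orthonormal_basis_of (hyperplane \<theta>) B"
proof -
  have "subspace (hyperplane \<theta>)"
    by (auto simp: hyperplane_def subspace_def inner_left_distrib)
  then show ?thesis
    unfolding orthonormal_basis_of_def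
    by (metis orthonormal_basis_subspace)
qed

lemma space_hyperplane_lborel: "space (hyperplane_lborel \<theta>) = hyperplane \<theta>"
  by (simp add: hyperplane_lborel_def Let_def space_restrict_space)

lemma space_directional_measure: "space (directional_measure \<theta> \<Omega>) = frontier \<Omega>"
  unfolding directional_measure_def
  by (metis sets.space_closed space_borel space_measure_of space_restrict_space Int_UNIV_right)

lemma sets_directional_measure:
  "sets (directional_measure \<theta> \<Omega>) = sets (restrict_space borel (frontier \<Omega>))"
  unfolding directional_measure_def
  by (metis sets.sets_measure_of_eq space_borel space_restrict_space Int_UNIV_right)

context
  fixes \<Omega> :: "'a::euclidean_space set" and \<theta> :: 'a
  assumes \<Omega>: "bounded \<Omega>" "open \<Omega>" and \<theta>: "norm \<theta> = 1"
begin

lemma exit_set_bdd: "x \<in> \<Omega> \<Longrightarrow> bdd_above {s. 0 \<le> s \<and> (\<forall>t\<in>{0..<s}. x + t *\<^sub>R \<theta> \<in> \<Omega>)}"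
proof -
  assume x: "x \<in> \<Omega>"
  obtain R where R: "\<And>y. y \<in> \<Omega> \<Longrightarrow> norm y \<le> R"
    using \<Omega>(1) bounded_iff by blast
  have "s \<le> 2 * R + 1" if s: "0 \<le> s" "\<forall>t\<in>{0..<s}. x + t *\<^sub>R \<theta> \<in> \<Omega>" for s
  proof (rule ccontr)
    assume "\<not> s \<le> 2 * R + 1"
    moreover have "0 \<le> R" using R[OF x] norm_ge_zero order_trans by blast
    ultimately have "x + (2 * R + 1) *\<^sub>R \<theta> \<in> \<Omega>" using s by auto
    then have "norm (x + (2 * R + 1) *\<^sub>R \<theta>) \<le> R" by (rule R)
    moreover have "norm ((2 * R + 1) *\<^sub>R \<theta>) \<le> norm (x + (2 * R + 1) *\<^sub>R \<theta>) + norm x"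
      using norm_triangle_ineq4[of "x + (2 * R + 1) *\<^sub>R \<theta>" x] by simp
    ultimately show False using R[OF x] \<theta> \<open>0 \<le> R\<close> by simp
  qed
  then show ?thesis by (intro bdd_aboveI[where M = "2 * R + 1"]) auto
qed

lemma less_exit_time_iff:
  assumes x: "x \<in> \<Omega>" and c: "0 \<le> c"
  shows "c < exit_time \<theta> \<Omega> x \<longleftrightarrow> (\<forall>t\<in>{0..c}. x + t *\<^sub>R \<theta> \<in> \<Omega>)"
proof
  assume "c < exit_time \<theta> \<Omega> x"
  moreover have "{s. 0 \<le> s \<and> (\<forall>t\<in>{0..<s}. x + t *\<^sub>R \<theta> \<in> \<Omega>)} \<noteq> {}"
    by (auto intro: exI[of _ 0])
  ultimately obtain s where "c < s" "\<forall>t\<in>{0..<s}. x + t *\<^sub>R \<theta> \<in> \<Omega>"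
    unfolding exit_time_def using less_cSup_iff[OF _ exit_set_bdd[OF x]] by auto
  then show "\<forall>t\<in>{0..c}. x + t *\<^sub>R \<theta> \<in> \<Omega>" by auto
next
  assume *: "\<forall>t\<in>{0..c}. x + t *\<^sub>R \<theta> \<in> \<Omega>"
  then have "x + c *\<^sub>R \<theta> \<in> \<Omega>" using c by auto
  then obtain e where e: "e > 0" "ball (x + c *\<^sub>R \<theta>) e \<subseteq> \<Omega>"
    using \<Omega>(2) open_contains_ball by blast
  have "x + t *\<^sub>R \<theta> \<in> \<Omega>" if "t \<in> {0..<c + e}" for t
  proof (cases "t \<le> c")
    case False
    have "dist (x + c *\<^sub>R \<theta>) (x + t *\<^sub>R \<theta>) = norm ((c - t) *\<^sub>R \<theta>)"
      by (simp add: dist_norm algebra_simps)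
    also have "\<dots> < e" using \<theta> that False by simp
    finally show ?thesis using e by auto
  qed (use * that in auto)
  then have "c + e \<le> exit_time \<theta> \<Omega> x"
    unfolding exit_time_def using c e(1) by (intro cSup_upper exit_set_bdd x) auto
  then show "c < exit_time \<theta> \<Omega> x" using e by simp
qed

lemma exit_time_pos: "x \<in> \<Omega> \<Longrightarrow> 0 < exit_time \<theta> \<Omega> x"
  using less_exit_time_iff[of x 0] by auto

lemma exit_point_frontier:
  assumes x: "x \<in> \<Omega>"
  shows "exit_point \<theta> \<Omega> x \<in> frontier \<Omega>"
proof -
  let ?d = "exit_time \<theta> \<Omega> x"
  have pos: "0 < ?d" using exit_time_pos[OF x] .
  have ins: "x + t *\<^sub>R \<theta> \<in> \<Omega>" if "0 \<le> t" "t < ?d" for t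
    using less_exit_time_iff[OF x that(1)] that by auto
  have "x + ?d *\<^sub>R \<theta> \<notin> \<Omega>"
  proof
    assume "x + ?d *\<^sub>R \<theta> \<in> \<Omega>"
    then have "\<forall>t\<in>{0..?d}. x + t *\<^sub>R \<theta> \<in> \<Omega>"
      using ins by (metis atLeastAtMost_iff less_eq_real_def)
    then show False using less_exit_time_iff[OF x, of ?d] pos by simp
  qed
  moreover have "x + ?d *\<^sub>R \<theta> \<in> closure \<Omega>"
    unfolding closure_approachable
  proof (intro allI impI)
    fix e :: real assume e: "0 < e"
    define t where "t = max 0 (?d - e / 2)"
    have t: "0 \<le> t" "t < ?d" "?d - t < e" using pos e by (auto simp: t_def)
    have "dist (x + t *\<^sub>R \<theta>) (x + ?d *\<^sub>R \<theta>) = norm ((t - ?d) *\<^sub>R \<theta>)"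
      by (simp add: dist_norm algebra_simps)
    also have "\<dots> < e" using \<theta> t by simp
    finally show "\<exists>y\<in>\<Omega>. dist y (x + ?d *\<^sub>R \<theta>) < e" using ins[OF t(1,2)] by blast
  qed
  ultimately show ?thesis
    using \<Omega>(2) by (simp add: frontier_def interior_open exit_point_def)
qed

lemma open_less_exit_time: "open {x \<in> \<Omega>. c < exit_time \<theta> \<Omega> x}"
proof (cases "0 \<le> c")
  case False
  then have "{x \<in> \<Omega>. c < exit_time \<theta> \<Omega> x} = \<Omega>"
    using exit_time_pos by force
  then show ?thesis using \<Omega>(2) by simp
next
  case True
  show ?thesis unfolding open_contains_ball
  proof
    fix x assume "x \<in> {x \<in> \<Omega>. c < exit_time \<theta> \<Omega> x}"
    then have x: "x \<in> \<Omega>" "\<forall>t\<in>{0..c}. x + t *\<^sub>R \<theta> \<in> \<Omega>"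
      using less_exit_time_iff True by auto
    let ?K = "(\<lambda>t. x + t *\<^sub>R \<theta>) ` {0..c}"
    have "compact ?K" by (intro compact_continuous_image continuous_intros) auto
    moreover have "?K \<noteq> {}" using True by auto
    moreover have "?K \<subseteq> \<Omega>" using x by auto
    ultimately obtain e where e: "0 < e" "(\<Union>y\<in>?K. ball y e) \<subseteq> \<Omega>"
      using compact_subset_open_imp_ball_epsilon_subset[OF _ \<Omega>(2)] by metis
    have "x' \<in> \<Omega> \<and> c < exit_time \<theta> \<Omega> x'" if "x' \<in> ball x e" for x'
    proof -
      have *: "x' + t *\<^sub>R \<theta> \<in> \<Omega>" if "t \<in> {0..c}" for t
        using e(2) that \<open>x' \<in> ball x e\<close> by (auto simp: dist_norm subset_eq)
      have "x' \<in> \<Omega>" using *[of 0] True by simp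
      then show ?thesis using less_exit_time_iff True * by blast
    qed
    then show "\<exists>e>0. ball x e \<subseteq> {x \<in> \<Omega>. c < exit_time \<theta> \<Omega> x}"
      using e(1) by blast
  qed
qed

lemma measurable_exit_point:
  "exit_point \<theta> \<Omega> \<in> restrict_space lborel \<Omega> \<rightarrow>\<^sub>M restrict_space borel (frontier \<Omega>)"
proof -
  have "exit_time \<theta> \<Omega> \<in> borel_measurable (restrict_space lborel \<Omega>)"
  proof (subst borel_measurable_iff_greater, rule allI)
    fix c
    have "{x \<in> \<Omega>. c < exit_time \<theta> \<Omega> x} \<in> sets borel"
      using open_less_exit_time by (rule borel_open)
    then show "{x \<in> space (restrict_space lborel \<Omega>). c < exit_time \<theta> \<Omega> x}
        \<in> sets (restrict_space lborel \<Omega>)"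
      using \<Omega>(2) by (subst sets_restrict_space_iff) (auto simp: space_restrict_space)
  qed
  moreover have "(\<lambda>x. x) \<in> borel_measurable (restrict_space lborel \<Omega>)"
    by (intro measurable_restrict_space1) simp
  ultimately have "exit_point \<theta> \<Omega> \<in> borel_measurable (restrict_space lborel \<Omega>)"
    unfolding exit_point_def[abs_def] by measurable
  then show ?thesis
    by (intro measurable_restrict_space2) (auto simp: space_restrict_space exit_point_frontier)
qed

lemma emeasure_directional_measure:
  assumes A: "A \<in> sets (restrict_space borel (frontier \<Omega>))"
  shows "emeasure (directional_measure \<theta> \<Omega>) A =
    (\<integral>\<^sup>+ x. indicator A (exit_point \<theta> \<Omega> x) \<partial>restrict_space lborel \<Omega>)"
proof -
  let ?B = "restrict_space borel (frontier \<Omega>)"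
  let ?D = "distr (restrict_space lborel \<Omega>) ?B (exit_point \<theta> \<Omega>)"
  have eq: "(\<integral>\<^sup>+ x. indicator A (exit_point \<theta> \<Omega> x) \<partial>restrict_space lborel \<Omega>) = emeasure ?D A"
    if "A \<in> sets ?B" for A
  proof -
    have "emeasure ?D A = (\<integral>\<^sup>+ z. indicator A z \<partial>?D)"
      using that by simp
    also have "\<dots> = (\<integral>\<^sup>+ x. indicator A (exit_point \<theta> \<Omega> x) \<partial>restrict_space lborel \<Omega>)"
      using that measurable_exit_point by (intro nn_integral_distr) auto
    finally show ?thesis ..
  qed
  have sp: "space ?B = frontier \<Omega>" by (simp add: space_restrict_space)
  have "directional_measure \<theta> \<Omega> = measure_of (space ?D) (sets ?D) (emeasure ?D)"
    unfolding directional_measure_def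
    using eq sets.space_closed[of ?B] sets.sigma_sets_eq[of ?B] sp
    by (simp del: emeasure_distr) (intro measure_of_eq, auto)
  also have "\<dots> = ?D" by (rule measure_of_of_measure)
  finally show ?thesis using eq A by simp
qed

lemma finite_measure_directional_measure: "finite_measure (directional_measure \<theta> \<Omega>)"
proof
  have top: "frontier \<Omega> \<in> sets (restrict_space borel (frontier \<Omega>))"
    using sets.top[of "restrict_space borel (frontier \<Omega>)"] by (simp add: space_restrict_space)
  have "emeasure (directional_measure \<theta> \<Omega>) (frontier \<Omega>)
      \<le> (\<integral>\<^sup>+ x. 1 \<partial>restrict_space lborel \<Omega>)"
    unfolding emeasure_directional_measure[OF top]
    by (intro nn_integral_mono) (auto simp: indicator_def)
  also have "\<dots> = emeasure lborel \<Omega>"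
    using \<Omega>(2) by (simp add: space_restrict_space emeasure_restrict_space)
  also have "\<dots> < \<infinity>"
    using \<Omega>(1) by (rule emeasure_bounded_finite)
  finally show "emeasure (directional_measure \<theta> \<Omega>) (space (directional_measure \<theta> \<Omega>)) \<noteq> \<infinity>"
    by (simp add: space_directional_measure)
qed

end

end

theory Submission
  imports Defs
begin

text \<open>
  Testing the weak derivative with products of a function of \<open>x \<bullet> \<theta>\<close> and a function of the projection
  of \<open>x\<close> onto the hyperplane shows, by Fubini, that on almost every line parallel to \<open>\<theta>\<close> the function
  \<open>u\<close> satisfies a countable family of one-dimensional weak identities. By the du Bois-Reymond
  argument these suffice for \<open>u\<close> to coincide on each component of the line with a constant plus a
  primitive of \<open>\<partial>\<^sub>\<theta> u\<close>. The end value of this primitive is the limit of averages of a Borel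
  representative of \<open>u\<close> over short segments ending at the boundary point, and this limit is a Borel
  function of the boundary point. Finally, by Fubini again, a set of boundary points is
  \<open>\<mu>\<^sub>\<theta>\<close>-negligible iff almost no line has a component whose right end point lies in it.
\<close>

section \<open>Smooth functions and bumps\<close>

text \<open>Fubini yields an exceptional null set of lines for each test function, while the
  components of a line are arbitrary intervals that change with the line. Hence the test functions
  are fixed before the line: they have rational data, and each is localised to a rational box of
  lines whose cylinder lies in \<Omega>. On a given line, every compact piece of a component has
  such a cylinder around it, and the whole component is recovered by exhaustion. Two measurability
  issues shape the rest. The trace must be Borel on the whole boundary, so it is given by one
  formula that mentions neither a line nor a component. And the set where two boundary functions
  differ may fail to be Borel, so negligibility is transferred through Borel covers, on the boundary
  and on the hyperplane. Lebesgue measure is compared with the hyperplane measure times length only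
  up to a finite positive factor, because just vanishing, finiteness and equality of integrals are
  read off.\<close>

definition smooth :: "('a::euclidean_space \<Rightarrow> real) \<Rightarrow> bool" where
  "smooth f \<longleftrightarrow> (\<forall>k. C_k k f)"

lemma C_k_Suc_imp: "C_k (Suc k) f \<Longrightarrow> C_k k f"
proof (induction k arbitrary: f)
  case 0
  then show ?case
    by (auto intro!: continuous_at_imp_continuous_on differentiable_imp_continuous_within)
next
  case (Suc k)
  then show ?case by (metis C_k.simps(2))
qed

lemma C_k_SucI:
  assumes "\<And>x. (f has_derivative f' x) (at x)" "\<And>b. b \<in> Basis \<Longrightarrow> C_k k (\<lambda>x. f' x b)"
  shows "C_k (Suc k) f"
proof -
  have "frechet_derivative f (at x) = f' x" for x
    using frechet_derivative_at[OF assms(1)[of x]] by simp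
  moreover have "f differentiable (at x)" for x
    using assms(1) differentiable_def by blast
  ultimately show ?thesis using assms(2) by simp
qed

lemma C_k_SucD:
  assumes "C_k (Suc k) f"
  shows "(f has_derivative frechet_derivative f (at x)) (at x)"
    and "b \<in> Basis \<Longrightarrow> C_k k (\<lambda>x. frechet_derivative f (at x) b)"
  using assms frechet_derivative_works by auto

lemma C_k_const: "C_k k (\<lambda>x. c)"
proof (induction k arbitrary: c)
  case (Suc k)
  show ?case by (rule C_k_SucI[where f' = "\<lambda>x h. 0"]) (use Suc in auto)
qed simp

lemma C_k_add:
  assumes "C_k k f" "C_k k g" shows "C_k k (\<lambda>x. f x + g x)"
  using assms
proof (induction k arbitrary: f g)
  case 0
  then show ?case by (simp add: continuous_on_add)
next
  case (Suc k)
  show ?case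
    by (rule C_k_SucI[OF has_derivative_add[OF C_k_SucD(1)[OF Suc.prems(1)] C_k_SucD(1)[OF Suc.prems(2)]]])
       (use Suc.IH C_k_SucD(2)[OF Suc.prems(1)] C_k_SucD(2)[OF Suc.prems(2)] in blast)
qed

lemma C_k_mult:
  assumes "C_k k f" "C_k k g" shows "C_k k (\<lambda>x. f x * g x)"
  using assms
proof (induction k arbitrary: f g)
  case 0
  then show ?case by (simp add: continuous_on_mult)
next
  case (Suc k)
  \<comment> \<open>The product rule brings back \<open>f\<close> and \<open>g\<close> themselves
    next to the derivatives, hence the descent by \<open>C_k_Suc_imp\<close>.\<close>
  show ?case
    by (rule C_k_SucI[OF has_derivative_mult[OF C_k_SucD(1)[OF Suc.prems(1)] C_k_SucD(1)[OF Suc.prems(2)]]])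
       (intro C_k_add Suc.IH C_k_Suc_imp[OF Suc.prems(1)] C_k_Suc_imp[OF Suc.prems(2)] C_k_SucD(2)[OF Suc.prems(1)] C_k_SucD(2)[OF Suc.prems(2)]; assumption)
qed

text \<open>The outer function is one-dimensional, so the chain rule gives an ordinary product. Its
  first factor is the derivative of \<open>A\<close> composed with the same \<open>g\<close>, so the
  induction generalises \<open>A\<close> and keeps \<open>g\<close> fixed.\<close>

lemma C_k_compose:
  fixes A :: "real \<Rightarrow> real"
  assumes "C_k k A" "C_k k g" shows "C_k k (\<lambda>x. A (g x))"
  using assms
proof (induction k arbitrary: A)
  case 0
  then show ?case by (auto intro: continuous_on_compose2)
next
  case (Suc k)
  have D: "((\<lambda>x. A (g x)) has_derivative
      (\<lambda>h. frechet_derivative A (at (g x)) 1 * frechet_derivative g (at x) h)) (at x)" for x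
  proof -
    have A: "(A has_derivative frechet_derivative A (at (g x))) (at (g x))"
      by (rule C_k_SucD(1)[OF Suc.prems(1)])
    have eq: "frechet_derivative A (at (g x)) = (\<lambda>r. frechet_derivative A (at (g x)) 1 * r)"
    proof
      fix r
      show "frechet_derivative A (at (g x)) r = frechet_derivative A (at (g x)) 1 * r"
        using linear_cmul[OF has_derivative_linear[OF A], of r 1] by simp
    qed
    show ?thesis
      by (rule has_derivative_eq_rhs[OF has_derivative_compose[OF C_k_SucD(1)[OF Suc.prems(2), of x] A]])
         (rule ext, rule fun_cong[OF eq])
  qed
  have A': "C_k k (\<lambda>s. frechet_derivative A (at s) 1)"
    by (rule C_k_SucD(2)[OF Suc.prems(1)]) simp
  show ?case
    by (rule C_k_SucI[OF D])
       (intro C_k_mult Suc.IH[OF A'] C_k_Suc_imp[OF Suc.prems(2)] C_k_SucD(2)[OF Suc.prems(2)])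
qed

lemma smooth_const: "smooth (\<lambda>x. c)"
  by (simp add: smooth_def C_k_const)

lemma smooth_mult: "smooth f \<Longrightarrow> smooth g \<Longrightarrow> smooth (\<lambda>x. f x * g x)"
  by (simp add: smooth_def C_k_mult)

lemma smooth_compose: "smooth A \<Longrightarrow> smooth g \<Longrightarrow> smooth (\<lambda>x. A (g x))" for A :: "real \<Rightarrow> real"
  by (simp add: smooth_def C_k_compose)

lemma smooth_prod: "(\<And>i. i \<in> I \<Longrightarrow> smooth (f i)) \<Longrightarrow> smooth (\<lambda>x. \<Prod>i\<in>I. f i x)"
  by (induction I rule: infinite_finite_induct) (simp_all add: smooth_const smooth_mult)

lemma smooth_SucI:
  assumes "\<And>x. (f has_derivative f' x) (at x)" "\<And>b. b \<in> Basis \<Longrightarrow> smooth (\<lambda>x. f' x b)"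
  shows "smooth f"
  unfolding smooth_def
proof
  fix k show "C_k k f"
    using C_k_SucI[of f f' k] C_k_Suc_imp assms unfolding smooth_def by blast
qed

lemma smooth_affine:
  assumes "bounded_linear g" shows "smooth (\<lambda>x. g x + c)"
proof (rule smooth_SucI)
  show "((\<lambda>x. g x + c) has_derivative g) (at x)" for x
    using bounded_linear_imp_has_derivative[OF assms] by (rule has_derivative_add_const)
qed (rule smooth_const)

lemma smooth_real_antiderivative:
  fixes A :: "real \<Rightarrow> real"
  assumes "\<And>x. (A has_real_derivative A' x) (at x)" "smooth A'"
  shows "smooth A"
proof (rule smooth_SucI)
  show "(A has_derivative (\<lambda>h. A' x * h)) (at x)" for x
    using assms(1) by (simp add: has_field_derivative_def)
qed (use assms(2) in simp)

lemma smooth_has_derivative: "smooth f \<Longrightarrow> (f has_derivative frechet_derivative f (at x)) (at x)"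
  unfolding smooth_def by (metis C_k_SucD(1))

lemma smooth_continuous_on: "smooth f \<Longrightarrow> continuous_on S f"
  unfolding smooth_def by (metis C_k.simps(1) continuous_on_subset subset_UNIV)

lemma smooth_frechet: "smooth f \<Longrightarrow> b \<in> Basis \<Longrightarrow> smooth (\<lambda>x. frechet_derivative f (at x) b)"
  unfolding smooth_def by (metis C_k_SucD(2))

lemma smooth_real_derivative:
  fixes A :: "real \<Rightarrow> real"
  assumes "smooth A"
  shows "(A has_real_derivative frechet_derivative A (at x) 1) (at x)"
proof -
  note D = smooth_has_derivative[OF assms, of x]
  have "frechet_derivative A (at x) = (*) (frechet_derivative A (at x) 1)"
  proof
    fix r
    show "frechet_derivative A (at x) r = frechet_derivative A (at x) 1 * r"
      using linear_cmul[OF has_derivative_linear[OF D], of r 1] by simp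
  qed
  with has_derivative_eq_rhs[OF D] show ?thesis unfolding has_field_derivative_def .
qed

lemma inner_gradient:
  assumes "smooth \<phi>"
  shows "\<theta> \<bullet> gradient \<phi> x = frechet_derivative \<phi> (at x) \<theta>"
proof -
  have lin: "linear (frechet_derivative \<phi> (at x))"
    using smooth_has_derivative[OF assms] by (rule has_derivative_linear)
  have "frechet_derivative \<phi> (at x) \<theta> = frechet_derivative \<phi> (at x) (\<Sum>b\<in>Basis. (\<theta> \<bullet> b) *\<^sub>R b)"
    by (simp add: euclidean_representation)
  also have "\<dots> = \<theta> \<bullet> gradient \<phi> x"
    by (simp add: linear_sum[OF lin] linear_cmul[OF lin] gradient_def inner_sum_right mult.commute)
  finally show ?thesis ..
qed

text \<open>The chain rule along the line through \<open>x\<close>. For a function of the coordinate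
  along \<theta> times a function of the projection, it reduces the directional derivative to one
  variable, with the second factor constant.\<close>

lemma inner_gradient_eq_deriv:
  assumes "smooth \<phi>" and D: "((\<lambda>t. \<phi> (x + t *\<^sub>R \<theta>)) has_real_derivative D) (at 0)"
  shows "\<theta> \<bullet> gradient \<phi> x = D"
proof -
  have 0: "(\<phi> has_derivative frechet_derivative \<phi> (at x)) (at (x + 0 *\<^sub>R \<theta>))"
    using smooth_has_derivative[OF assms(1), of x] by simp
  have 1: "((\<lambda>t. x + t *\<^sub>R \<theta>) has_derivative (\<lambda>t. t *\<^sub>R \<theta>)) (at 0)"
    by (auto intro!: derivative_eq_intros)
  have "((\<lambda>t. \<phi> (x + t *\<^sub>R \<theta>)) has_derivative (\<lambda>t. frechet_derivative \<phi> (at x) (t *\<^sub>R \<theta>))) (at 0)"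
    by (rule has_derivative_compose[OF 1 0])
  from has_derivative_unique[OF this D[unfolded has_field_derivative_def]]
  have "(\<lambda>t. frechet_derivative \<phi> (at x) (t *\<^sub>R \<theta>)) = (*) D" .
  then have "frechet_derivative \<phi> (at x) (1 *\<^sub>R \<theta>) = D * 1" by metis
  then show ?thesis using inner_gradient[OF assms(1)] by simp
qed

section \<open>Flat exponentials and smooth bumps on boxes\<close>

definition flat_exp :: "real poly \<Rightarrow> real \<Rightarrow> real" where
  "flat_exp p x = (if x \<le> 0 then 0 else poly p (1 / x) * exp (- (1 / x)))"

lemma poly_mult_exp_tendsto_0: "((\<lambda>t. poly p t * exp (- t)) \<longlongrightarrow> 0) at_top" for p :: "real poly"
proof -
  have "((\<lambda>t. \<Sum>i\<le>degree p. coeff p i * (t ^ i / exp t)) \<longlongrightarrow> (\<Sum>i\<le>degree p. coeff p i * 0)) at_top"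
    by (intro tendsto_intros tendsto_power_div_exp_0)
  moreover have "(\<lambda>t. poly p t * exp (- t)) = (\<lambda>t. \<Sum>i\<le>degree p. coeff p i * (t ^ i / exp t))"
    by (simp add: poly_altdef sum_distrib_right exp_minus field_simps sum_divide_distrib)
  ultimately show ?thesis by simp
qed

text \<open>With t = 1/x one has dt/dx = -t^2, so p(t) exp(-t) has derivative t^2 (p(t) - p'(t))
  exp(-t). The family over all polynomials is closed under differentiation, so that smoothness
  becomes an induction with \<open>p\<close> arbitrary.\<close>

lemma flat_exp_has_derivative:
  "(flat_exp p has_real_derivative flat_exp ([:0, 0, 1:] * (p - pderiv p)) x) (at x)"
proof -
  consider "x < 0" | "x > 0" | "x = 0" by linarith
  then show ?thesis
  proof cases
    case 1
    have "((\<lambda>x. 0) has_real_derivative 0) (at x)" by simp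
    then have "(flat_exp p has_real_derivative 0) (at x)"
      by (rule has_field_derivative_transform_within[where d = "- x"])
         (use 1 in \<open>auto simp: flat_exp_def dist_real_def\<close>)
    then show ?thesis using 1 by (simp add: flat_exp_def)
  next
    case 2
    have "((\<lambda>x. poly p (1 / x) * exp (- (1 / x))) has_real_derivative
        poly ([:0, 0, 1:] * (p - pderiv p)) (1 / x) * exp (- (1 / x))) (at x)"
      using 2 by (auto intro!: derivative_eq_intros simp: field_simps power2_eq_square)
    then have "(flat_exp p has_real_derivative
        poly ([:0, 0, 1:] * (p - pderiv p)) (1 / x) * exp (- (1 / x))) (at x)"
      by (rule has_field_derivative_transform_within[where d = x])
         (use 2 in \<open>auto simp: flat_exp_def dist_real_def\<close>)
    then show ?thesis using 2 by (simp add: flat_exp_def)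
  next
    case 3
    \<comment> \<open>With r = 1/t the difference quotient \<open>flat_exp p t / t\<close> is r p(r)
      exp(-r), hence the polynomial \<open>pCons 0 p\<close>.\<close>
    have "((\<lambda>t. poly (pCons 0 p) (1 / t) * exp (- (1 / t))) \<longlongrightarrow> 0) (at_right 0)"
      using filterlim_compose[OF poly_mult_exp_tendsto_0[of "pCons 0 p"] filterlim_inverse_at_top_right]
      by (simp add: divide_inverse)
    then have R: "((\<lambda>t. flat_exp p t / t) \<longlongrightarrow> 0) (at_right 0)"
      by (rule Lim_transform_eventually)
         (auto simp: eventually_at_filter flat_exp_def)
    have L: "((\<lambda>t. flat_exp p t / t) \<longlongrightarrow> 0) (at_left 0)"
      by (rule Lim_transform_eventually[of "\<lambda>_. 0"]) (auto simp: eventually_at_filter flat_exp_def)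
    have "((\<lambda>t. flat_exp p t / t) \<longlongrightarrow> 0) (at 0)"
      using L R by (simp add: filterlim_split_at)
    then show ?thesis using 3 by (simp add: has_field_derivative_iff flat_exp_def)
  qed
qed

lemma smooth_flat_exp: "smooth (flat_exp p)"
proof -
  have "C_k k (flat_exp p)" for k
  proof (induction k arbitrary: p)
    case 0
    show ?case
      by (auto intro!: continuous_at_imp_continuous_on DERIV_isCont[OF flat_exp_has_derivative])
  next
    case (Suc k)
    show ?case
      by (rule C_k_SucI[OF flat_exp_has_derivative[unfolded has_field_derivative_def]])
         (use Suc in simp)
  qed
  then show ?thesis by (simp add: smooth_def)
qed

text \<open>Each factor is positive exactly on the inner side of one face, so for every
  \<open>n\<close> the product is positive exactly on \<open>box l u\<close>. The scale
  \<open>Suc n\<close> only steepens the transition: the limit in \<open>n\<close> is the indicator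
  of the open box, with the support unchanged.\<close>

definition bump :: "nat \<Rightarrow> 'a \<Rightarrow> 'a \<Rightarrow> 'a::euclidean_space \<Rightarrow> real" where
  "bump n l u y = (\<Prod>b\<in>Basis. flat_exp 1 (real (Suc n) * ((y - l) \<bullet> b)) * flat_exp 1 (real (Suc n) * ((u - y) \<bullet> b)))"

lemma flat_exp_1: "0 \<le> flat_exp 1 x" "flat_exp 1 x \<le> 1" "flat_exp 1 x = 0 \<longleftrightarrow> x \<le> 0"
  by (auto simp: flat_exp_def)

lemma bump_nonneg: "0 \<le> bump n l u y"
  unfolding bump_def by (intro prod_nonneg mult_nonneg_nonneg flat_exp_1 ballI)

lemma bump_le_1: "bump n l u y \<le> 1"
  unfolding bump_def by (intro prod_le_1 conjI mult_nonneg_nonneg mult_le_one flat_exp_1)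

lemma bump_eq_0_iff: "bump n l u y = 0 \<longleftrightarrow> y \<notin> box l u"
  by (force simp: bump_def flat_exp_1 mem_box inner_diff_left mult_le_0_iff not_less)

lemma smooth_bump_compose:
  assumes "bounded_linear P" shows "smooth (\<lambda>x. bump n l u (P x))"
proof -
  have "smooth (\<lambda>x. flat_exp 1 (real (Suc n) * ((P x - l) \<bullet> b)) * flat_exp 1 (real (Suc n) * ((u - P x) \<bullet> b)))" for b
  proof (rule smooth_mult; rule smooth_compose[OF smooth_flat_exp])
    show "smooth (\<lambda>x. real (Suc n) * ((P x - l) \<bullet> b))"
    proof -
      have "bounded_linear (\<lambda>x. P x \<bullet> (real (Suc n) *\<^sub>R b))"
        by (rule bounded_linear_compose[OF bounded_linear_inner_left assms])
      from smooth_affine[OF this, of "- (real (Suc n) * (l \<bullet> b))"] show ?thesis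
        by (simp add: inner_diff_left algebra_simps)
    qed
    show "smooth (\<lambda>x. real (Suc n) * ((u - P x) \<bullet> b))"
    proof -
      have "bounded_linear (\<lambda>x. P x \<bullet> (- real (Suc n) *\<^sub>R b))"
        by (rule bounded_linear_compose[OF bounded_linear_inner_left assms])
      from smooth_affine[OF this, of "real (Suc n) * (u \<bullet> b)"] show ?thesis
        by (simp add: inner_diff_left algebra_simps)
    qed
  qed
  then show ?thesis unfolding bump_def by (intro smooth_prod)
qed

lemma smooth_bump: "smooth (bump n l u)"
  using smooth_bump_compose[OF bounded_linear_ident, of n l u] .

lemma flat_exp_scaled_tendsto:
  "(\<lambda>n. flat_exp 1 (real (Suc n) * x)) \<longlonglongrightarrow> (if 0 < x then 1 else 0)"
proof (cases "0 < x")
  case True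
  have "(\<lambda>n. exp (- (inverse (real (Suc n)) * inverse x))) \<longlonglongrightarrow> exp (- (0 * inverse x))"
    by (intro tendsto_intros LIMSEQ_inverse_real_of_nat)
  moreover have "0 < x + x * real n" for n
    using True by (simp add: add_pos_nonneg)
  ultimately show ?thesis using True
    by (simp add: flat_exp_def field_simps not_le[symmetric])
qed (simp add: flat_exp_def mult_le_0_iff not_less)

lemma bump_tendsto: "(\<lambda>n. bump n l u y) \<longlonglongrightarrow> indicator (box l u) y"
proof -
  have "(\<lambda>n. bump n l u y) \<longlonglongrightarrow>
      (\<Prod>b\<in>Basis. (if 0 < (y - l) \<bullet> b then 1 else 0) * (if 0 < (u - y) \<bullet> b then 1 else 0))"
    unfolding bump_def by (intro tendsto_prod tendsto_mult flat_exp_scaled_tendsto)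
  moreover have "(\<Prod>b\<in>Basis. (if 0 < (y - l) \<bullet> b then 1 else 0) * (if 0 < (u - y) \<bullet> b then 1 else 0))
      = (indicator (box l u) y :: real)"
  proof (cases "y \<in> box l u")
    case True
    then show ?thesis by (auto simp: mem_box inner_diff_left intro!: prod.neutral)
  next
    case False
    then obtain b where "b \<in> Basis" "\<not> (0 < (y - l) \<bullet> b \<and> 0 < (u - y) \<bullet> b)"
      by (auto simp: mem_box inner_diff_left)
    then show ?thesis using False by (auto intro!: prod_zero bexI[of _ b])
  qed
  ultimately show ?thesis by simp
qed

section \<open>Lebesgue measure in orthonormal coordinates\<close>

lemma nn_integral_lborel_translate:
  fixes h :: "'a::euclidean_space \<Rightarrow> ennreal"
  assumes [measurable]: "h \<in> borel_measurable borel"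
  shows "(\<integral>\<^sup>+ x. h (a + x) \<partial>lborel) = (\<integral>\<^sup>+ x. h x \<partial>lborel)"
proof -
  have "(\<integral>\<^sup>+ x. h x \<partial>distr lborel borel ((+) a)) = (\<integral>\<^sup>+ x. h (a + x) \<partial>lborel)"
    by (rule nn_integral_distr) auto
  then show ?thesis by (simp only: lborel_distr_plus)
qed

text \<open>On boxes this is translation invariance in each coordinate, and boxes determine the
  product measure. The restriction to \<open>B\<close> keeps shifted tuples extensional, as points
  of the product space must be.\<close>

lemma distr_PiM_lborel_translate:
  fixes B :: "'i set" and c :: "'i \<Rightarrow> real"
  assumes B: "finite B"
  shows "distr (\<Pi>\<^sub>M b\<in>B. lborel) (\<Pi>\<^sub>M b\<in>B. lborel) (\<lambda>f. \<lambda>b\<in>B. f b + c b) = (\<Pi>\<^sub>M b\<in>B. lborel)"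
proof -
  interpret P: product_sigma_finite "\<lambda>_::'i. lborel :: real measure" ..
  show ?thesis
  proof (rule P.PiM_eqI[OF B])
    fix A assume A: "\<And>i. i \<in> B \<Longrightarrow> A i \<in> sets (lborel :: real measure)"
    have 1: "(\<lambda>f. \<lambda>b\<in>B. f b + c b) -` Pi\<^sub>E B A \<inter> space (\<Pi>\<^sub>M b\<in>B. (lborel::real measure))
        = Pi\<^sub>E B (\<lambda>b. (\<lambda>t. c b + t) -` A b)"
      by (auto simp: space_PiM PiE_iff add.commute)
    have 2: "emeasure lborel ((\<lambda>t. c b + t) -` A b) = emeasure lborel (A b)" if "b \<in> B" for b
    proof -
      have "emeasure (distr lborel borel ((+) (c b))) (A b) = emeasure lborel ((\<lambda>t. c b + t) -` A b)"
        using A[OF that] by (subst emeasure_distr) auto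
      then show ?thesis by (simp only: lborel_distr_plus)
    qed
    have 3: "(\<lambda>t. c b + t) -` A b \<in> sets lborel" if "b \<in> B" for b
      using A[OF that] measurable_sets[of "(+) (c b)" borel borel "A b"] by simp
    show "emeasure (distr (\<Pi>\<^sub>M b\<in>B. lborel) (\<Pi>\<^sub>M b\<in>B. lborel) (\<lambda>f. \<lambda>b\<in>B. f b + c b)) (Pi\<^sub>E B A)
        = (\<Prod>i\<in>B. emeasure lborel (A i))"
    proof -
      have "emeasure (\<Pi>\<^sub>M b\<in>B. lborel) (Pi\<^sub>E B (\<lambda>b. (\<lambda>t. c b + t) -` A b)) = (\<Prod>i\<in>B. emeasure lborel (A i))"
        using 3 by (simp add: P.emeasure_PiM[OF B] 2)
      then show ?thesis using A B by (subst emeasure_distr) (auto simp: 1 sets_PiM_I_finite)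
    qed
  qed simp
qed

text \<open>
  Uniqueness of Haar measure: integrating \<open>h (T f) * indicator B (y - T f)\<close> in both orders shows that the
  image of \<open>Q\<close> under \<open>T\<close> is a multiple of Lebesgue measure.
\<close>

lemma translation_invariant_nn_integral:
  fixes T :: "'b \<Rightarrow> 'a::euclidean_space" and h :: "'a \<Rightarrow> ennreal"
  assumes Q: "sigma_finite_measure Q" and T[measurable]: "T \<in> borel_measurable Q"
    and inv: "\<And>c h. h \<in> borel_measurable borel \<Longrightarrow> (\<integral>\<^sup>+ f. h (T f + c) \<partial>Q) = (\<integral>\<^sup>+ f. h (T f) \<partial>Q)"
    and h[measurable]: "h \<in> borel_measurable borel" and B[measurable]: "B \<in> sets borel"
  shows "(\<integral>\<^sup>+ f. h (T f) \<partial>Q) * emeasure lborel B =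
    (\<integral>\<^sup>+ f. indicator B (- T f) \<partial>Q) * (\<integral>\<^sup>+ x. h x \<partial>lborel)"
proof -
  interpret Q: sigma_finite_measure Q by fact
  interpret QL: pair_sigma_finite Q "lborel :: 'a measure" ..
  have "(\<integral>\<^sup>+ f. h (T f) \<partial>Q) * emeasure lborel B = (\<integral>\<^sup>+ f. \<integral>\<^sup>+ y. h (T f) * indicator B y \<partial>lborel \<partial>Q)"
    by (simp add: nn_integral_cmult nn_integral_multc)
  also have "\<dots> = (\<integral>\<^sup>+ f. \<integral>\<^sup>+ y. h (T f) * indicator B (y - T f) \<partial>lborel \<partial>Q)"
    using nn_integral_lborel_translate[where h = "\<lambda>y. h (T f) * indicator B y" and a = "- T f" for f]
    by simp
  also have "\<dots> = (\<integral>\<^sup>+ y. \<integral>\<^sup>+ f. h (T f) * indicator B (y - T f) \<partial>Q \<partial>lborel)"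
    by (rule QL.Fubini'[symmetric]) measurable
  also have "\<dots> = (\<integral>\<^sup>+ y. \<integral>\<^sup>+ f. h (T f + y) * indicator B (- T f) \<partial>Q \<partial>lborel)"
    using inv[where h = "\<lambda>x. h x * indicator B (y - x)" and c = y for y] by simp
  also have "\<dots> = (\<integral>\<^sup>+ f. \<integral>\<^sup>+ y. h (T f + y) * indicator B (- T f) \<partial>lborel \<partial>Q)"
    by (rule QL.Fubini') measurable
  also have "\<dots> = (\<integral>\<^sup>+ f. \<integral>\<^sup>+ y. h y * indicator B (- T f) \<partial>lborel \<partial>Q)"
    using nn_integral_lborel_translate[where h = "\<lambda>y. h y * indicator B (- T f)" and a = "T f" for f]
    by simp
  also have "\<dots> = (\<integral>\<^sup>+ f. indicator B (- T f) \<partial>Q) * (\<integral>\<^sup>+ x. h x \<partial>lborel)"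
    by (simp add: nn_integral_cmult nn_integral_multc mult.commute)
  finally show ?thesis .
qed

section \<open>Orthonormal coordinates\<close>

definition frame_sum :: "'a::euclidean_space set \<Rightarrow> ('a \<Rightarrow> real) \<Rightarrow> 'a" where
  "frame_sum B f = (\<Sum>b\<in>B. f b *\<^sub>R b)"

lemma measurable_frame_sum: "frame_sum B \<in> borel_measurable (\<Pi>\<^sub>M b\<in>B. lborel)"
  unfolding frame_sum_def[abs_def] by measurable

lemma orthonormal_basis_of_finite: "orthonormal_basis_of V B \<Longrightarrow> finite B"
  by (auto simp: orthonormal_basis_of_def intro: pairwise_orthogonal_imp_finite)

lemma inner_frame_sum:
  assumes "orthonormal_basis_of V B" "b \<in> B"
  shows "frame_sum B f \<bullet> b = f b"
proof -
  have "frame_sum B f \<bullet> b = (\<Sum>c\<in>B. if c = b then f c else 0)"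
    unfolding frame_sum_def inner_sum_left
  proof (rule sum.cong[OF refl])
    fix c assume "c \<in> B"
    then show "f c *\<^sub>R c \<bullet> b = (if c = b then f c else 0)"
      using assms by (auto simp: orthonormal_basis_of_def pairwise_def orthogonal_def norm_eq_1)
  qed
  then show ?thesis using orthonormal_basis_of_finite[OF assms(1)] assms(2) by (simp add: sum.delta)
qed

lemma frame_sum_eqI:
  assumes B: "orthonormal_basis_of V B" and x: "x \<in> V"
  shows "frame_sum B (\<lambda>b. x \<bullet> b) = x"
proof -
  have fin: "finite B" by (rule orthonormal_basis_of_finite[OF B])
  have "x \<in> span B" using B x by (simp add: orthonormal_basis_of_def)
  then obtain g where g: "x = frame_sum B g"
    using span_finite[OF fin] by (auto simp: frame_sum_def)
  show ?thesis
    unfolding frame_sum_def[of B "\<lambda>b. x \<bullet> b"] using inner_frame_sum[OF B] by (simp add: g) (simp add: frame_sum_def)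
qed

text \<open>The image of the product measure under \<open>frame_sum B\<close> is translation
  invariant, because shifting by \<open>c\<close> shifts the coordinates by the inner products
  \<open>c \<bullet> b\<close>. Uniqueness of Haar measure then gives proportionality, and it
  remains to see that the factor is neither 0 nor infinite.\<close>

lemma lborel_eq_orthonormal_product:
  fixes B :: "'a::euclidean_space set"
  assumes B: "orthonormal_basis_of UNIV B"
  obtains c where "0 < c" "c < \<infinity>"
    "\<And>h. h \<in> borel_measurable borel \<Longrightarrow>
      (\<integral>\<^sup>+ x. h x \<partial>lborel) = c * (\<integral>\<^sup>+ f. h (frame_sum B f) \<partial>(\<Pi>\<^sub>M b\<in>B. lborel))"
proof -
  have fin: "finite B" by (rule orthonormal_basis_of_finite[OF B])
  interpret P: product_sigma_finite "\<lambda>_::'a. lborel :: real measure" ..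
  let ?Q = "\<Pi>\<^sub>M b\<in>B. (lborel :: real measure)"
  have Q: "sigma_finite_measure ?Q" by (rule P.sigma_finite[OF fin])
  note T[measurable] = measurable_frame_sum[of B]
  have inv: "(\<integral>\<^sup>+ f. h (frame_sum B f + c) \<partial>?Q) = (\<integral>\<^sup>+ f. h (frame_sum B f) \<partial>?Q)"
    if [measurable]: "h \<in> borel_measurable borel" for c and h :: "'a \<Rightarrow> ennreal"
  proof -
    have *: "(\<lambda>f. \<lambda>b\<in>B. f b + c \<bullet> b) \<in> ?Q \<rightarrow>\<^sub>M ?Q" by measurable
    have "frame_sum B f + c = frame_sum B (\<lambda>b\<in>B. f b + c \<bullet> b)" for f
      using frame_sum_eqI[OF B UNIV_I, of c]
      by (simp add: frame_sum_def scaleR_add_left sum.distrib)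
    then have "(\<integral>\<^sup>+ f. h (frame_sum B f + c) \<partial>?Q) =
        (\<integral>\<^sup>+ f. h (frame_sum B f) \<partial>distr ?Q ?Q (\<lambda>f. \<lambda>b\<in>B. f b + c \<bullet> b))"
      by (subst nn_integral_distr[OF *]) simp_all
    then show ?thesis by (simp only: distr_PiM_lborel_translate[OF fin])
  qed
  \<comment> \<open>The reference set for the comparison: its volume is positive and finite, and its
    boundedness controls the coordinates.\<close>
  let ?K = "box (- One) One :: 'a set"
  have K: "?K \<in> sets borel" by simp
  define q where "q = (\<integral>\<^sup>+ f. indicator ?K (- frame_sum B f) \<partial>?Q)"
  define N where "N = emeasure lborel ?K"
  have N: "N > 0" "N < \<infinity>"
    unfolding N_def
    by (auto simp: emeasure_lborel_box_eq inner_add_left intro!: prod_pos)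
  have eq: "(\<integral>\<^sup>+ f. h (frame_sum B f) \<partial>?Q) * N = q * (\<integral>\<^sup>+ x. h x \<partial>lborel)"
    if "h \<in> borel_measurable borel" for h
    unfolding q_def N_def by (rule translation_invariant_nn_integral[OF Q T inv that K])
  obtain R where R: "\<And>x. x \<in> ?K \<Longrightarrow> norm x \<le> R"
    using bounded_box[of "- One :: 'a" One] unfolding bounded_iff by blast
  \<comment> \<open>A coordinate is the inner product with a unit vector, so the coordinates of
    points of the bounded set lie in a cube, which has finite product measure.\<close>
  have "q \<le> (\<integral>\<^sup>+ f. indicator (Pi\<^sub>E B (\<lambda>_. {-R..R})) f \<partial>?Q)"
    unfolding q_def
  proof (rule nn_integral_mono)
    fix f assume f: "f \<in> space ?Q"
    have "f \<in> Pi\<^sub>E B (\<lambda>_. {-R..R})" if "- frame_sum B f \<in> ?K"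
    proof (rule PiE_I)
      fix b assume b: "b \<in> B"
      have "\<bar>frame_sum B f \<bullet> b\<bar> \<le> norm (frame_sum B f) * norm b"
        by (rule Cauchy_Schwarz_ineq2)
      also have "\<dots> \<le> R"
        using R[OF that] B b by (simp add: orthonormal_basis_of_def)
      finally show "f b \<in> {-R..R}" by (auto simp: inner_frame_sum[OF B b])
    qed (use f in \<open>auto simp: space_PiM PiE_iff extensional_def\<close>)
    then show "indicator ?K (- frame_sum B f) \<le> (indicator (Pi\<^sub>E B (\<lambda>_. {-R..R})) f :: ennreal)"
      by (auto simp: indicator_def)
  qed
  also have "\<dots> = emeasure ?Q (Pi\<^sub>E B (\<lambda>_. {-R..R}))"
    using fin by (intro nn_integral_indicator sets_PiM_I_finite) auto
  also have "\<dots> < \<infinity>"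
    using fin by (subst P.emeasure_PiM) (auto simp: emeasure_lborel_Icc_eq ennreal_power)
  finally have q_fin: "q < \<infinity>" .
  \<comment> \<open>If \<open>q\<close> were 0, testing with the constant 1 would make the total
    mass of the product space 0; that mass is a product of infinite factors.\<close>
  have q_pos: "q \<noteq> 0"
  proof
    assume "q = 0"
    with eq[of "\<lambda>_. 1"] have "emeasure ?Q (space ?Q) * N = 0" by simp
    moreover have "emeasure ?Q (space ?Q) = (\<Prod>b\<in>B. \<infinity>)"
      using P.emeasure_PiM[OF fin, of "\<lambda>_. UNIV"] by (simp add: space_PiM)
    ultimately show False using N fin by simp
  qed
  show thesis
  proof (rule that[of "N / q"])
    show "0 < N / q" "N / q < \<infinity>"
      using N q_fin q_pos by (simp_all add: ennreal_divide_eq_top_iff less_top[symmetric] ennreal_zero_less_divide)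
    fix h :: "'a \<Rightarrow> ennreal" assume "h \<in> borel_measurable borel"
    from eq[OF this] have "(\<integral>\<^sup>+ x. h x \<partial>lborel) * q / q = (\<integral>\<^sup>+ f. h (frame_sum B f) \<partial>?Q) * N / q"
      by (simp add: mult.commute)
    moreover have "(\<integral>\<^sup>+ x. h x \<partial>lborel) * q / q = (\<integral>\<^sup>+ x. h x \<partial>lborel)"
      using q_pos q_fin by (intro ennreal_mult_divide_eq) auto
    moreover have "(\<integral>\<^sup>+ f. h (frame_sum B f) \<partial>?Q) * N / q = N / q * (\<integral>\<^sup>+ f. h (frame_sum B f) \<partial>?Q)"
      by (subst ennreal_times_divide[symmetric]) (rule mult.commute)
    ultimately show "(\<integral>\<^sup>+ x. h x \<partial>lborel) = N / q * (\<integral>\<^sup>+ f. h (frame_sum B f) \<partial>?Q)"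
      by simp
  qed
qed

section \<open>Fubini along the lines of a fixed direction\<close>

lemma hyperplane_lborel_frame:
  obtains B where "orthonormal_basis_of (hyperplane \<theta>) B"
    "hyperplane_lborel \<theta> = distr (\<Pi>\<^sub>M b\<in>B. lborel) (restrict_space borel (hyperplane \<theta>)) (frame_sum B)"
  using someI_ex[OF orthonormal_basis_of_hyperplane[of \<theta>]]
  unfolding hyperplane_lborel_def Let_def frame_sum_def[abs_def] by blast

lemma sets_hyperplane_lborel: "sets (hyperplane_lborel \<theta>) = sets (restrict_space borel (hyperplane \<theta>))"
  by (simp add: hyperplane_lborel_def Let_def)

lemma measurable_hyperplane_lborel:
  assumes "f \<in> M \<rightarrow>\<^sub>M N" "sets M = sets borel" shows "f \<in> hyperplane_lborel \<theta> \<rightarrow>\<^sub>M N"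
proof -
  have "sets (hyperplane_lborel \<theta>) = sets (restrict_space M (hyperplane \<theta>))"
    using assms(2) by (simp add: sets_hyperplane_lborel sets_restrict_space)
  from measurable_cong_sets[OF this refl] measurable_restrict_space1[OF assms(1)] show ?thesis
    by blast
qed

lemma insert_orthonormal_basis_of_hyperplane:
  assumes \<theta>: "norm \<theta> = 1" and B: "orthonormal_basis_of (hyperplane \<theta>) B"
  shows "\<theta> \<notin> B" "orthonormal_basis_of UNIV (insert \<theta> B)"
proof -
  have B': "B \<subseteq> hyperplane \<theta>" "pairwise orthogonal B" "\<And>b. b \<in> B \<Longrightarrow> norm b = 1" "span B = hyperplane \<theta>"
    using B by (auto simp: orthonormal_basis_of_def)
  have \<theta>\<theta>: "\<theta> \<bullet> \<theta> = 1" using \<theta> by (simp add: norm_eq_1)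
  show "\<theta> \<notin> B" using B'(1) \<theta>\<theta> by (auto simp: hyperplane_def)
  have "x \<in> span (insert \<theta> B)" for x
  proof -
    have "x - (x \<bullet> \<theta>) *\<^sub>R \<theta> \<in> span B"
      unfolding B'(4) using \<theta>\<theta> by (simp add: hyperplane_def inner_diff_left)
    then show ?thesis unfolding span_insert by blast
  qed
  then show "orthonormal_basis_of UNIV (insert \<theta> B)"
    unfolding orthonormal_basis_of_def using B' \<theta>
    by (auto simp: pairwise_insert orthogonal_def hyperplane_def inner_commute)
qed

text \<open>Adding \<theta> to the orthonormal basis chosen inside \<open>hyperplane_lborel\<close>
  gives an orthonormal basis of the whole space, and the product measure splits off the coordinate
  of \<theta>. The factor \<open>c\<close> is the one from the comparison of \<open>lborel\<close>
  with the product measure.\<close>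

lemma lborel_fubini_hyperplane:
  fixes \<theta> :: "'a::euclidean_space"
  assumes \<theta>: "norm \<theta> = 1"
  obtains c where "0 < c" "c < \<infinity>"
    "\<And>h. h \<in> borel_measurable borel \<Longrightarrow>
      (\<integral>\<^sup>+ x. h x \<partial>lborel) = c * (\<integral>\<^sup>+ y. \<integral>\<^sup>+ s. h (s *\<^sub>R \<theta> + y) \<partial>lborel \<partial>hyperplane_lborel \<theta>)"
proof -
  obtain B where B: "orthonormal_basis_of (hyperplane \<theta>) B" and
    H: "hyperplane_lborel \<theta> = distr (\<Pi>\<^sub>M b\<in>B. lborel) (restrict_space borel (hyperplane \<theta>)) (frame_sum B)"
    by (rule hyperplane_lborel_frame)
  note fin = orthonormal_basis_of_finite[OF B]
  note ins = insert_orthonormal_basis_of_hyperplane[OF \<theta> B]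
  interpret P: product_sigma_finite "\<lambda>_::'a. lborel :: real measure" ..
  have "frame_sum B f \<in> span B" for f
    unfolding frame_sum_def by (intro span_sum span_scale span_base)
  then have "frame_sum B f \<in> hyperplane \<theta>" for f
    using B by (simp add: orthonormal_basis_of_def)
  then have T: "frame_sum B \<in> (\<Pi>\<^sub>M b\<in>B. lborel) \<rightarrow>\<^sub>M restrict_space borel (hyperplane \<theta>)"
    by (intro measurable_restrict_space2 measurable_frame_sum) auto
  obtain c where c: "0 < c" "c < \<infinity>" "\<And>h. h \<in> borel_measurable borel \<Longrightarrow>
      (\<integral>\<^sup>+ x. h x \<partial>lborel) = c * (\<integral>\<^sup>+ f. h (frame_sum (insert \<theta> B) f) \<partial>(\<Pi>\<^sub>M b\<in>insert \<theta> B. lborel))"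
    using lborel_eq_orthonormal_product[OF ins(2)] by blast
  show thesis
  proof (rule that[OF c(1,2)])
    fix h :: "'a \<Rightarrow> ennreal" assume h[measurable]: "h \<in> borel_measurable borel"
    have fr: "frame_sum (insert \<theta> B) (f(\<theta> := s)) = s *\<^sub>R \<theta> + frame_sum B f" for f s
      using ins(1) fin by (auto simp: frame_sum_def intro!: sum.cong)
    have "(\<integral>\<^sup>+ f. h (frame_sum (insert \<theta> B) f) \<partial>(\<Pi>\<^sub>M b\<in>insert \<theta> B. lborel)) =
        (\<integral>\<^sup>+ f. \<integral>\<^sup>+ s. h (s *\<^sub>R \<theta> + frame_sum B f) \<partial>lborel \<partial>(\<Pi>\<^sub>M b\<in>B. lborel))"
      using fin ins(1) measurable_compose[OF measurable_frame_sum h]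
      by (subst P.product_nn_integral_insert) (auto simp: fr)
    also have "\<dots> = (\<integral>\<^sup>+ y. \<integral>\<^sup>+ s. h (s *\<^sub>R \<theta> + y) \<partial>lborel \<partial>hyperplane_lborel \<theta>)"
      unfolding H by (subst nn_integral_distr[OF T]) (auto intro!: measurable_restrict_space1)
    finally show "(\<integral>\<^sup>+ x. h x \<partial>lborel) = c * (\<integral>\<^sup>+ y. \<integral>\<^sup>+ s. h (s *\<^sub>R \<theta> + y) \<partial>lborel \<partial>hyperplane_lborel \<theta>)"
      using c(3)[OF h] by simp
  qed
qed

text \<open>Fubini is applied to a Borel null set containing the exceptional points, which allows an
  arbitrary predicate \<open>P\<close>.\<close>

lemma AE_line:
  fixes \<theta> :: "'a::euclidean_space"
  assumes \<theta>: "norm \<theta> = 1" and P: "AE x in lborel. P x"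
  shows "AE y in hyperplane_lborel \<theta>. AE s in lborel. P (s *\<^sub>R \<theta> + y)"
proof -
  obtain N where N: "{x. \<not> P x} \<subseteq> N" "N \<in> null_sets lborel"
    using P by (auto simp: eventually_ae_filter)
  then have [measurable]: "N \<in> sets borel" by auto
  obtain c where c: "0 < c" "c < \<infinity>" "\<And>h. h \<in> borel_measurable borel \<Longrightarrow>
      (\<integral>\<^sup>+ x. h x \<partial>lborel) = c * (\<integral>\<^sup>+ y. \<integral>\<^sup>+ s. h (s *\<^sub>R \<theta> + y) \<partial>lborel \<partial>hyperplane_lborel \<theta>)"
    using lborel_fubini_hyperplane[OF \<theta>] by blast
  have "(\<integral>\<^sup>+ x. indicator N x \<partial>lborel) = 0" using N by (simp add: null_setsD1)
  then have "(\<integral>\<^sup>+ y. \<integral>\<^sup>+ s. indicator N (s *\<^sub>R \<theta> + y) \<partial>lborel \<partial>hyperplane_lborel \<theta>) = 0"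
    using c(1) by (subst (asm) c(3)) auto
  moreover have "(\<lambda>y. \<integral>\<^sup>+ s. indicator N (s *\<^sub>R \<theta> + y) \<partial>lborel) \<in> borel_measurable (hyperplane_lborel \<theta>)"
    by (rule measurable_hyperplane_lborel[of _ borel]) auto
  ultimately have "AE y in hyperplane_lborel \<theta>. (\<integral>\<^sup>+ s. indicator N (s *\<^sub>R \<theta> + y) \<partial>lborel) = 0"
    by (simp add: nn_integral_0_iff_AE)
  then show ?thesis
  proof (rule AE_mp[OF _ AE_I2[OF impI]])
    fix y assume "(\<integral>\<^sup>+ s. indicator N (s *\<^sub>R \<theta> + y) \<partial>lborel) = 0"
    then have "AE s in lborel. indicator N (s *\<^sub>R \<theta> + y) = (0::ennreal)"
      by (subst (asm) nn_integral_0_iff_AE) auto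
    then show "AE s in lborel. P (s *\<^sub>R \<theta> + y)"
      by (rule AE_mp) (use N in \<open>auto simp: indicator_eq_0_iff\<close>)
  qed
qed

text \<open>The positive and negative parts of \<open>W\<close>, taken as densities and pushed
  forward by \<open>X\<close>, agree on boxes, which are stable under intersection and generate the
  Borel sets. Since \<open>ennreal\<close> sends negative numbers to 0, the two parts are
  \<open>ennreal (W x)\<close> and \<open>ennreal (- W x)\<close>. It is applied with
  \<open>X\<close> the identity and with \<open>X\<close> the projection onto the
  hyperplane.\<close>

lemma integral_boxes_zero_imp:
  fixes X :: "'b \<Rightarrow> 'a::euclidean_space" and W :: "'b \<Rightarrow> real"
  assumes W: "integrable M W" and X[measurable]: "X \<in> borel_measurable M"
    and 0: "\<And>l u. (\<integral>x. W x * indicator (box l u) (X x) \<partial>M) = 0"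
    and S: "S \<in> sets borel"
  shows "(\<integral>\<^sup>+x. ennreal (W x) * indicator S (X x) \<partial>M) = (\<integral>\<^sup>+x. ennreal (- W x) * indicator S (X x) \<partial>M)"
proof -
  have [measurable]: "W \<in> borel_measurable M" using W by simp
  define D where "D = (\<lambda>V. distr (density M (\<lambda>x. ennreal (V x))) borel X)"
  have D: "emeasure (D V) S = (\<integral>\<^sup>+x. ennreal (V x) * indicator S (X x) \<partial>M)"
    if [measurable]: "V \<in> borel_measurable M" "S \<in> sets borel" for V S
  proof -
    have "emeasure (D V) S = emeasure (density M (\<lambda>x. ennreal (V x))) (X -` S \<inter> space M)"
      unfolding D_def by (subst emeasure_distr) auto
    also have "\<dots> = (\<integral>\<^sup>+x. ennreal (V x) * indicator (X -` S \<inter> space M) x \<partial>M)"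
      by (rule emeasure_density) measurable
    also have "\<dots> = (\<integral>\<^sup>+x. ennreal (V x) * indicator S (X x) \<partial>M)"
      by (rule nn_integral_cong) (auto simp: indicator_def)
    finally show ?thesis .
  qed
  \<comment> \<open>Finiteness serves twice: to pass from a vanishing real difference to equal
    extended values, and for the exhausting boxes in the uniqueness theorem for measures.\<close>
  have fin: "(\<integral>\<^sup>+x. ennreal (V x) * indicator (box l u) (X x) \<partial>M) \<noteq> \<infinity>"
    if V: "integrable M V" for V l u
  proof -
    have "(\<integral>\<^sup>+x. ennreal (V x) * indicator (box l u) (X x) \<partial>M) \<le> (\<integral>\<^sup>+x. ennreal (norm (V x)) \<partial>M)"
      by (intro nn_integral_mono) (auto simp: indicator_def ennreal_leI)
    also have "\<dots> < \<infinity>" using V by (simp add: integrable_iff_bounded)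
    finally show ?thesis by simp
  qed
  have eq: "emeasure (D W) (box l u) = emeasure (D (\<lambda>x. - W x)) (box l u)" for l u
  proof -
    have I: "integrable M (\<lambda>x. W x * indicator (box l u) (X x))"
      by (rule Bochner_Integration.integrable_bound[OF W]) (auto simp: indicator_def)
    have e: "ennreal (V x * indicator (box l u) (X x)) = ennreal (V x) * indicator (box l u) (X x)"
      for V :: "'b \<Rightarrow> real" and x by (auto simp: indicator_def)
    have "(\<integral>x. W x * indicator (box l u) (X x) \<partial>M) =
        enn2real (\<integral>\<^sup>+x. ennreal (W x) * indicator (box l u) (X x) \<partial>M) -
        enn2real (\<integral>\<^sup>+x. ennreal (- W x) * indicator (box l u) (X x) \<partial>M)"
      using real_lebesgue_integral_def[OF I] e[of W] e[of "\<lambda>x. - W x"] by simp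
    then have "enn2real (\<integral>\<^sup>+x. ennreal (W x) * indicator (box l u) (X x) \<partial>M) =
        enn2real (\<integral>\<^sup>+x. ennreal (- W x) * indicator (box l u) (X x) \<partial>M)"
      using 0[of l u] by simp
    moreover have "integrable M (\<lambda>x. - W x)" using W by simp
    moreover have "a = b" if "enn2real a = enn2real b" "a \<noteq> \<infinity>" "b \<noteq> \<infinity>" for a b :: ennreal
      using that by (cases a; cases b) auto
    ultimately show ?thesis
      using fin[OF W, of l u] fin[of "\<lambda>x. - W x" l u] by (simp add: D[of _ "box l u"])
  qed
  have "D W = D (\<lambda>x. - W x)"
  proof (rule measure_eqI_generator_eq[where E = "range (\<lambda>(l, u). box l u :: 'a set)" and \<Omega> = UNIV
        and A = "\<lambda>n. box (- real n *\<^sub>R One) (real n *\<^sub>R One)"])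
    show "Int_stable (range (\<lambda>(l, u). box l u :: 'a set))"
      by (auto simp: Int_stable_def box_Int_box)
    show "emeasure (D W) X = emeasure (D (\<lambda>x. - W x)) X" if "X \<in> range (\<lambda>(l, u). box l u)" for X
      using that eq by auto
    show "sets (D W) = sigma_sets UNIV (range (\<lambda>(l, u). box l u))"
      "sets (D (\<lambda>x. - W x)) = sigma_sets UNIV (range (\<lambda>(l, u). box l u))"
      by (simp_all add: D_def borel_eq_box)
    show "(\<Union>n. box (- real n *\<^sub>R One) (real n *\<^sub>R One)) = (UNIV :: 'a set)"
      using UN_box_eq_UNIV by auto
    show "emeasure (D W) (box (- real n *\<^sub>R One) (real n *\<^sub>R One)) \<noteq> \<infinity>" for n
      using fin[OF W] by (simp add: D)
  qed auto
  then show ?thesis using D[of W S] D[of "\<lambda>x. - W x" S] S by simp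
qed

section \<open>Functions of one variable\<close>

text \<open>Written with an indicator, it is a parametrised integral, to which measurability, Fubini
  and dominated convergence apply directly. To the left of \<alpha> it is 0, not a signed
  integral.\<close>

definition primitive :: "(real \<Rightarrow> real) \<Rightarrow> real \<Rightarrow> real \<Rightarrow> real" where
  "primitive v \<alpha> s = (\<integral>t. v t * indicator {\<alpha><..s} t \<partial>lborel)"

lemma measurable_primitive [measurable]:
  assumes [measurable]: "v \<in> borel_measurable borel"
  shows "primitive v \<alpha> \<in> borel_measurable borel"
proof -
  have "primitive v \<alpha> = (\<lambda>s. \<integral>t. v t * (if \<alpha> < t \<and> t \<le> s then 1 else 0) \<partial>lborel)"
    unfolding primitive_def by (intro ext Bochner_Integration.integral_cong) auto
  then show ?thesis by simp
qed

lemma primitive_bound: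
  assumes v: "integrable lborel v"
  shows "\<bar>primitive v \<alpha> s\<bar> \<le> (\<integral>t. \<bar>v t\<bar> \<partial>lborel)"
proof -
  have "\<bar>primitive v \<alpha> s\<bar> \<le> (\<integral>t. \<bar>v t * indicator {\<alpha><..s} t\<bar> \<partial>lborel)"
    unfolding primitive_def using integral_norm_bound[of lborel "\<lambda>t. v t * indicator {\<alpha><..s} t"] by simp
  also have "\<dots> \<le> (\<integral>t. \<bar>v t\<bar> \<partial>lborel)"
    using v by (intro integral_mono integrable_abs integrable_real_mult_indicator)
      (auto simp: indicator_def)
  finally show ?thesis .
qed

lemma continuous_on_primitive:
  assumes v: "integrable lborel v"
  shows "continuous_on S (primitive v \<alpha>)"
proof (rule continuous_on_sequentiallyI)
  fix u :: "nat \<Rightarrow> real" and a assume u: "u \<longlonglongrightarrow> a"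
  have [measurable]: "v \<in> borel_measurable borel" using v by auto
  show "(\<lambda>n. primitive v \<alpha> (u n)) \<longlonglongrightarrow> primitive v \<alpha> a"
    unfolding primitive_def
  proof (rule integral_dominated_convergence[where w = "\<lambda>t. \<bar>v t\<bar>"])
    show "AE t in lborel. (\<lambda>n. v t * indicator {\<alpha><..u n} t) \<longlonglongrightarrow> v t * indicator {\<alpha><..a} t"
      \<comment> \<open>The indicators may fail to converge only at \<open>t = a\<close>, where
        membership depends on the side from which \<open>u n\<close> approaches.\<close>
      using AE_lborel_singleton[of a]
    proof eventually_elim
      case (elim t)
      have "\<forall>\<^sub>F n in sequentially. v t * indicator {\<alpha><..u n} t = v t * indicator {\<alpha><..a} t"
      proof (cases "t < a")
        case True
        from order_tendstoD(1)[OF u this] show ?thesis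
          by eventually_elim (use True in \<open>auto simp: indicator_def\<close>)
      next
        case False
        with elim have "a < t" by simp
        from order_tendstoD(2)[OF u this] show ?thesis
          by eventually_elim (use \<open>a < t\<close> in \<open>auto simp: indicator_def\<close>)
      qed
      then show ?case by (rule tendsto_eventually)
    qed
  qed (use v in \<open>auto simp: indicator_def\<close>)
qed

lemma integrable_mult_bounded:
  fixes f g :: "'a \<Rightarrow> real"
  assumes "integrable M f" "g \<in> borel_measurable M" "\<And>x. \<bar>g x\<bar> \<le> C"
  shows "integrable M (\<lambda>x. f x * g x)"
proof (rule Bochner_Integration.integrable_bound)
  show "integrable M (\<lambda>x. C * \<bar>f x\<bar>)" using assms by simp
  show "AE x in M. norm (f x * g x) \<le> norm (C * \<bar>f x\<bar>)"
  proof (rule AE_I2)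
    fix x
    have "\<bar>g x\<bar> \<le> \<bar>C\<bar>" using assms(3)[of x] by simp
    then show "norm (f x * g x) \<le> norm (C * \<bar>f x\<bar>)"
      using mult_left_mono[of "\<bar>g x\<bar>" "\<bar>C\<bar>" "\<bar>f x\<bar>"] by (simp add: abs_mult mult.commute)
  qed
qed (use assms in auto)

section \<open>Compactly supported test functions on the line\<close>

lemma continuous_compact_support_bounded:
  fixes \<phi> :: "real \<Rightarrow> real"
  assumes "continuous_on UNIV \<phi>" "\<And>s. s \<notin> {p<..<q} \<Longrightarrow> \<phi> s = 0"
  obtains C where "\<And>s. \<bar>\<phi> s\<bar> \<le> C"
proof -
  have "bounded (\<phi> ` {p..q})"
    by (intro compact_imp_bounded compact_continuous_image continuous_on_subset[OF assms(1)]) auto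
  then obtain C where C: "\<And>s. s \<in> {p..q} \<Longrightarrow> \<bar>\<phi> s\<bar> \<le> C"
    by (fastforce simp: bounded_iff)
  have "\<bar>\<phi> s\<bar> \<le> max C 0" for s
    using C[of s] assms(2)[of s] by (cases "s \<in> {p..q}") (auto simp: max_def)
  then show thesis by (rule that)
qed

lemma continuous_compact_support_integrable:
  fixes \<phi> :: "real \<Rightarrow> real"
  assumes "continuous_on UNIV \<phi>" "\<And>s. s \<notin> {p<..<q} \<Longrightarrow> \<phi> s = 0"
  shows "integrable lborel \<phi>"
proof -
  have [measurable]: "\<phi> \<in> borel_measurable borel"
    using assms(1) by (rule borel_measurable_continuous_onI)
  obtain C where C: "\<And>s. \<bar>\<phi> s\<bar> \<le> C"
    using continuous_compact_support_bounded[OF assms] by blast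
  have "integrable lborel (\<lambda>s. indicator {p..q} s * \<phi> s)"
    by (rule integrable_mult_bounded[OF _ _ C]) (auto simp: integrable_indicator_iff emeasure_lborel_Icc_eq)
  moreover have "(\<lambda>s. indicator {p..q} s * \<phi> s) = \<phi>"
  proof
    show "indicator {p..q} s * \<phi> s = \<phi> s" for s
      using assms(2)[of s] by (cases "s \<in> {p<..<q}") auto
  qed
  ultimately show ?thesis by simp
qed

text \<open>A one-dimensional test function \<open>A\<close> bundled with its derivative \<phi>.
  Keeping both as data avoids derivative operators in the weak identities, and the common interval
  records where both may be nonzero.\<close>

definition test_pair :: "real \<Rightarrow> real \<Rightarrow> (real \<Rightarrow> real) \<Rightarrow> (real \<Rightarrow> real) \<Rightarrow> bool" where
  "test_pair p q A \<phi> \<longleftrightarrow> p < q \<and> (\<forall>s. (A has_real_derivative \<phi> s) (at s)) \<and> continuous_on UNIV \<phi> \<and>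
    (\<forall>s. s \<notin> {p<..<q} \<longrightarrow> A s = 0 \<and> \<phi> s = 0)"

lemma test_pairD:
  assumes "test_pair p q A \<phi>"
  shows "p < q" "(A has_real_derivative \<phi> s) (at s)" "continuous_on S \<phi>" "continuous_on S A"
    "s \<notin> {p<..<q} \<Longrightarrow> A s = 0" "s \<notin> {p<..<q} \<Longrightarrow> \<phi> s = 0" "isCont \<phi> s"
    "\<phi> \<in> borel_measurable borel" "A \<in> borel_measurable borel"
proof -
  have A: "continuous_on UNIV A"
    using assms by (auto simp: test_pair_def intro!: continuous_at_imp_continuous_on DERIV_isCont)
  have \<phi>: "continuous_on UNIV \<phi>" using assms by (simp add: test_pair_def)
  show "continuous_on S \<phi>" "continuous_on S A"
    using A \<phi> continuous_on_subset by blast+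
  show "\<phi> \<in> borel_measurable borel" "A \<in> borel_measurable borel"
    using A \<phi> borel_measurable_continuous_onI by blast+
  show "isCont \<phi> s" using \<phi> by (simp add: continuous_on_eq_continuous_at)
qed (use assms in \<open>auto simp: test_pair_def\<close>)

lemma test_pair_tail_integral:
  assumes t: "test_pair p q A \<phi>"
  shows "(\<integral>s. \<phi> s * indicator {r..} s \<partial>lborel) = - A r"
proof -
  let ?q = "max q r"
  have "(\<integral>s. \<phi> s * indicator {r..?q} s \<partial>lborel) = A ?q - A r"
    by (rule integral_FTC_Icc_real) (use test_pairD[OF t] in auto)
  moreover have "\<phi> s * indicator {r..?q} s = \<phi> s * indicator {r..} s" for s
    using test_pairD(6)[OF t, of s] by (cases "q \<le> s") (auto simp: indicator_def)
  moreover have "A ?q = 0" using test_pairD(5)[OF t, of ?q] by auto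
  ultimately show ?thesis by simp
qed

text \<open>An antiderivative normalised to 0 at \<open>p\<close> vanishes to the left of
  \<open>p\<close>; vanishing integral of \<phi> is precisely what makes it vanish to the right of
  \<open>q\<close> as well.\<close>

lemma test_pair_exists:
  assumes cont: "continuous_on UNIV \<phi>" and pq: "p < q" and supp: "\<And>s. s \<notin> {p<..<q} \<Longrightarrow> \<phi> s = 0"
    and zero: "(\<integral>s. \<phi> s \<partial>lborel) = 0"
  obtains A where "test_pair p q A \<phi>"
proof -
  have isCont: "isCont \<phi> s" for s using cont by (simp add: continuous_on_eq_continuous_at)
  obtain F where "\<forall>x::real. - \<infinity> < ereal x \<longrightarrow> ereal x < \<infinity> \<longrightarrow> (F has_vector_derivative \<phi> x) (at x)"
    using einterval_antiderivative[of "- \<infinity>" \<infinity> \<phi>] isCont by auto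
  then have F: "(F has_real_derivative \<phi> x) (at x)" for x
    by (simp add: has_real_derivative_iff_has_vector_derivative)
  have FTC: "(\<integral>s. \<phi> s * indicator {a..b} s \<partial>lborel) = F b - F a" if "a \<le> b" for a b
    by (rule integral_FTC_Icc_real[OF that F isCont])
  have left: "F s = F p" if "s \<le> p" for s
  proof -
    have "(\<lambda>t. \<phi> t * indicator {s..p} t) = (\<lambda>t. 0)"
    proof
      show "\<phi> t * indicator {s..p} t = 0" for t
        using supp[of t] by (cases "t \<in> {p<..<q}") auto
    qed
    then show ?thesis using FTC[OF that] by simp
  qed
  have right: "F s = F p" if "q \<le> s" for s
  proof -
    have "(\<lambda>t. \<phi> t * indicator {p..s} t) = \<phi>"
    proof
      show "\<phi> t * indicator {p..s} t = \<phi> t" for t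
        using supp[of t] that by (cases "t \<in> {p<..<q}") auto
    qed
    then show ?thesis using FTC[of p s] that pq zero by simp
  qed
  have "test_pair p q (\<lambda>s. F s - F p) \<phi>"
    unfolding test_pair_def
  proof (intro conjI allI impI)
    show "((\<lambda>s. F s - F p) has_real_derivative \<phi> s) (at s)" for s
      using DERIV_diff[OF F[of s] DERIV_const[of "F p"]] by simp
    show "F s - F p = 0" if "s \<notin> {p<..<q}" for s using left[of s] right[of s] that by auto
  qed (use cont pq supp in auto)
  then show thesis by (rule that)
qed

text \<open>Fubini for v(r) \<phi>(s) on the region \<alpha> < r \<le> s: integrating over
  \<open>r\<close> gives the primitive, integrating over \<open>s\<close> gives the tail integral of
  \<phi> from \<open>r\<close>, which is \<open>- A r\<close>.\<close>

lemma integral_primitive_by_parts: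
  assumes v: "integrable lborel v" and t: "test_pair p q A \<phi>" and \<alpha>: "\<alpha> \<le> p"
  shows "(\<integral>s. primitive v \<alpha> s * \<phi> s \<partial>lborel) = - (\<integral>t. v t * A t \<partial>lborel)"
proof -
  have [measurable]: "v \<in> borel_measurable borel" using v by auto
  note [measurable] = test_pairD(8,9)[OF t]
  define f where "f = (\<lambda>(r, s). v r * (if \<alpha> < r \<and> r \<le> s then 1 else 0) * \<phi> s)"
  have \<phi>: "integrable lborel \<phi>"
    using continuous_compact_support_integrable[OF test_pairD(3)[OF t] test_pairD(6)[OF t]] .
  have f_meas: "f \<in> borel_measurable (lborel \<Otimes>\<^sub>M lborel)"
    unfolding f_def by measurable
  have bnd: "norm (f (r, s)) \<le> \<bar>v r\<bar> * \<bar>\<phi> s\<bar>" for r s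
    by (auto simp: f_def abs_mult)
  have int_f: "integrable (lborel \<Otimes>\<^sub>M lborel) f"
  proof (rule lborel_pair.Fubini_integrable[OF f_meas])
    have I: "integrable lborel (\<lambda>s. f (r, s))" for r
    proof (rule Bochner_Integration.integrable_bound)
      show "integrable lborel (\<lambda>s. \<bar>v r\<bar> * \<bar>\<phi> s\<bar>)" using \<phi> by simp
      show "(\<lambda>s. f (r, s)) \<in> borel_measurable lborel" by (rule measurable_compose_Pair1[OF _ f_meas]) simp
    qed (use bnd in auto)
    then show "AE r in lborel. integrable lborel (\<lambda>s. f (r, s))" by simp
    show "integrable lborel (\<lambda>r. \<integral>s. norm (f (r, s)) \<partial>lborel)"
    proof (rule Bochner_Integration.integrable_bound)
      show "integrable lborel (\<lambda>r. \<bar>v r\<bar> * (\<integral>s. \<bar>\<phi> s\<bar> \<partial>lborel))" using v by simp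
      show "(\<lambda>r. \<integral>s. norm (f (r, s)) \<partial>lborel) \<in> borel_measurable lborel"
        unfolding f_def by measurable
      have "(\<integral>s. norm (f (r, s)) \<partial>lborel) \<le> \<bar>v r\<bar> * (\<integral>s. \<bar>\<phi> s\<bar> \<partial>lborel)" for r
        using integral_mono[OF integrable_norm[OF I[of r]] _ bnd] \<phi> by simp
      then show "AE r in lborel. norm (\<integral>s. norm (f (r, s)) \<partial>lborel) \<le> norm (\<bar>v r\<bar> * (\<integral>s. \<bar>\<phi> s\<bar> \<partial>lborel))"
        by (simp add: abs_mult)
    qed
  qed
  have "(\<integral>s. primitive v \<alpha> s * \<phi> s \<partial>lborel) = (\<integral>s. \<integral>r. f (r, s) \<partial>lborel \<partial>lborel)"
  proof (rule Bochner_Integration.integral_cong[OF refl])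
    fix s
    have "primitive v \<alpha> s * \<phi> s = (\<integral>r. v r * indicator {\<alpha><..s} r * \<phi> s \<partial>lborel)"
      unfolding primitive_def by simp
    also have "\<dots> = (\<integral>r. f (r, s) \<partial>lborel)"
      by (rule Bochner_Integration.integral_cong) (auto simp: f_def)
    finally show "primitive v \<alpha> s * \<phi> s = (\<integral>r. f (r, s) \<partial>lborel)" .
  qed
  also have "\<dots> = (\<integral>r. \<integral>s. f (r, s) \<partial>lborel \<partial>lborel)"
    using lborel_pair.Fubini_integral[of "\<lambda>r s. f (r, s)"] int_f by simp
  also have "\<dots> = (\<integral>r. - (v r * A r) \<partial>lborel)"
  proof (rule Bochner_Integration.integral_cong[OF refl])
    fix r
    have "(\<integral>s. f (r, s) \<partial>lborel) = (\<integral>s. (if \<alpha> < r then v r else 0) * (\<phi> s * indicator {r..} s) \<partial>lborel)"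
      by (rule Bochner_Integration.integral_cong) (auto simp: f_def)
    also have "\<dots> = (if \<alpha> < r then v r else 0) * - A r"
      by (simp add: test_pair_tail_integral[OF t])
    \<comment> \<open>For r \<le> \<alpha> the truncation is harmless: then r \<le> p, where
      \<open>A\<close> vanishes.\<close>
    also have "\<dots> = - (v r * A r)"
      using test_pairD(5)[OF t, of r] \<alpha> by auto
    finally show "(\<integral>s. f (r, s) \<partial>lborel) = - (v r * A r)" .
  qed
  finally show ?thesis by simp
qed

text \<open>The two parts of \<open>W\<close> have equal mass on every Borel set. On the set where
  \<open>W\<close> is positive the negative part has no mass, so neither has the positive one;
  symmetrically where \<open>W\<close> is negative.\<close>

lemma AE_zero_if_box_integrals_zero:
  fixes W :: "'a::euclidean_space \<Rightarrow> real"
  assumes W: "integrable lborel W" and 0: "\<And>l u. (\<integral>x. W x * indicator (box l u) x \<partial>lborel) = 0"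
  shows "AE x in lborel. W x = 0"
proof -
  have [measurable]: "W \<in> borel_measurable borel" using W by auto
  have S: "{x. W x > 0} \<in> sets borel" "{x. W x < 0} \<in> sets borel" by measurable
  note * = integral_boxes_zero_imp[OF W _ 0]
  have z: "ennreal (- W x) * indicator {x. W x > 0} x = 0" "ennreal (W x) * indicator {x. W x < 0} x = 0" for x
    by (auto simp: indicator_def ennreal_neg)
  have "(\<integral>\<^sup>+x. ennreal (W x) * indicator {x. W x > 0} x \<partial>lborel) = 0"
    using *[OF _ S(1)] by (simp only: z) simp
  then have 1: "AE x in lborel. ennreal (W x) * indicator {x. W x > 0} x = 0"
    by (subst (asm) nn_integral_0_iff_AE) auto
  have "(\<integral>\<^sup>+x. ennreal (- W x) * indicator {x. W x < 0} x \<partial>lborel) = 0"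
    using *[OF _ S(2)] by (simp only: z) simp
  then have 2: "AE x in lborel. ennreal (- W x) * indicator {x. W x < 0} x = 0"
    by (subst (asm) nn_integral_0_iff_AE) auto
  from 1 2 show ?thesis
    by eventually_elim (auto simp: indicator_def ennreal_eq_0_iff split: if_splits)
qed

section \<open>The du Bois-Reymond argument\<close>

lemma bump_real_eq_0: "s \<notin> {a<..<b} \<Longrightarrow> bump n a b s = 0" for a b s :: real
  using bump_eq_0_iff[of n a b s] by simp

lemma integrable_bump: "integrable lborel (bump n a b)" for a b :: real
  by (rule continuous_compact_support_integrable[OF smooth_continuous_on[OF smooth_bump] bump_real_eq_0])

text \<open>Each bump is weighted by the integral of the other, which makes the mean zero. A
  function orthogonal to all of these has, in the limit of large \<open>n\<close>, the same average
  over the two intervals.\<close>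

definition zero_mean_bump :: "nat \<Rightarrow> real \<Rightarrow> real \<Rightarrow> real \<Rightarrow> real \<Rightarrow> real \<Rightarrow> real" where
  "zero_mean_bump n a b a' b' s =
    (\<integral>t. bump n a' b' t \<partial>lborel) * bump n a b s - (\<integral>t. bump n a b t \<partial>lborel) * bump n a' b' s"

lemma integral_mult_bump_tendsto:
  assumes K: "integrable lborel K"
  shows "(\<lambda>n. \<integral>s. K s * bump n a b s \<partial>lborel) \<longlonglongrightarrow> (\<integral>s. K s * indicator {a<..<b::real} s \<partial>lborel)"
proof (rule integral_dominated_convergence[where w = "\<lambda>s. \<bar>K s\<bar>"])
  have [measurable]: "K \<in> borel_measurable borel" "bump n a b \<in> borel_measurable borel" for n
    using K borel_measurable_continuous_onI[OF smooth_continuous_on[OF smooth_bump]] by auto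
  show "(\<lambda>s. K s * indicator {a<..<b} s) \<in> borel_measurable lborel"
    "\<And>n. (\<lambda>s. K s * bump n a b s) \<in> borel_measurable lborel" by auto
  show "AE s in lborel. (\<lambda>n. K s * bump n a b s) \<longlonglongrightarrow> K s * indicator {a<..<b} s"
    using tendsto_mult[OF tendsto_const bump_tendsto[of a b]] by (simp only: box_real) simp
  show "AE s in lborel. norm (K s * bump n a b s) \<le> \<bar>K s\<bar>" for n
    using bump_nonneg[of n a b] bump_le_1[of n a b] by (auto simp: abs_mult intro!: mult_left_le)
qed (use K in auto)

lemma integral_bump_tendsto:
  assumes "a \<le> b"
  shows "(\<lambda>n. \<integral>s. bump n a b s \<partial>lborel) \<longlonglongrightarrow> b - (a::real)"
proof -
  \<comment> \<open>The constant 1 is not integrable on the line; the indicator of the closed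
    interval replaces it, being 1 wherever the bump is nonzero.\<close>
  have "(\<lambda>n. \<integral>s. indicator {a..b} s * bump n a b s \<partial>lborel) \<longlonglongrightarrow>
      (\<integral>s. indicator {a..b} s * indicator {a<..<b} s \<partial>lborel)"
    by (rule integral_mult_bump_tendsto) (simp add: integrable_indicator_iff emeasure_lborel_Icc_eq)
  moreover have "(\<lambda>s. indicator {a..b} s * bump n a b s) = bump n a b" for n
  proof
    show "indicator {a..b} s * bump n a b s = bump n a b s" for s
      using bump_real_eq_0[of s a b n] by (cases "s \<in> {a<..<b}") auto
  qed
  moreover have "(\<lambda>s. indicator {a..b} s * indicator {a<..<b} s) = (indicator {a<..<b} :: real \<Rightarrow> real)"
    by (auto simp: indicator_def)
  ultimately show ?thesis using assms by simp
qed

lemma test_pair_zero_mean_bump: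
  assumes "a < b" "a' < b'"
  obtains A where "test_pair (min a a') (max b b') A (zero_mean_bump n a b a' b')"
proof (rule test_pair_exists)
  show "continuous_on UNIV (zero_mean_bump n a b a' b')"
    unfolding zero_mean_bump_def[abs_def]
    by (intro continuous_intros smooth_continuous_on[OF smooth_bump])
  show "min a a' < max b b'" using assms by auto
  show "zero_mean_bump n a b a' b' s = 0" if "s \<notin> {min a a'<..<max b b'}" for s
  proof -
    have "s \<notin> {a<..<b}" "s \<notin> {a'<..<b'}" using that by auto
    from bump_real_eq_0[OF this(1)] bump_real_eq_0[OF this(2)] show ?thesis
      by (simp add: zero_mean_bump_def)
  qed
  show "(\<integral>s. zero_mean_bump n a b a' b' s \<partial>lborel) = 0"
    unfolding zero_mean_bump_def by (simp add: integrable_bump)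
qed (rule that)

lemma smooth_zero_mean_bump: "smooth (zero_mean_bump n a b a' b')"
proof -
  have "zero_mean_bump n a b a' b' = (\<lambda>s. (\<integral>t. bump n a' b' t \<partial>lborel) * bump n a b s
      + (- (\<integral>t. bump n a b t \<partial>lborel)) * bump n a' b' s)"
    by (simp add: zero_mean_bump_def fun_eq_iff)
  then show ?thesis
    using C_k_add smooth_mult[OF smooth_const smooth_bump] unfolding smooth_def by metis
qed

text \<open>Every box meets ]\<alpha>,\<beta>[ in an interval that rational intervals lying strictly
  inside approximate from within, and dominated convergence carries the vanishing integral to the
  limit.\<close>

lemma AE_zero_if_rational_intervals:
  fixes g :: "real \<Rightarrow> real"
  assumes g: "integrable lborel g" and supp: "\<And>s. s \<notin> {\<alpha><..<\<beta>} \<Longrightarrow> g s = 0"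
    and 0: "\<And>a b. a \<in> \<rat> \<Longrightarrow> b \<in> \<rat> \<Longrightarrow> \<alpha> < a \<Longrightarrow> a < b \<Longrightarrow> b < \<beta> \<Longrightarrow> (\<integral>s. g s * indicator {a<..<b} s \<partial>lborel) = 0"
  shows "AE s in lborel. g s = 0"
proof (rule AE_zero_if_box_integrals_zero[OF g])
  have [measurable]: "g \<in> borel_measurable borel" using g by auto
  fix l u :: real
  define l' u' where "l' = max l \<alpha>" and "u' = min u \<beta>"
  have eq: "g s * indicator (box l u) s = g s * indicator {l'<..<u'} s" for s
    using supp[of s] by (cases "s \<in> {\<alpha><..<\<beta>}") (auto simp: l'_def u'_def indicator_def)
  show "(\<integral>s. g s * indicator (box l u) s \<partial>lborel) = 0"
  proof (cases "l' < u'")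
    case False
    then show ?thesis unfolding eq by simp
  next
    case True
    \<comment> \<open>Half the length: with error at most \<delta> on either side the two rational
      ends stay on opposite sides of the midpoint, already for n = 0.\<close>
    define \<delta> where "\<delta> = (u' - l') / 2"
    have \<delta>: "0 < \<delta>" "l' + \<delta> = u' - \<delta>" using True by (auto simp: \<delta>_def field_simps)
    have "\<exists>a\<in>\<rat>. l' < a \<and> a < l' + \<delta> / real (Suc n)" "\<exists>b\<in>\<rat>. u' - \<delta> / real (Suc n) < b \<and> b < u'" for n
      using \<delta>(1) by (auto intro!: Rats_dense_in_real)
    then obtain a b where a: "\<And>n. a n \<in> \<rat>" "\<And>n. l' < a n" "\<And>n. a n < l' + \<delta> / real (Suc n)"
      and b: "\<And>n. b n \<in> \<rat>" "\<And>n. u' - \<delta> / real (Suc n) < b n" "\<And>n. b n < u'"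
      by metis
    have le: "\<delta> / real (Suc n) \<le> \<delta>" for n
      using \<delta>(1) by (simp add: field_simps)
    have z: "(\<lambda>n. \<delta> / real (Suc n)) \<longlonglongrightarrow> 0"
      using tendsto_mult[OF tendsto_const[of \<delta>] LIMSEQ_inverse_real_of_nat] by (simp add: divide_inverse)
    have a_lim: "a \<longlonglongrightarrow> l'"
      by (rule tendsto_sandwich[OF _ _ tendsto_const[of l'] tendsto_add[OF tendsto_const z, of l', simplified]])
         (use a in \<open>auto intro!: always_eventually less_imp_le\<close>)
    have b_lim: "b \<longlonglongrightarrow> u'"
      by (rule tendsto_sandwich[OF _ _ tendsto_diff[OF tendsto_const z, of u', simplified] tendsto_const[of u']])
         (use b in \<open>auto intro!: always_eventually less_imp_le\<close>)
    have "(\<lambda>n. \<integral>s. g s * indicator {a n<..<b n} s \<partial>lborel) \<longlonglongrightarrow> (\<integral>s. g s * indicator {l'<..<u'} s \<partial>lborel)"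
    proof (rule integral_dominated_convergence[where w = "\<lambda>s. \<bar>g s\<bar>"])
      show "AE s in lborel. (\<lambda>n. g s * indicator {a n<..<b n} s) \<longlonglongrightarrow> g s * indicator {l'<..<u'} s"
      proof (rule AE_I2)
        fix s
        have "\<forall>\<^sub>F n in sequentially. g s * indicator {a n<..<b n} s = g s * indicator {l'<..<u'} s"
        proof (cases "l' < s \<and> s < u'")
          case True
          then have "\<forall>\<^sub>F n in sequentially. a n < s" "\<forall>\<^sub>F n in sequentially. s < b n"
            using order_tendstoD(2)[OF a_lim] order_tendstoD(1)[OF b_lim] by auto
          then show ?thesis by eventually_elim (use True in simp)
        next
          case False
          then have "s \<notin> {a n<..<b n}" for n
            using a(2)[of n] b(3)[of n] by auto
          then show ?thesis using False by auto
        qed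
        then show "(\<lambda>n. g s * indicator {a n<..<b n} s) \<longlonglongrightarrow> g s * indicator {l'<..<u'} s"
          by (rule tendsto_eventually)
      qed
    qed (use g in \<open>auto simp: indicator_def\<close>)
    moreover have "(\<integral>s. g s * indicator {a n<..<b n} s \<partial>lborel) = 0" for n
    proof (rule 0)
      show "a n \<in> \<rat>" "b n \<in> \<rat>" by (fact a b)+
      show "\<alpha> < a n" "b n < \<beta>" using a(2)[of n] b(3)[of n] by (auto simp: l'_def u'_def)
      show "a n < b n" using a(3)[of n] b(2)[of n] le[of n] \<delta> by linarith
    qed
    ultimately show ?thesis unfolding eq by (simp add: LIMSEQ_const_iff)
  qed
qed

text \<open>
  The test functions form a countable family, so that the hypothesis can hold simultaneously for all of
  them on almost every line.
\<close>

lemma du_bois_reymond_rational: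
  fixes f v :: "real \<Rightarrow> real"
  assumes f: "integrable lborel f" and v: "integrable lborel v" and \<alpha>\<beta>: "\<alpha> < \<beta>"
    and H: "\<And>n a b a' b'. \<lbrakk>a \<in> \<rat>; b \<in> \<rat>; a' \<in> \<rat>; b' \<in> \<rat>; a < b; a' < b'; \<alpha> < min a a'; max b b' < \<beta>\<rbrakk> \<Longrightarrow>
      \<exists>A. test_pair (min a a') (max b b') A (zero_mean_bump n a b a' b') \<and>
        (\<integral>s. f s * zero_mean_bump n a b a' b' s + v s * A s \<partial>lborel) = 0"
  shows "\<exists>c. AE s in lborel. s \<in> {\<alpha><..<\<beta>} \<longrightarrow> f s = c + primitive v \<alpha> s"
proof -
  have [measurable]: "f \<in> borel_measurable borel" "v \<in> borel_measurable borel" using f v by auto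
  \<comment> \<open>The claim is that \<open>K\<close> is constant a.e. on the interval. The cut-off
    makes it integrable on the line, as the primitive is only bounded.\<close>
  define K where "K = (\<lambda>s. (f s - primitive v \<alpha> s) * indicator {\<alpha><..<\<beta>} s)"
  have ind: "integrable lborel (indicator {\<alpha><..<\<beta>} :: real \<Rightarrow> real)"
    using \<alpha>\<beta> by (simp add: integrable_indicator_iff)
  have prim: "integrable lborel (\<lambda>s. indicator {\<alpha><..<\<beta>} s * primitive v \<alpha> s)"
    by (rule integrable_mult_bounded[OF ind _ primitive_bound[OF v]]) simp
  then have K: "integrable lborel K"
    using Bochner_Integration.integrable_diff[OF integrable_real_mult_indicator[OF _ f, of "{\<alpha><..<\<beta>}"] prim]
    by (simp add: K_def algebra_simps)
  define L where "L = (\<lambda>a b. \<integral>s. K s * indicator {a<..<b} s \<partial>lborel)"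
  \<comment> \<open>The average of \<open>K\<close> is the same over all rational intervals inside
    ]\<alpha>,\<beta>[. By parts, the hypothesis says that \<open>K\<close> is orthogonal to
    \<open>zero_mean_bump\<close>; then \<open>n\<close> tends to infinity.\<close>
  have key: "(b' - a') * L a b = (b - a) * L a' b'"
    if R: "a \<in> \<rat>" "b \<in> \<rat>" "a' \<in> \<rat>" "b' \<in> \<rat>" "a < b" "a' < b'" "\<alpha> < min a a'" "max b b' < \<beta>" for a b a' b'
  proof -
    have "(\<integral>t. bump n a' b' t \<partial>lborel) * (\<integral>s. K s * bump n a b s \<partial>lborel)
        = (\<integral>t. bump n a b t \<partial>lborel) * (\<integral>s. K s * bump n a' b' s \<partial>lborel)" for n
    proof -
      let ?z = "zero_mean_bump n a b a' b'"
      obtain A where t: "test_pair (min a a') (max b b') A ?z"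
        and 0: "(\<integral>s. f s * ?z s + v s * A s \<partial>lborel) = 0"
        using H[OF R] by blast
      note [measurable] = test_pairD(8,9)[OF t]
      obtain C where C: "\<And>s. \<bar>?z s\<bar> \<le> C"
        using continuous_compact_support_bounded[OF test_pairD(3)[OF t] test_pairD(6)[OF t]] by blast
      obtain D where D: "\<And>s. \<bar>A s\<bar> \<le> D"
        using continuous_compact_support_bounded[OF test_pairD(4)[OF t] test_pairD(5)[OF t]] by blast
      have fz: "integrable lborel (\<lambda>s. f s * ?z s)" and vA: "integrable lborel (\<lambda>s. v s * A s)"
        using integrable_mult_bounded[OF f _ C] integrable_mult_bounded[OF v _ D] by auto
      have in_ab: "s \<in> {\<alpha><..<\<beta>}" if "?z s \<noteq> 0" for s
      proof -
        have "s \<in> {min a a'<..<max b b'}" using test_pairD(6)[OF t, of s] that by blast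
        then show ?thesis using R(7,8) by auto
      qed
      have pz: "integrable lborel (\<lambda>s. primitive v \<alpha> s * ?z s)"
      proof -
        have "(\<lambda>s. primitive v \<alpha> s * ?z s) = (\<lambda>s. indicator {\<alpha><..<\<beta>} s * primitive v \<alpha> s * ?z s)"
        proof
          show "primitive v \<alpha> s * ?z s = indicator {\<alpha><..<\<beta>} s * primitive v \<alpha> s * ?z s" for s
            using in_ab[of s] by (cases "?z s = 0") auto
        qed
        then show ?thesis using integrable_mult_bounded[OF prim _ C] by simp
      qed
      have "K s * ?z s = f s * ?z s - primitive v \<alpha> s * ?z s" for s
        using in_ab[of s] by (cases "?z s = 0") (auto simp: K_def algebra_simps)
      then have "(\<integral>s. K s * ?z s \<partial>lborel) = (\<integral>s. f s * ?z s \<partial>lborel) - (\<integral>s. primitive v \<alpha> s * ?z s \<partial>lborel)"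
        using fz pz by simp
      also have "\<dots> = (\<integral>s. f s * ?z s \<partial>lborel) + (\<integral>s. v s * A s \<partial>lborel)"
        using integral_primitive_by_parts[OF v t] R(7) by simp
      also have "\<dots> = 0" using 0 fz vA by simp
      finally have "(\<integral>s. K s * ?z s \<partial>lborel) = 0" .
      moreover have Kb: "integrable lborel (\<lambda>s. K s * bump n a b s)" for a b
        using bump_nonneg[of n a b] bump_le_1[of n a b] borel_measurable_continuous_onI[OF smooth_continuous_on[OF smooth_bump]]
        by (intro integrable_mult_bounded[OF K, where C = 1]) auto
      have "K s * ?z s = (\<integral>t. bump n a' b' t \<partial>lborel) * (K s * bump n a b s)
          - (\<integral>t. bump n a b t \<partial>lborel) * (K s * bump n a' b' s)" for s
        by (simp add: zero_mean_bump_def algebra_simps)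
      ultimately show ?thesis using Kb by simp
    qed
    moreover have "(\<lambda>n. (\<integral>t. bump n a' b' t \<partial>lborel) * (\<integral>s. K s * bump n a b s \<partial>lborel)) \<longlonglongrightarrow> (b' - a') * L a b"
      unfolding L_def using R by (intro tendsto_mult integral_bump_tendsto integral_mult_bump_tendsto[OF K]) auto
    moreover have "(\<lambda>n. (\<integral>t. bump n a b t \<partial>lborel) * (\<integral>s. K s * bump n a' b' s \<partial>lborel)) \<longlonglongrightarrow> (b - a) * L a' b'"
      unfolding L_def using R by (intro tendsto_mult integral_bump_tendsto integral_mult_bump_tendsto[OF K]) auto
    ultimately have "(\<lambda>n. (\<integral>t. bump n a b t \<partial>lborel) * (\<integral>s. K s * bump n a' b' s \<partial>lborel)) \<longlonglongrightarrow> (b' - a') * L a b"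
      "(\<lambda>n. (\<integral>t. bump n a b t \<partial>lborel) * (\<integral>s. K s * bump n a' b' s \<partial>lborel)) \<longlonglongrightarrow> (b - a) * L a' b'"
      by simp_all
    then show ?thesis by (rule LIMSEQ_unique)
  qed
  obtain a' where a': "a' \<in> \<rat>" "\<alpha> < a'" "a' < \<beta>" using Rats_dense_in_real[OF \<alpha>\<beta>] by blast
  obtain b' where b': "b' \<in> \<rat>" "a' < b'" "b' < \<beta>" using Rats_dense_in_real[OF a'(3)] by blast
  \<comment> \<open>The common average, read off from one reference interval.\<close>
  define c where "c = L a' b' / (b' - a')"
  have "AE s in lborel. K s - c * indicator {\<alpha><..<\<beta>} s = 0"
  proof (rule AE_zero_if_rational_intervals[of _ \<alpha> \<beta>])
    show "integrable lborel (\<lambda>s. K s - c * indicator {\<alpha><..<\<beta>} s)"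
      using K ind by simp
    show "K s - c * indicator {\<alpha><..<\<beta>} s = 0" if "s \<notin> {\<alpha><..<\<beta>}" for s
      using that by (simp add: K_def)
    fix a b assume ab: "a \<in> \<rat>" "b \<in> \<rat>" "\<alpha> < a" "a < b" "b < \<beta>"
    have "(\<integral>s. (K s - c * indicator {\<alpha><..<\<beta>} s) * indicator {a<..<b} s \<partial>lborel)
        = (\<integral>s. K s * indicator {a<..<b} s - c * indicator {a<..<b} s \<partial>lborel)"
      using ab by (intro Bochner_Integration.integral_cong) (auto simp: indicator_def)
    also have "\<dots> = L a b - c * (b - a)"
      using ab integrable_real_mult_indicator[OF _ K, of "{a<..<b}"]
      by (simp add: L_def integrable_indicator_iff)
    also have "\<dots> = 0"
      using key[of a b a' b'] ab a' b' by (simp add: c_def field_simps)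
    finally show "(\<integral>s. (K s - c * indicator {\<alpha><..<\<beta>} s) * indicator {a<..<b} s \<partial>lborel) = 0" .
  qed
  then have "AE s in lborel. s \<in> {\<alpha><..<\<beta>} \<longrightarrow> f s = c + primitive v \<alpha> s"
    by eventually_elim (auto simp: K_def)
  then show ?thesis ..
qed

section \<open>End values and Sobolev functions on an interval\<close>

lemma AE_lborel_interval_ex:
  assumes "AE s in lborel. P s" "l < (u::real)"
  shows "\<exists>s. l < s \<and> s < u \<and> P s"
proof (rule ccontr)
  assume "\<not> ?thesis"
  with assms(1) have "AE s in lborel. s \<notin> {l<..<u}"
    by (auto elim!: eventually_mono)
  then have "emeasure lborel {l<..<u} = 0"
    by (subst (asm) AE_iff_null_sets[symmetric]) auto
  then show False using assms(2) by simp
qed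

lemma AE_lebesgue_on_iff:
  assumes "S \<in> sets borel"
  shows "(AE x in lebesgue_on S. P x) \<longleftrightarrow> (AE x in lborel. x \<in> S \<longrightarrow> P x)"
  using assms by (subst AE_restrict_space_iff) (auto simp: AE_completion_iff)

text \<open>Two continuous functions on the closed interval that agree a.e. inside agree at points
  arbitrarily close to \<beta>, hence at \<beta>. So the description \<open>THE\<close> has exactly
  one candidate.\<close>

lemma end_trace_eq:
  assumes \<alpha>\<beta>: "\<alpha> < \<beta>" and G: "continuous_on {\<alpha>..\<beta>} G"
    and ae: "AE s in lborel. s \<in> {\<alpha><..<\<beta>} \<longrightarrow> f s = G s"
  shows "end_trace \<alpha> \<beta> f = G \<beta>"
  unfolding end_trace_def
proof (rule the_equality)
  have ae': "AE s in lebesgue_on {\<alpha><..<\<beta>}. G s = f s"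
    using ae by (subst AE_lebesgue_on_iff) (auto elim!: eventually_mono)
  then show "\<exists>F. continuous_on {\<alpha>..\<beta>} F \<and> (AE s in lebesgue_on {\<alpha><..<\<beta>}. F s = f s) \<and> G \<beta> = F \<beta>"
    using G by blast
  fix c assume "\<exists>F. continuous_on {\<alpha>..\<beta>} F \<and> (AE s in lebesgue_on {\<alpha><..<\<beta>}. F s = f s) \<and> c = F \<beta>"
  then obtain F where F: "continuous_on {\<alpha>..\<beta>} F" "AE s in lebesgue_on {\<alpha><..<\<beta>}. F s = f s" "c = F \<beta>"
    by blast
  have FG: "AE s in lborel. s \<in> {\<alpha><..<\<beta>} \<longrightarrow> F s = G s"
    using F(2) ae unfolding AE_lebesgue_on_iff[OF borel_open[OF open_greaterThanLessThan]]
    by eventually_elim auto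
  have cont: "continuous_on {\<alpha>..\<beta>} (\<lambda>s. F s - G s)" using F(1) G by (intro continuous_intros)
  have "F \<beta> - G \<beta> = 0"
  proof (rule ccontr)
    assume ne: "F \<beta> - G \<beta> \<noteq> 0"
    have "\<beta> \<in> {\<alpha>..\<beta>}" using \<alpha>\<beta> by simp
    from cont[unfolded continuous_on_iff, rule_format, OF this, of "\<bar>F \<beta> - G \<beta>\<bar>"] ne
    obtain d where d: "d > 0" "\<And>s. s \<in> {\<alpha>..\<beta>} \<Longrightarrow> dist s \<beta> < d \<Longrightarrow> dist (F s - G s) (F \<beta> - G \<beta>) < \<bar>F \<beta> - G \<beta>\<bar>"
      by auto
    have "max \<alpha> (\<beta> - d) < \<beta>" using \<alpha>\<beta> d(1) by simp
    from AE_lborel_interval_ex[OF FG this] obtain s where "max \<alpha> (\<beta> - d) < s" "s < \<beta>" "s \<in> {\<alpha><..<\<beta>} \<longrightarrow> F s = G s"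
      by blast
    with d(2)[of s] show False by (auto simp: dist_real_def)
  qed
  then show "c = G \<beta>" using F(3) by simp
qed

lemma end_trace_cong_AE:
  assumes "AE s in lborel. s \<in> {\<alpha><..<\<beta>} \<longrightarrow> f s = g s"
  shows "end_trace \<alpha> \<beta> f = end_trace \<alpha> \<beta> g"
proof -
  have "(AE s in lebesgue_on {\<alpha><..<\<beta>}. F s = f s) \<longleftrightarrow> (AE s in lebesgue_on {\<alpha><..<\<beta>}. F s = g s)" for F
    unfolding AE_lebesgue_on_iff[OF borel_open[OF open_greaterThanLessThan]]
    using assms by (intro iffI; elim AE_mp) (auto elim!: eventually_mono)
  then show ?thesis unfolding end_trace_def by simp
qed

lemma integral_lebesgue_on_eq_lborel:
  fixes g :: "'a::euclidean_space \<Rightarrow> real"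
  assumes "S \<in> sets borel" "(\<lambda>x. indicator S x * g x) \<in> borel_measurable borel"
  shows "(\<integral>x. g x \<partial>lebesgue_on S) = (\<integral>x. indicator S x * g x \<partial>lborel)"
  using assms by (subst integral_restrict_space) (auto simp: integral_completion)

text \<open>A test function and its derivative form a test pair on the interval. Against the
  derivative the constant integrates to 0, and the primitive is handled by parts, so
  \<open>v\<close> is the weak derivative of \<open>f\<close>.\<close>

lemma H1_intervalI:
  fixes f v :: "real \<Rightarrow> real"
  assumes \<alpha>\<beta>: "\<alpha> < \<beta>"
    and f: "integrable lborel f" "integrable lborel (\<lambda>s. (f s)\<^sup>2)"
    and v: "integrable lborel v" "integrable lborel (\<lambda>s. (v s)\<^sup>2)"
    and ae: "AE s in lborel. s \<in> {\<alpha><..<\<beta>} \<longrightarrow> f s = c + primitive v \<alpha> s"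
  shows "f \<in> H1_interval \<alpha> \<beta>"
proof -
  let ?I = "{\<alpha><..<\<beta>}"
  have [measurable]: "f \<in> borel_measurable borel" "v \<in> borel_measurable borel" using f v by auto
  have L2: "g \<in> L2_space ?I" if "integrable lborel g" "integrable lborel (\<lambda>s. (g s)\<^sup>2)" for g :: "real \<Rightarrow> real"
  proof -
    have [measurable]: "g \<in> borel_measurable borel" using that by auto
    have "g \<in> borel_measurable (lebesgue_on ?I)"
      by (intro measurable_restrict_space1 measurable_completion) simp
    moreover have "integrable (lebesgue_on ?I) (\<lambda>s. (g s)\<^sup>2)"
      using integrable_mult_indicator[OF _ that(2), of ?I]
      by (subst integrable_restrict_space) (auto simp: integrable_completion)
    ultimately show ?thesis by (simp add: L2_space_def)
  qed
  have W: "weak_dir_deriv 1 ?I f v"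
    unfolding weak_dir_deriv_def
  proof
    fix \<phi> :: "real \<Rightarrow> real" assume \<phi>: "\<phi> \<in> test_functions ?I"
    then have sm: "smooth \<phi>" and supp: "closure {x. \<phi> x \<noteq> 0} \<subseteq> ?I"
      by (auto simp: test_functions_def smooth_def)
    define \<phi>' where "\<phi>' = (\<lambda>s. frechet_derivative \<phi> (at s) 1)"
    have D: "(\<phi> has_real_derivative \<phi>' s) (at s)" for s
      unfolding \<phi>'_def by (rule smooth_real_derivative[OF sm])
    have supp0: "\<phi> s = 0" if "s \<notin> closure {x. \<phi> x \<noteq> 0}" for s
      using that closure_subset[of "{x. \<phi> x \<noteq> 0}"] by auto
    \<comment> \<open>Off its closed support \<phi> is zero on an open set, so the derivative
      vanishes there too.\<close>
    have supp0': "\<phi>' s = 0" if s: "s \<notin> closure {x. \<phi> x \<noteq> 0}" for s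
    proof -
      have "((\<lambda>_. 0) has_real_derivative 0) (at s)" by simp
      then have "(\<phi> has_real_derivative 0) (at s)"
      proof (rule has_field_derivative_transform_within_open)
        show "open (- closure {x. \<phi> x \<noteq> 0})" by auto
        show "s \<in> - closure {x. \<phi> x \<noteq> 0}" using s by simp
        show "0 = \<phi> x" if "x \<in> - closure {x. \<phi> x \<noteq> 0}" for x
          using supp0[of x] that by simp
      qed
      with D show ?thesis using DERIV_unique by blast
    qed
    have t: "test_pair \<alpha> \<beta> \<phi> \<phi>'"
      unfolding test_pair_def
    proof (intro conjI allI impI)
      show "continuous_on UNIV \<phi>'"
        unfolding \<phi>'_def using smooth_continuous_on[OF smooth_frechet[OF sm, of 1]] by simp
      fix s assume "s \<notin> ?I"
      then have "s \<notin> closure {x. \<phi> x \<noteq> 0}" using supp by blast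
      then show "\<phi> s = 0" "\<phi>' s = 0" by (rule supp0 supp0')+
    qed (use \<alpha>\<beta> D in auto)
    note [measurable] = test_pairD(8,9)[OF t]
    have grad: "1 \<bullet> gradient \<phi> s = \<phi>' s" for s
      using inner_gradient[OF sm] by (simp add: \<phi>'_def)
    have ind: "indicator ?I s * (g s * \<phi>' s) = g s * \<phi>' s" "indicator ?I s * (g s * \<phi> s) = g s * \<phi> s" for g s
      using test_pairD(5,6)[OF t, of s] by (cases "s \<in> ?I"; simp)+
    have \<phi>'_int: "integrable lborel \<phi>'"
      using continuous_compact_support_integrable[OF test_pairD(3)[OF t] test_pairD(6)[OF t]] .
    have p_int: "integrable lborel (\<lambda>s. \<phi>' s * primitive v \<alpha> s)"
      by (rule integrable_mult_bounded[OF \<phi>'_int _ primitive_bound[OF v(1)]]) simp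
    have "(\<integral>s. f s * (1 \<bullet> gradient \<phi> s) \<partial>lebesgue_on ?I) = (\<integral>s. f s * \<phi>' s \<partial>lborel)"
      unfolding grad by (subst integral_lebesgue_on_eq_lborel) (auto simp: ind)
    also have "\<dots> = (\<integral>s. c * \<phi>' s + primitive v \<alpha> s * \<phi>' s \<partial>lborel)"
    proof (rule integral_cong_AE)
      show "AE s in lborel. f s * \<phi>' s = c * \<phi>' s + primitive v \<alpha> s * \<phi>' s"
        using ae
      proof eventually_elim
        case (elim s)
        then show ?case
          using test_pairD(6)[OF t, of s] by (cases "s \<in> ?I") (auto simp: algebra_simps)
      qed
    qed (measurable)
    also have "\<dots> = c * (\<integral>s. \<phi>' s \<partial>lborel) + (\<integral>s. primitive v \<alpha> s * \<phi>' s \<partial>lborel)"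
      using \<phi>'_int p_int by (simp add: mult.commute)
    also have "(\<integral>s. \<phi>' s \<partial>lborel) = 0"
    proof -
      have "(\<lambda>s. \<phi>' s * indicator {\<alpha>..} s) = \<phi>'"
      proof
        show "\<phi>' s * indicator {\<alpha>..} s = \<phi>' s" for s
          using test_pairD(6)[OF t, of s] by (cases "s \<in> ?I") auto
      qed
      then show ?thesis using test_pair_tail_integral[OF t, of \<alpha>] test_pairD(5)[OF t, of \<alpha>] by simp
    qed
    also have "(\<integral>s. primitive v \<alpha> s * \<phi>' s \<partial>lborel) = - (\<integral>s. v s * \<phi> s \<partial>lborel)"
      by (rule integral_primitive_by_parts[OF v(1) t]) simp
    also have "(\<integral>s. v s * \<phi> s \<partial>lborel) = (\<integral>s. v s * \<phi> s \<partial>lebesgue_on ?I)"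
      by (subst integral_lebesgue_on_eq_lborel) (auto simp: ind)
    finally show "(\<integral>s. f s * (1 \<bullet> gradient \<phi> s) \<partial>lebesgue_on ?I) = - (\<integral>s. v s * \<phi> s \<partial>lebesgue_on ?I)"
      by simp
  qed
  show ?thesis
    unfolding H1_interval_def W_space_def
    by (rule CollectI, rule conjI[OF L2[OF f]], rule bexI[of _ v], rule W, rule L2[OF v])
qed

text \<open>The substitution s = \<beta> - r / (n + 1) turns the average over the segment of length
  1 / (n + 1) ending at \<beta> into an integral over the fixed interval ]0,1[. This form involves
  neither \<alpha> nor \<open>G\<close>, so it makes sense at every point of space.\<close>

lemma end_average_tendsto:
  fixes f G :: "real \<Rightarrow> real"
  assumes \<alpha>\<beta>: "\<alpha> < \<beta>" and G: "continuous_on {\<alpha>..\<beta>} G"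
    and f[measurable]: "f \<in> borel_measurable borel"
    and ae: "AE s in lborel. s \<in> {\<alpha><..<\<beta>} \<longrightarrow> f s = G s"
  shows "(\<lambda>n. \<integral>r. f (\<beta> - r / real (Suc n)) * indicator {0<..<1} r \<partial>lborel) \<longlonglongrightarrow> G (\<beta>::real)"
proof -
  \<comment> \<open>Clamping the argument extends \<open>G\<close> to a bounded continuous function
    on the line, so that dominated convergence covers all \<open>n\<close> at once.\<close>
  define H where "H = (\<lambda>s. G (max \<alpha> (min \<beta> s)))"
  have H: "continuous_on UNIV H"
    unfolding H_def by (rule continuous_on_compose2[OF G]) (use \<alpha>\<beta> in \<open>auto intro!: continuous_intros\<close>)
  then have [measurable]: "H \<in> borel_measurable borel" by (rule borel_measurable_continuous_onI)
  have "bounded (G ` {\<alpha>..\<beta>})"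
    by (intro compact_imp_bounded compact_continuous_image G) simp
  then obtain C where C: "\<And>s. s \<in> {\<alpha>..\<beta>} \<Longrightarrow> \<bar>G s\<bar> \<le> C" by (fastforce simp: bounded_iff)
  have HC: "\<bar>H s\<bar> \<le> C" for s
    unfolding H_def by (rule C) (use \<alpha>\<beta> in auto)
  have z: "(\<lambda>n. r / real (Suc n)) \<longlonglongrightarrow> 0" for r
    using tendsto_mult[OF tendsto_const[of r] LIMSEQ_inverse_real_of_nat] by (simp add: divide_inverse)
  have "(\<lambda>n. \<integral>r. H (\<beta> - r / real (Suc n)) * indicator {0<..<1} r \<partial>lborel) \<longlonglongrightarrow> (\<integral>r. H \<beta> * indicator {0<..<1::real} r \<partial>lborel)"
  proof (rule integral_dominated_convergence[where w = "\<lambda>r. C * indicator {0<..<1} r"])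
    show "AE r in lborel. (\<lambda>n. H (\<beta> - r / real (Suc n)) * indicator {0<..<1} r) \<longlonglongrightarrow> H \<beta> * indicator {0<..<1} r"
    proof (rule AE_I2, intro tendsto_mult tendsto_const)
      show "(\<lambda>n. H (\<beta> - r / real (Suc n))) \<longlonglongrightarrow> H \<beta>" for r
        by (rule continuous_on_tendsto_compose[OF H])
           (use tendsto_diff[OF tendsto_const[of \<beta>] z[of r]] in auto)
    qed
    show "integrable lborel (\<lambda>r. C * indicator {0<..<1::real} r)"
      by (simp add: integrable_indicator_iff)
  qed (use HC in \<open>auto simp: indicator_def\<close>)
  moreover have "(\<integral>r. H \<beta> * indicator {0<..<1::real} r \<partial>lborel) = G \<beta>"
    using \<alpha>\<beta> by (simp add: H_def)
  ultimately have lim: "(\<lambda>n. \<integral>r. H (\<beta> - r / real (Suc n)) * indicator {0<..<1} r \<partial>lborel) \<longlonglongrightarrow> G \<beta>"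
    by simp
  \<comment> \<open>Once the segment is shorter than the interval it lies inside it, where
    \<open>f\<close> and \<open>H\<close> agree a.e.; an affine change of variable keeps the null
    set null.\<close>
  have "(\<integral>r. H (\<beta> - r / real (Suc n)) * indicator {0<..<1} r \<partial>lborel)
      = (\<integral>r. f (\<beta> - r / real (Suc n)) * indicator {0<..<1} r \<partial>lborel)"
    if n: "1 / real (Suc n) < \<beta> - \<alpha>" for n
  proof (rule integral_cong_AE)
    have "AE s in lborel. s \<in> {\<alpha><..<\<beta>} \<longrightarrow> f s = H s"
      using ae by eventually_elim (auto simp: H_def)
    then have "AE r in lborel. (\<beta> + (- 1 / real (Suc n)) * r) \<in> {\<alpha><..<\<beta>} \<longrightarrow>
        f (\<beta> + (- 1 / real (Suc n)) * r) = H (\<beta> + (- 1 / real (Suc n)) * r)"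
      by (rule AE_borel_affine[rotated 2]) simp_all
    then show "AE r in lborel. H (\<beta> - r / real (Suc n)) * indicator {0<..<1} r = f (\<beta> - r / real (Suc n)) * indicator {0<..<1} r"
    proof eventually_elim
      case (elim r)
      show ?case
      proof (cases "r \<in> {0<..<1}")
        case True
        then have "0 < r / real (Suc n)" "r / real (Suc n) < 1 / real (Suc n)"
          by (auto simp: divide_strict_right_mono)
        then show ?thesis using elim n by simp
      qed simp
    qed
  qed simp_all
  then have "\<forall>\<^sub>F n in sequentially. (\<integral>r. H (\<beta> - r / real (Suc n)) * indicator {0<..<1} r \<partial>lborel)
      = (\<integral>r. f (\<beta> - r / real (Suc n)) * indicator {0<..<1} r \<partial>lborel)"
    using order_tendstoD(2)[OF z[of 1], of "\<beta> - \<alpha>"] \<alpha>\<beta> by (auto elim!: eventually_mono)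
  with lim show ?thesis by (rule Lim_transform_eventually)
qed

section \<open>Restriction to almost every line\<close>

text \<open>A Lebesgue measurable function is a.e. equal to a Borel one, and the cut-off to \<Omega>
  puts it on the whole space, so that its restrictions to lines are Borel. As |t| \<le> 1 + t^2 and
  \<Omega> has finite measure, square integrability gives integrability.\<close>

lemma L2_space_borel_representative:
  fixes u :: "'a::euclidean_space \<Rightarrow> real"
  assumes u: "u \<in> L2_space \<Omega>" and \<Omega>: "bounded \<Omega>" "open \<Omega>"
  obtains w where "w \<in> borel_measurable borel" "AE x in lborel. x \<in> \<Omega> \<longrightarrow> w x = u x"
    "\<And>x. x \<notin> \<Omega> \<Longrightarrow> w x = 0" "integrable lborel w" "integrable lborel (\<lambda>x. (w x)\<^sup>2)"
proof -
  have [measurable]: "\<Omega> \<in> sets borel" using \<Omega>(2) by simp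
  have u': "u \<in> borel_measurable (lebesgue_on \<Omega>)" "integrable (lebesgue_on \<Omega>) (\<lambda>x. (u x)\<^sup>2)"
    using u by (auto simp: L2_space_def)
  have "(\<lambda>x. indicator \<Omega> x *\<^sub>R u x) \<in> borel_measurable lebesgue"
    using u'(1) by (subst (asm) borel_measurable_restrict_space_iff) auto
  from completion_ex_borel_measurable_real[OF this]
  obtain g where g[measurable]: "g \<in> borel_measurable borel" and ae: "AE x in lborel. indicator \<Omega> x *\<^sub>R u x = g x"
    by auto
  define w where "w = (\<lambda>x. indicator \<Omega> x * g x)"
  have w[measurable]: "w \<in> borel_measurable borel" unfolding w_def by measurable
  have eq: "AE x in lborel. x \<in> \<Omega> \<longrightarrow> w x = u x"
    using ae by eventually_elim (auto simp: w_def)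
  have "integrable lebesgue (\<lambda>x. indicator \<Omega> x *\<^sub>R (u x)\<^sup>2)"
    using u'(2) by (subst (asm) integrable_restrict_space) auto
  then have "integrable lebesgue (\<lambda>x. (w x)\<^sup>2)"
  proof (rule integrable_cong_AE_imp)
    show "AE x in lebesgue. indicator \<Omega> x *\<^sub>R (u x)\<^sup>2 = (w x)\<^sup>2"
      using eq unfolding AE_completion_iff by eventually_elim (auto simp: w_def indicator_def)
    show "(\<lambda>x. (w x)\<^sup>2) \<in> borel_measurable lebesgue" by (intro measurable_completion) simp
  qed
  then have w2: "integrable lborel (\<lambda>x. (w x)\<^sup>2)" by (subst (asm) integrable_completion) simp_all
  have "integrable lborel w"
  proof (rule Bochner_Integration.integrable_bound)
    show "integrable lborel (\<lambda>x. indicator \<Omega> x + (w x)\<^sup>2)"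
      using w2 emeasure_bounded_finite[OF \<Omega>(1)] by (simp add: integrable_indicator_iff)
    have "\<bar>t\<bar> \<le> 1 + t\<^sup>2" for t :: real
      using sum_squares_bound[of "\<bar>t\<bar>" 1] by (simp add: power2_eq_square)
    then show "AE x in lborel. norm (w x) \<le> norm (indicator \<Omega> x + (w x)\<^sup>2)"
      by (auto simp: w_def indicator_def)
  qed simp
  with w eq w2 show thesis by (intro that) (auto simp: w_def)
qed

section \<open>Cylinder test functions\<close>

lemma bounded_linear_hyper_proj: "bounded_linear (hyper_proj \<theta>)"
  unfolding hyper_proj_def[abs_def]
  by (intro bounded_linear_sub bounded_linear_ident bounded_linear_scaleR_const bounded_linear_inner_left)

lemma measurable_hyper_proj [measurable]: "hyper_proj \<theta> \<in> borel_measurable borel"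
  using linear_continuous_on[OF bounded_linear_hyper_proj] by (rule borel_measurable_continuous_onI)

lemma hyper_proj_line:
  assumes "norm \<theta> = 1"
  shows "hyper_proj \<theta> (x + t *\<^sub>R \<theta>) = hyper_proj \<theta> x"
    and "y \<in> hyperplane \<theta> \<Longrightarrow> hyper_proj \<theta> (s *\<^sub>R \<theta> + y) = y"
    and "y \<in> hyperplane \<theta> \<Longrightarrow> (s *\<^sub>R \<theta> + y) \<bullet> \<theta> = s"
    and "(x \<bullet> \<theta>) *\<^sub>R \<theta> + hyper_proj \<theta> x = x"
    and "hyper_proj \<theta> x \<in> hyperplane \<theta>"
  using assms
  by (auto simp: hyper_proj_def hyperplane_def inner_add_left inner_diff_left norm_eq_1 algebra_simps)

lemma integral_lebesgue_on_representative:
  fixes u w h :: "'a::euclidean_space \<Rightarrow> real"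
  assumes \<Omega>: "open \<Omega>" and u: "u \<in> borel_measurable (lebesgue_on \<Omega>)"
    and w[measurable]: "w \<in> borel_measurable borel" and eq: "AE x in lborel. x \<in> \<Omega> \<longrightarrow> w x = u x"
    and supp: "\<And>x. x \<notin> \<Omega> \<Longrightarrow> w x = 0" and h[measurable]: "h \<in> borel_measurable borel"
  shows "(\<integral>x. u x * h x \<partial>lebesgue_on \<Omega>) = (\<integral>x. w x * h x \<partial>lborel)"
proof -
  have \<Omega>': "\<Omega> \<in> sets borel" using \<Omega> by simp
  have b: "g \<in> borel_measurable (lebesgue_on \<Omega>)" if "g \<in> borel_measurable borel" for g :: "'a \<Rightarrow> real"
    by (intro measurable_restrict_space1 measurable_completion) (use that in simp)
  have "(\<integral>x. u x * h x \<partial>lebesgue_on \<Omega>) = (\<integral>x. w x * h x \<partial>lebesgue_on \<Omega>)"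
  proof (rule integral_cong_AE)
    show "AE x in lebesgue_on \<Omega>. u x * h x = w x * h x"
      unfolding AE_lebesgue_on_iff[OF \<Omega>'] using eq by eventually_elim auto
  qed (intro borel_measurable_times u b w h)+
  also have "\<dots> = (\<integral>x. indicator \<Omega> x * (w x * h x) \<partial>lborel)"
    using \<Omega>' by (intro integral_lebesgue_on_eq_lborel) auto
  also have "\<dots> = (\<integral>x. w x * h x \<partial>lborel)"
    by (rule Bochner_Integration.integral_cong) (use supp in \<open>auto simp: indicator_def\<close>)
  finally show ?thesis .
qed

lemma smooth_borel_measurable: "smooth f \<Longrightarrow> f \<in> borel_measurable borel"
  by (intro borel_measurable_continuous_onI smooth_continuous_on)

text \<open>The weak identity for \<open>A (x \<bullet> \<theta>)\<close> times two bumps in the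
  projection of \<open>x\<close>. The bump with index 0 is a fixed cut-off that keeps the support in
  the cylinder over \<open>cbox l r\<close>; the other approximates the indicator of an arbitrary
  box as \<open>n\<close> grows.\<close>

lemma cylinder_test_identity:
  fixes u v :: "'a::euclidean_space \<Rightarrow> real"
  assumes \<theta>: "norm \<theta> = 1" and \<Omega>: "open \<Omega>"
    and u: "u \<in> borel_measurable (lebesgue_on \<Omega>)" and v: "v \<in> borel_measurable (lebesgue_on \<Omega>)"
    and weak: "weak_dir_deriv \<theta> \<Omega> u v"
    and w: "integrable lborel w" "AE x in lborel. x \<in> \<Omega> \<longrightarrow> w x = u x" "\<And>x. x \<notin> \<Omega> \<Longrightarrow> w x = 0"
    and z: "integrable lborel z" "AE x in lborel. x \<in> \<Omega> \<longrightarrow> z x = v x" "\<And>x. x \<notin> \<Omega> \<Longrightarrow> z x = 0"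
    and t: "test_pair p q A \<phi>" and sm: "smooth \<phi>"
    and K: "{x. p \<le> x \<bullet> \<theta> \<and> x \<bullet> \<theta> \<le> q \<and> hyper_proj \<theta> x \<in> cbox l r} \<subseteq> \<Omega>"
  shows "(\<integral>x. (w x * \<phi> (x \<bullet> \<theta>) + z x * A (x \<bullet> \<theta>)) * bump 0 l r (hyper_proj \<theta> x) * bump n l' r' (hyper_proj \<theta> x) \<partial>lborel) = 0"
proof -
  define \<zeta> where "\<zeta> = (\<lambda>x. bump 0 l r (hyper_proj \<theta> x) * bump n l' r' (hyper_proj \<theta> x))"
  define \<psi> where "\<psi> = (\<lambda>x. A (x \<bullet> \<theta>) * \<zeta> x)"
  have [measurable]: "w \<in> borel_measurable borel" "z \<in> borel_measurable borel" using w z by auto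
  note [measurable] = test_pairD(8,9)[OF t]
  have smA: "smooth A" using test_pairD(2)[OF t] sm by (rule smooth_real_antiderivative)
  have sm\<zeta>: "smooth \<zeta>"
    unfolding \<zeta>_def by (intro smooth_mult smooth_bump_compose bounded_linear_hyper_proj)
  have sm\<psi>: "smooth \<psi>"
    unfolding \<psi>_def using smooth_affine[OF bounded_linear_inner_left[of \<theta>], of 0]
    by (intro smooth_mult smooth_compose[OF smA] sm\<zeta>) simp
  note [measurable] = smooth_borel_measurable[OF sm\<zeta>] smooth_borel_measurable[OF sm\<psi>]
  let ?K = "{x. p \<le> x \<bullet> \<theta> \<and> x \<bullet> \<theta> \<le> q \<and> hyper_proj \<theta> x \<in> cbox l r}"
  have sub: "{x. \<psi> x \<noteq> 0} \<subseteq> ?K"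
  proof
    fix x assume "x \<in> {x. \<psi> x \<noteq> 0}"
    then have "A (x \<bullet> \<theta>) \<noteq> 0" "bump 0 l r (hyper_proj \<theta> x) \<noteq> 0" by (auto simp: \<psi>_def \<zeta>_def)
    then have "x \<bullet> \<theta> \<in> {p<..<q}" "hyper_proj \<theta> x \<in> box l r"
      using test_pairD(5)[OF t] by (blast, simp add: bump_eq_0_iff)
    then show "x \<in> ?K" using box_subset_cbox by auto
  qed
  have closed: "closed ?K"
    by (intro closed_Collect_conj closed_Collect_le continuous_intros
        closed_vimage[OF closed_cbox linear_continuous_on[OF bounded_linear_hyper_proj], unfolded vimage_def])
  have "bounded ?K"
  proof -
    obtain R where R: "\<And>x. x \<in> cbox l r \<Longrightarrow> norm x \<le> R"
      using bounded_cbox[of l r] unfolding bounded_iff by blast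
    have "norm x \<le> max \<bar>p\<bar> \<bar>q\<bar> + R" if "x \<in> ?K" for x
    proof -
      have "norm x \<le> norm ((x \<bullet> \<theta>) *\<^sub>R \<theta>) + norm (hyper_proj \<theta> x)"
        by (metis hyper_proj_line(4)[OF \<theta>] norm_triangle_ineq)
      also have "norm ((x \<bullet> \<theta>) *\<^sub>R \<theta>) \<le> max \<bar>p\<bar> \<bar>q\<bar>" using that \<theta> by auto
      finally show ?thesis using R[of "hyper_proj \<theta> x"] that by auto
    qed
    then show ?thesis unfolding bounded_iff by blast
  qed
  then have "bounded {x. \<psi> x \<noteq> 0}" using sub bounded_subset by blast
  then have "compact (closure {x. \<psi> x \<noteq> 0})" by simp
  moreover have "closure {x. \<psi> x \<noteq> 0} \<subseteq> ?K" by (rule closure_minimal[OF sub closed])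
  ultimately have "\<psi> \<in> test_functions \<Omega>"
    using K sm\<psi> by (auto simp: test_functions_def smooth_def)
  with weak have eq: "(\<integral>x. u x * (\<theta> \<bullet> gradient \<psi> x) \<partial>lebesgue_on \<Omega>) = - (\<integral>x. v x * \<psi> x \<partial>lebesgue_on \<Omega>)"
    unfolding weak_dir_deriv_def by blast
  \<comment> \<open>The projection is constant along \<theta>, so only the factor \<open>A\<close>
    is differentiated.\<close>
  have grad: "\<theta> \<bullet> gradient \<psi> x = \<phi> (x \<bullet> \<theta>) * \<zeta> x" for x
  proof (rule inner_gradient_eq_deriv[OF sm\<psi>])
    have "(\<lambda>t. \<psi> (x + t *\<^sub>R \<theta>)) = (\<lambda>t. A (t + x \<bullet> \<theta>) * \<zeta> x)"
      using \<theta> by (simp add: \<psi>_def \<zeta>_def hyper_proj_line(1) inner_add_left norm_eq_1 add.commute)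
    moreover have "((\<lambda>t. A (t + x \<bullet> \<theta>)) has_real_derivative \<phi> (x \<bullet> \<theta>)) (at 0)"
      using test_pairD(2)[OF t, of "0 + x \<bullet> \<theta>"] unfolding DERIV_shift by simp
    ultimately show "((\<lambda>t. \<psi> (x + t *\<^sub>R \<theta>)) has_real_derivative \<phi> (x \<bullet> \<theta>) * \<zeta> x) (at 0)"
      by (simp add: DERIV_cmult_right)
  qed
  have parts: "(\<integral>x. w x * (\<phi> (x \<bullet> \<theta>) * \<zeta> x) \<partial>lborel) = - (\<integral>x. z x * \<psi> x \<partial>lborel)"
    using eq unfolding grad
    by (subst (asm) integral_lebesgue_on_representative[OF \<Omega> u _ w(2,3)], simp, simp, simp)
       (subst (asm) integral_lebesgue_on_representative[OF \<Omega> v _ z(2,3)], simp_all)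
  have b01: "\<bar>bump m a b y\<bar> \<le> 1" for m and a b y :: 'a
    using bump_nonneg[of m a b y] bump_le_1[of m a b y] by simp
  have b\<zeta>: "\<bar>\<zeta> x\<bar> \<le> 1" for x
    unfolding \<zeta>_def abs_mult by (intro mult_le_one b01) simp
  obtain C where C: "\<And>s. \<bar>\<phi> s\<bar> \<le> C"
    using continuous_compact_support_bounded[OF test_pairD(3)[OF t] test_pairD(6)[OF t]] by blast
  obtain D where D: "\<And>s. \<bar>A s\<bar> \<le> D"
    using continuous_compact_support_bounded[OF test_pairD(4)[OF t] test_pairD(5)[OF t]] by blast
  have i1: "integrable lborel (\<lambda>x. w x * \<phi> (x \<bullet> \<theta>) * \<zeta> x)" "integrable lborel (\<lambda>x. z x * A (x \<bullet> \<theta>) * \<zeta> x)"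
    by (rule integrable_mult_bounded[OF integrable_mult_bounded[OF w(1) _ C] _ b\<zeta>], measurable,
        rule integrable_mult_bounded[OF integrable_mult_bounded[OF z(1) _ D] _ b\<zeta>], measurable)
  have "(\<integral>x. (w x * \<phi> (x \<bullet> \<theta>) + z x * A (x \<bullet> \<theta>)) * bump 0 l r (hyper_proj \<theta> x) * bump n l' r' (hyper_proj \<theta> x) \<partial>lborel)
     = (\<integral>x. w x * \<phi> (x \<bullet> \<theta>) * \<zeta> x + z x * A (x \<bullet> \<theta>) * \<zeta> x \<partial>lborel)"
    by (rule Bochner_Integration.integral_cong) (auto simp: \<zeta>_def algebra_simps)
  also have "\<dots> = (\<integral>x. w x * \<phi> (x \<bullet> \<theta>) * \<zeta> x \<partial>lborel) + (\<integral>x. z x * A (x \<bullet> \<theta>) * \<zeta> x \<partial>lborel)"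
    using i1 by simp
  finally show ?thesis using parts by (simp add: \<psi>_def mult.assoc)
qed

text \<open>Integrating the two parts of \<open>W\<close> over the lines gives densities on the
  hyperplane. By Fubini they assign equal mass to every Borel set of lines; since one total mass is
  finite, the densities agree a.e.\<close>

lemma AE_hyperplane_if_cylinder_integrals_zero:
  fixes \<theta> :: "'a::euclidean_space" and W :: "'a \<Rightarrow> real"
  assumes \<theta>: "norm \<theta> = 1" and W: "integrable lborel W"
    and 0: "\<And>l u. (\<integral>x. W x * indicator (box l u) (hyper_proj \<theta> x) \<partial>lborel) = 0"
  shows "AE y in hyperplane_lborel \<theta>. (\<integral>s. W (s *\<^sub>R \<theta> + y) \<partial>lborel) = 0"
proof -
  have W_meas[measurable]: "W \<in> borel_measurable borel" using W by auto
  let ?H = "hyperplane_lborel \<theta>"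
  obtain c where c: "0 < c" "c < \<infinity>" "\<And>h. h \<in> borel_measurable borel \<Longrightarrow>
      (\<integral>\<^sup>+ x. h x \<partial>lborel) = c * (\<integral>\<^sup>+ y. \<integral>\<^sup>+ s. h (s *\<^sub>R \<theta> + y) \<partial>lborel \<partial>?H)"
    using lborel_fubini_hyperplane[OF \<theta>] by blast
  define J where "J = (\<lambda>V y. \<integral>\<^sup>+ s. ennreal (V (s *\<^sub>R \<theta> + y)) \<partial>lborel)"
  have J_meas: "J V \<in> borel_measurable ?H" if [measurable]: "V \<in> borel_measurable borel" for V
    unfolding J_def by (rule measurable_hyperplane_lborel[of _ borel]) auto
  have cyl: "(\<integral>\<^sup>+x. ennreal (V x) * indicator S (hyper_proj \<theta> x) \<partial>lborel) = c * (\<integral>\<^sup>+ y. J V y * indicator S y \<partial>?H)"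
    if [measurable]: "V \<in> borel_measurable borel" "S \<in> sets borel" for V S
  proof -
    have "(\<integral>\<^sup>+x. ennreal (V x) * indicator S (hyper_proj \<theta> x) \<partial>lborel) =
        c * (\<integral>\<^sup>+ y. \<integral>\<^sup>+ s. ennreal (V (s *\<^sub>R \<theta> + y)) * indicator S (hyper_proj \<theta> (s *\<^sub>R \<theta> + y)) \<partial>lborel \<partial>?H)"
      by (rule c(3)) measurable
    also have "(\<integral>\<^sup>+ y. \<integral>\<^sup>+ s. ennreal (V (s *\<^sub>R \<theta> + y)) * indicator S (hyper_proj \<theta> (s *\<^sub>R \<theta> + y)) \<partial>lborel \<partial>?H)
        = (\<integral>\<^sup>+ y. J V y * indicator S y \<partial>?H)"
    proof (rule nn_integral_cong)
      fix y assume "y \<in> space ?H"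
      then have "y \<in> hyperplane \<theta>" by (simp add: space_hyperplane_lborel)
      then show "(\<integral>\<^sup>+ s. ennreal (V (s *\<^sub>R \<theta> + y)) * indicator S (hyper_proj \<theta> (s *\<^sub>R \<theta> + y)) \<partial>lborel) = J V y * indicator S y"
        by (simp add: hyper_proj_line(2)[OF \<theta>] J_def nn_integral_multc)
    qed
    finally show ?thesis .
  qed
  have "AE y in ?H. J W y = J (\<lambda>x. - W x) y"
  proof (rule finite_density_unique[THEN iffD1])
    show "J W \<in> borel_measurable ?H" "J (\<lambda>x. - W x) \<in> borel_measurable ?H"
      by (simp_all add: J_meas)
    have "c * (\<integral>\<^sup>+ y. J W y \<partial>?H) = (\<integral>\<^sup>+x. ennreal (W x) \<partial>lborel)"
      using cyl[OF W_meas, of UNIV] by simp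
    also have "\<dots> \<le> (\<integral>\<^sup>+x. ennreal (norm (W x)) \<partial>lborel)"
      by (intro nn_integral_mono ennreal_leI) simp
    also have "\<dots> < \<infinity>" using W by (simp add: integrable_iff_bounded)
    finally show "(\<integral>\<^sup>+ y. J W y \<partial>?H) \<noteq> \<infinity>"
      using c(1) by (auto simp: ennreal_mult_eq_top_iff ennreal_mult_less_top)
    show "density ?H (J W) = density ?H (J (\<lambda>x. - W x))"
    proof (rule measure_eqI)
      fix S assume "S \<in> sets (density ?H (J W))"
      then have SH: "S \<in> sets ?H" by simp
      then obtain S' where S': "S = hyperplane \<theta> \<inter> S'" "S' \<in> sets borel"
        by (auto simp: sets_hyperplane_lborel sets_restrict_space)
      have "emeasure (density ?H (J V)) S = (\<integral>\<^sup>+ y. J V y * indicator S' y \<partial>?H)"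
        if "V \<in> borel_measurable borel" for V
        unfolding emeasure_density[OF J_meas[OF that] SH]
        by (rule nn_integral_cong) (auto simp: S' space_hyperplane_lborel indicator_def)
      moreover have "c * (\<integral>\<^sup>+ y. J W y * indicator S' y \<partial>?H) = c * (\<integral>\<^sup>+ y. J (\<lambda>x. - W x) y * indicator S' y \<partial>?H)"
        using integral_boxes_zero_imp[OF W _ 0 S'(2)] S'(2) by (simp add: cyl)
      ultimately show "emeasure (density ?H (J W)) S = emeasure (density ?H (J (\<lambda>x. - W x))) S"
        using c(1,2) by (auto simp: ennreal_mult_cancel_left)
    qed simp
  qed simp_all
  then show ?thesis
  proof eventually_elim
    case (elim y)
    show ?case
    \<comment> \<open>A line on which \<open>W\<close> is not integrable has Bochner integral 0 by
      convention.\<close>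
    proof (cases "integrable lborel (\<lambda>s. W (s *\<^sub>R \<theta> + y))")
      case True
      then show ?thesis using elim real_lebesgue_integral_def[OF True] by (simp add: J_def)
    qed (rule not_integrable_integral_eq)
  qed
qed

lemma AE_integrable_line:
  fixes \<theta> :: "'a::euclidean_space"
  assumes \<theta>: "norm \<theta> = 1" and W: "integrable lborel (W :: _ \<Rightarrow> real)"
  shows "AE y in hyperplane_lborel \<theta>. integrable lborel (\<lambda>s. W (s *\<^sub>R \<theta> + y))"
proof -
  have [measurable]: "W \<in> borel_measurable borel" using W by auto
  let ?H = "hyperplane_lborel \<theta>"
  obtain c where c: "0 < c" "c < \<infinity>" "\<And>h. h \<in> borel_measurable borel \<Longrightarrow>
      (\<integral>\<^sup>+ x. h x \<partial>lborel) = c * (\<integral>\<^sup>+ y. \<integral>\<^sup>+ s. h (s *\<^sub>R \<theta> + y) \<partial>lborel \<partial>?H)"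
    using lborel_fubini_hyperplane[OF \<theta>] by blast
  have "c * (\<integral>\<^sup>+ y. \<integral>\<^sup>+ s. ennreal (norm (W (s *\<^sub>R \<theta> + y))) \<partial>lborel \<partial>?H) < \<infinity>"
    using W by (subst c(3)[symmetric]) (auto simp: integrable_iff_bounded)
  then have "(\<integral>\<^sup>+ y. \<integral>\<^sup>+ s. ennreal (norm (W (s *\<^sub>R \<theta> + y))) \<partial>lborel \<partial>?H) \<noteq> \<infinity>"
    using c(1) by (auto simp: ennreal_mult_less_top)
  moreover have "(\<lambda>y. \<integral>\<^sup>+ s. ennreal (norm (W (s *\<^sub>R \<theta> + y))) \<partial>lborel) \<in> borel_measurable ?H"
    by (rule measurable_hyperplane_lborel[of _ borel]) auto
  ultimately have "AE y in ?H. (\<integral>\<^sup>+ s. ennreal (norm (W (s *\<^sub>R \<theta> + y))) \<partial>lborel) \<noteq> \<infinity>"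
    by (intro nn_integral_PInf_AE)
  then show ?thesis
    by eventually_elim (simp add: integrable_iff_bounded less_top)
qed

text \<open>In the limit the second bump becomes the indicator of an arbitrary box, so almost every
  line satisfies the identity with the cut-off included. On the line through \<open>y\<close> the
  cut-off is the constant \<open>bump 0 l r y\<close>, nonzero for \<open>y\<close> in
  \<open>box l r\<close>, and can be divided out.\<close>

lemma AE_line_test:
  fixes u v :: "'a::euclidean_space \<Rightarrow> real"
  assumes \<theta>: "norm \<theta> = 1" and \<Omega>: "open \<Omega>"
    and u: "u \<in> borel_measurable (lebesgue_on \<Omega>)" and v: "v \<in> borel_measurable (lebesgue_on \<Omega>)"
    and weak: "weak_dir_deriv \<theta> \<Omega> u v"
    and w: "integrable lborel w" "AE x in lborel. x \<in> \<Omega> \<longrightarrow> w x = u x" "\<And>x. x \<notin> \<Omega> \<Longrightarrow> w x = 0"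
    and z: "integrable lborel z" "AE x in lborel. x \<in> \<Omega> \<longrightarrow> z x = v x" "\<And>x. x \<notin> \<Omega> \<Longrightarrow> z x = 0"
    and t: "test_pair p q A \<phi>" and sm: "smooth \<phi>"
    and K: "{x. p \<le> x \<bullet> \<theta> \<and> x \<bullet> \<theta> \<le> q \<and> hyper_proj \<theta> x \<in> cbox l r} \<subseteq> \<Omega>"
  shows "AE y in hyperplane_lborel \<theta>. y \<in> box l r \<longrightarrow>
    (\<integral>s. w (s *\<^sub>R \<theta> + y) * \<phi> s + z (s *\<^sub>R \<theta> + y) * A s \<partial>lborel) = 0"
proof -
  have [measurable]: "w \<in> borel_measurable borel" "z \<in> borel_measurable borel" using w z by auto
  note [measurable] = test_pairD(8,9)[OF t]
  have bm[measurable]: "bump m a b \<in> borel_measurable borel" for m and a b :: 'a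
    by (rule smooth_borel_measurable[OF smooth_bump])
  have b01: "\<bar>bump m a b y\<bar> \<le> 1" for m and a b y :: 'a
    using bump_nonneg[of m a b y] bump_le_1[of m a b y] by simp
  define W where "W = (\<lambda>x. (w x * \<phi> (x \<bullet> \<theta>) + z x * A (x \<bullet> \<theta>)) * bump 0 l r (hyper_proj \<theta> x))"
  obtain C where C: "\<And>s. \<bar>\<phi> s\<bar> \<le> C"
    using continuous_compact_support_bounded[OF test_pairD(3)[OF t] test_pairD(6)[OF t]] by blast
  obtain D where D: "\<And>s. \<bar>A s\<bar> \<le> D"
    using continuous_compact_support_bounded[OF test_pairD(4)[OF t] test_pairD(5)[OF t]] by blast
  have "integrable lborel (\<lambda>x. w x * \<phi> (x \<bullet> \<theta>))" "integrable lborel (\<lambda>x. z x * A (x \<bullet> \<theta>))"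
    by (rule integrable_mult_bounded[OF w(1) _ C], measurable, rule integrable_mult_bounded[OF z(1) _ D], measurable)
  then have W: "integrable lborel W"
    unfolding W_def by (intro integrable_mult_bounded[OF Bochner_Integration.integrable_add _ b01]) auto
  have [measurable]: "W \<in> borel_measurable borel" using W by auto
  have "(\<integral>x. W x * indicator (box l' r') (hyper_proj \<theta> x) \<partial>lborel) = 0" for l' r'
  proof -
    have "(\<lambda>n. \<integral>x. W x * bump n l' r' (hyper_proj \<theta> x) \<partial>lborel) \<longlonglongrightarrow> (\<integral>x. W x * indicator (box l' r') (hyper_proj \<theta> x) \<partial>lborel)"
    proof (rule integral_dominated_convergence[where w = "\<lambda>x. \<bar>W x\<bar>"])
      show "AE x in lborel. (\<lambda>n. W x * bump n l' r' (hyper_proj \<theta> x)) \<longlonglongrightarrow> W x * indicator (box l' r') (hyper_proj \<theta> x)"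
        by (intro AE_I2 tendsto_mult tendsto_const bump_tendsto)
      show "AE x in lborel. norm (W x * bump n l' r' (hyper_proj \<theta> x)) \<le> \<bar>W x\<bar>" for n
        using b01 by (auto simp: abs_mult intro!: mult_left_le)
    qed (use W in simp_all)
    then show ?thesis
      using cylinder_test_identity[OF \<theta> \<Omega> u v weak w z t sm K]
      by (simp add: W_def LIMSEQ_const_iff)
  qed
  from AE_hyperplane_if_cylinder_integrals_zero[OF \<theta> W this] AE_space show ?thesis
  proof eventually_elim
    case (elim y)
    then have y: "y \<in> hyperplane \<theta>" by (simp add: space_hyperplane_lborel)
    show ?case
    proof
      assume "y \<in> box l r"
      then have "bump 0 l r y \<noteq> 0" by (simp add: bump_eq_0_iff)
      moreover have "W (s *\<^sub>R \<theta> + y) = (w (s *\<^sub>R \<theta> + y) * \<phi> s + z (s *\<^sub>R \<theta> + y) * A s) * bump 0 l r y" for s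
        by (simp add: W_def hyper_proj_line(2,3)[OF \<theta> y])
      ultimately show "(\<integral>s. w (s *\<^sub>R \<theta> + y) * \<phi> s + z (s *\<^sub>R \<theta> + y) * A s \<partial>lborel) = 0"
        using elim(1) by simp
    qed
  qed
qed

lemma countable_rational_vectors: "countable {a :: 'a::euclidean_space. \<forall>i\<in>Basis. a \<bullet> i \<in> \<rat>}"
proof (rule countable_subset)
  show "{a :: 'a. \<forall>i\<in>Basis. a \<bullet> i \<in> \<rat>} \<subseteq> (\<lambda>f. \<Sum>i\<in>Basis. f i *\<^sub>R i) ` (Pi\<^sub>E Basis (\<lambda>_. \<rat>))"
  proof
    fix a :: 'a assume "a \<in> {a. \<forall>i\<in>Basis. a \<bullet> i \<in> \<rat>}"
    then show "a \<in> (\<lambda>f. \<Sum>i\<in>Basis. f i *\<^sub>R i) ` (Pi\<^sub>E Basis (\<lambda>_. \<rat>))"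
      by (intro image_eqI[of _ _ "\<lambda>i\<in>Basis. a \<bullet> i"]) (auto simp: euclidean_representation)
  qed
qed (intro countable_image countable_PiE countable_rat finite_Basis)

text \<open>Countably many choices of \<open>n\<close>, \<open>a\<close>, \<open>b\<close>,
  \<open>a'\<close>, \<open>b'\<close>, \<open>l\<close>, \<open>r\<close> leave one null set of
  lines. Off it, an arbitrary real interval in the section is treated by finding, for each rational
  test interval inside it, a rational box around \<open>y\<close> whose cylinder lies in
  \<Omega>.\<close>

lemma AE_line_primitive:
  fixes u v :: "'a::euclidean_space \<Rightarrow> real"
  assumes \<theta>: "norm \<theta> = 1" and \<Omega>: "open \<Omega>"
    and u: "u \<in> borel_measurable (lebesgue_on \<Omega>)" and v: "v \<in> borel_measurable (lebesgue_on \<Omega>)"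
    and weak: "weak_dir_deriv \<theta> \<Omega> u v"
    and w: "integrable lborel w" "AE x in lborel. x \<in> \<Omega> \<longrightarrow> w x = u x" "\<And>x. x \<notin> \<Omega> \<Longrightarrow> w x = 0"
    and z: "integrable lborel z" "AE x in lborel. x \<in> \<Omega> \<longrightarrow> z x = v x" "\<And>x. x \<notin> \<Omega> \<Longrightarrow> z x = 0"
  shows "AE y in hyperplane_lborel \<theta>. \<forall>\<alpha> \<beta>. \<alpha> < \<beta> \<longrightarrow> {\<alpha><..<\<beta>} \<subseteq> line_section \<theta> \<Omega> y \<longrightarrow>
    (\<exists>c. AE s in lborel. s \<in> {\<alpha><..<\<beta>} \<longrightarrow> w (s *\<^sub>R \<theta> + y) = c + primitive (\<lambda>s. z (s *\<^sub>R \<theta> + y)) \<alpha> s)"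
proof -
  let ?V = "{a :: 'a. \<forall>i\<in>Basis. a \<bullet> i \<in> \<rat>}"
  define good where "good = (\<lambda>n a b a' b' y. \<exists>A. test_pair (min a a') (max b b') A (zero_mean_bump n a b a' b') \<and>
      (\<integral>s. w (s *\<^sub>R \<theta> + y) * zero_mean_bump n a b a' b' s + z (s *\<^sub>R \<theta> + y) * A s \<partial>lborel) = 0)"
  have "AE y in hyperplane_lborel \<theta>. \<forall>n. \<forall>a\<in>\<rat>. \<forall>b\<in>\<rat>. \<forall>a'\<in>\<rat>. \<forall>b'\<in>\<rat>. \<forall>l\<in>?V. \<forall>r\<in>?V.
      a < b \<and> a' < b' \<and> {x. min a a' \<le> x \<bullet> \<theta> \<and> x \<bullet> \<theta> \<le> max b b' \<and> hyper_proj \<theta> x \<in> cbox l r} \<subseteq> \<Omega> \<and> y \<in> box l r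
      \<longrightarrow> good n a b a' b' y"
  proof (intro AE_all_countable[THEN iffD2] allI AE_ball_countable' countable_rat countable_rational_vectors)
    fix n a b a' b' and l r :: 'a
    show "AE y in hyperplane_lborel \<theta>. a < b \<and> a' < b' \<and>
        {x. min a a' \<le> x \<bullet> \<theta> \<and> x \<bullet> \<theta> \<le> max b b' \<and> hyper_proj \<theta> x \<in> cbox l r} \<subseteq> \<Omega> \<and> y \<in> box l r
      \<longrightarrow> good n a b a' b' y"
    proof (cases "a < b \<and> a' < b' \<and>
        {x. min a a' \<le> x \<bullet> \<theta> \<and> x \<bullet> \<theta> \<le> max b b' \<and> hyper_proj \<theta> x \<in> cbox l r} \<subseteq> \<Omega>")
      case True
      obtain A where A: "test_pair (min a a') (max b b') A (zero_mean_bump n a b a' b')"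
        using test_pair_zero_mean_bump[of a b a' b' n] True by blast
      have "AE y in hyperplane_lborel \<theta>. y \<in> box l r \<longrightarrow>
          (\<integral>s. w (s *\<^sub>R \<theta> + y) * zero_mean_bump n a b a' b' s + z (s *\<^sub>R \<theta> + y) * A s \<partial>lborel) = 0"
        by (rule AE_line_test[OF \<theta> \<Omega> u v weak w z A smooth_zero_mean_bump]) (use True in auto)
      then show ?thesis by eventually_elim (use A in \<open>auto simp: good_def\<close>)
    qed auto
  qed
  moreover note AE_integrable_line[OF \<theta> w(1)] AE_integrable_line[OF \<theta> z(1)] AE_space
  ultimately show ?thesis
  proof eventually_elim
    case (elim y)
    then have y: "y \<in> hyperplane \<theta>" by (simp add: space_hyperplane_lborel)
    show ?case
    proof (intro allI impI)
      fix \<alpha> \<beta> :: real assume \<alpha>\<beta>: "\<alpha> < \<beta>" and sub: "{\<alpha><..<\<beta>} \<subseteq> line_section \<theta> \<Omega> y"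
      show "\<exists>c. AE s in lborel. s \<in> {\<alpha><..<\<beta>} \<longrightarrow> w (s *\<^sub>R \<theta> + y) = c + primitive (\<lambda>s. z (s *\<^sub>R \<theta> + y)) \<alpha> s"
      proof (rule du_bois_reymond_rational[OF elim(2,3) \<alpha>\<beta>])
        fix n a b a' b' assume R: "a \<in> \<rat>" "b \<in> \<rat>" "a' \<in> \<rat>" "b' \<in> \<rat>" "a < b" "a' < b'"
          "\<alpha> < min a a'" "max b b' < \<beta>"
        let ?S = "(\<lambda>s. s *\<^sub>R \<theta> + y) ` {min a a'..max b b'}"
        have "compact ?S" by (intro compact_continuous_image continuous_intros compact_Icc)
        moreover have "?S \<subseteq> \<Omega>"
        proof -
          have "s *\<^sub>R \<theta> + y \<in> \<Omega>" if "min a a' \<le> s" "s \<le> max b b'" for s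
            using subsetD[OF sub, of s] less_le_trans[OF R(7) that(1)] le_less_trans[OF that(2) R(8)]
            by (simp add: line_section_def)
          then show ?thesis by auto
        qed
        \<comment> \<open>The compact segment over the test interval has a tube of positive radius
          in \<Omega>.\<close>
        ultimately obtain e where e: "e > 0" "(\<Union>x\<in>?S. ball x e) \<subseteq> \<Omega>"
          using compact_subset_open_imp_ball_epsilon_subset[OF _ \<Omega>] by metis
        \<comment> \<open>Half the radius, so that also the closed box, which bounds the support,
          stays in the open ball of radius \<open>e\<close>.\<close>
        obtain l r where lr: "l \<in> ?V" "r \<in> ?V" "y \<in> box l r" "box l r \<subseteq> ball y (e / 2)"
          using rational_boxes[of "e / 2" y] e(1) by auto
        have "cbox l r \<subseteq> cball y (e / 2)"
          using closure_mono[OF lr(4)] closure_box[of l r] lr(3) e(1) by (metis closure_ball empty_iff half_gt_zero)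
        then have cb: "cbox l r \<subseteq> ball y e" using e(1) by (auto simp: subset_eq)
        have "{x. min a a' \<le> x \<bullet> \<theta> \<and> x \<bullet> \<theta> \<le> max b b' \<and> hyper_proj \<theta> x \<in> cbox l r} \<subseteq> \<Omega>"
        proof
          fix x assume x: "x \<in> {x. min a a' \<le> x \<bullet> \<theta> \<and> x \<bullet> \<theta> \<le> max b b' \<and> hyper_proj \<theta> x \<in> cbox l r}"
          have "dist ((x \<bullet> \<theta>) *\<^sub>R \<theta> + y) x = dist ((x \<bullet> \<theta>) *\<^sub>R \<theta> + y) ((x \<bullet> \<theta>) *\<^sub>R \<theta> + hyper_proj \<theta> x)"
            by (simp only: hyper_proj_line(4)[OF \<theta>])
          also have "\<dots> < e" using x cb by (auto simp: dist_norm)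
          finally have "x \<in> ball ((x \<bullet> \<theta>) *\<^sub>R \<theta> + y) e" by simp
          moreover have "(x \<bullet> \<theta>) *\<^sub>R \<theta> + y \<in> ?S" using x by auto
          ultimately show "x \<in> \<Omega>" using e(2) by blast
        qed
        then show "\<exists>A. test_pair (min a a') (max b b') A (zero_mean_bump n a b a' b') \<and>
            (\<integral>s. w (s *\<^sub>R \<theta> + y) * zero_mean_bump n a b a' b' s + z (s *\<^sub>R \<theta> + y) * A s \<partial>lborel) = 0"
          using elim(1) R lr unfolding good_def by blast
      qed
    qed
  qed
qed

section \<open>End points of components and directional traces\<close>

text \<open>If \<beta> were in \<open>S\<close>, then ]\<alpha>,\<beta>] would be a connected subset
  larger than the component.\<close>

lemma component_interval_right_end:
  fixes S :: "real set"
  assumes S: "open S" and C: "{\<alpha><..<\<beta>} \<in> components S"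
  shows "\<alpha> < \<beta>" "{\<alpha><..<\<beta>} \<subseteq> S" "\<beta> \<notin> S"
proof -
  show 1: "\<alpha> < \<beta>" using in_components_nonempty[OF C] by auto
  show 2: "{\<alpha><..<\<beta>} \<subseteq> S" by (rule in_components_subset[OF C])
  show "\<beta> \<notin> S"
  proof
    assume "\<beta> \<in> S"
    then have "{\<alpha><..\<beta>} \<subseteq> S" using 2 by (force simp: subset_eq)
    moreover have "{\<alpha><..<\<beta>} \<inter> {\<alpha><..\<beta>} = {\<alpha><..<\<beta>}" by auto
    then have "{\<alpha><..<\<beta>} \<inter> {\<alpha><..\<beta>} \<noteq> {}" using in_components_nonempty[OF C] by simp
    moreover have "connected {\<alpha><..\<beta>}" by simp
    ultimately have "{\<alpha><..\<beta>} \<subseteq> {\<alpha><..<\<beta>}" using components_maximal[OF C] by blast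
    then show False using 1 by auto
  qed
qed

text \<open>The component of the point \<beta> - e/2 is open, connected and bounded. It cannot pass
  \<beta> and contains everything just before it, so it is the interval from its infimum to
  \<beta>.\<close>

lemma component_interval_ex:
  fixes S :: "real set"
  assumes S: "open S" "bounded S" and sub: "{\<beta> - e<..<\<beta>} \<subseteq> S" and e: "e > 0" and \<beta>: "\<beta> \<notin> S"
  shows "\<exists>\<alpha>. {\<alpha><..<\<beta>} \<in> components S"
proof -
  define s where "s = \<beta> - e / 2"
  have s: "\<beta> - e < s" "s < \<beta>" using e by (auto simp: s_def)
  let ?C = "connected_component_set S s"
  have sS: "s \<in> S" using sub s by auto
  have CS: "?C \<subseteq> S" by (rule connected_component_subset)
  have sC: "s \<in> ?C" using sS by (simp add: connected_component_refl)
  have conn: "connected ?C" by (rule connected_connected_component)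
  have op: "open ?C" by (rule open_connected_component[OF S(1)])
  have bdd: "bdd_below ?C" using bounded_imp_bdd_below[OF bounded_subset[OF S(2) CS]] .
  have big: "{\<beta> - e<..<\<beta>} \<subseteq> ?C"
    by (rule connected_component_maximal) (use s sub in auto)
  define \<alpha> where "\<alpha> = Inf ?C"
  have "?C = {\<alpha><..<\<beta>}"
  proof (intro equalityI subsetI)
    fix x assume x: "x \<in> ?C"
    have "x < \<beta>"
    proof (rule ccontr)
      assume "\<not> x < \<beta>"
      then have "\<beta> \<in> {s..x}" using s by auto
      then have "\<beta> \<in> ?C" using connected_contains_Icc[OF conn sC x] by blast
      then show False using CS \<beta> by auto
    qed
    moreover obtain d where d: "d > 0" "ball x d \<subseteq> ?C" using op x open_contains_ball by blast
    then have "x - d / 2 \<in> ?C" by (auto simp: dist_real_def subset_eq)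
    then have "\<alpha> \<le> x - d / 2" unfolding \<alpha>_def by (rule cInf_lower[OF _ bdd])
    ultimately show "x \<in> {\<alpha><..<\<beta>}" using d(1) by auto
  next
    fix x assume x: "x \<in> {\<alpha><..<\<beta>}"
    have "?C \<noteq> {}" using sC by blast
    moreover have "Inf ?C < x" using x by (simp add: \<alpha>_def)
    ultimately obtain c where c: "c \<in> ?C" "c < x" using cInf_lessD[of ?C x] by metis
    show "x \<in> ?C"
    proof (cases "x \<le> s")
      case True
      then have "x \<in> {c..s}" using c(2) by simp
      then show ?thesis using connected_contains_Icc[OF conn c(1) sC] by blast
    next
      case False
      then have "x \<in> {\<beta> - e<..<\<beta>}" using x s by auto
      then show ?thesis using big by blast
    qed
  qed
  moreover have "?C \<in> components S" using sS by (auto simp: components_def)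
  ultimately show ?thesis by auto
qed

lemma open_line_section: "open \<Omega> \<Longrightarrow> open (line_section \<theta> \<Omega> y)"
  unfolding line_section_def
  using open_vimage[of \<Omega> "\<lambda>s. s *\<^sub>R \<theta> + y"] by (simp add: vimage_def continuous_intros)

lemma bounded_line_section:
  assumes "bounded \<Omega>" "norm \<theta> = 1" shows "bounded (line_section \<theta> \<Omega> y)"
proof -
  obtain R where R: "\<And>x. x \<in> \<Omega> \<Longrightarrow> norm x \<le> R" using assms(1) bounded_iff by metis
  have "norm s \<le> R + norm y" if "s \<in> line_section \<theta> \<Omega> y" for s
  proof -
    have "norm s = norm ((s *\<^sub>R \<theta> + y) - y)" using assms(2) by simp
    also have "\<dots> \<le> norm (s *\<^sub>R \<theta> + y) + norm y" by (rule norm_triangle_ineq4)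
    also have "\<dots> \<le> R + norm y" using R that by (simp add: line_section_def)
    finally show ?thesis .
  qed
  then show ?thesis unfolding bounded_iff by blast
qed

section \<open>Exit points and right end points of components\<close>

lemma frontier_component_end:
  assumes \<Omega>: "open \<Omega>" and C: "{\<alpha><..<\<beta>} \<in> components (line_section \<theta> \<Omega> y)"
  shows "\<beta> *\<^sub>R \<theta> + y \<in> frontier \<Omega>"
proof -
  note c = component_interval_right_end[OF open_line_section[OF \<Omega>] C]
  have "(\<lambda>s. s *\<^sub>R \<theta> + y) ` closure {\<alpha><..<\<beta>} \<subseteq> closure \<Omega>"
    using c(2) closure_subset[of \<Omega>]
    by (intro image_closure_subset continuous_intros) (auto simp: line_section_def)
  moreover have "\<beta> \<in> closure {\<alpha><..<\<beta>}" using c(1) by simp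
  ultimately have "\<beta> *\<^sub>R \<theta> + y \<in> closure \<Omega>" by blast
  then show ?thesis using c(3) \<Omega> by (simp add: frontier_def interior_open line_section_def)
qed

text \<open>This links the directional measure to the components: the exit point is constant along a
  component, so each right end point is hit by a whole interval of its line.\<close>

lemma exit_point_component:
  assumes \<Omega>: "bounded \<Omega>" "open \<Omega>" and \<theta>: "norm \<theta> = 1"
    and C: "{\<alpha><..<\<beta>} \<in> components (line_section \<theta> \<Omega> y)" and s: "\<alpha> < s" "s < \<beta>"
  shows "exit_point \<theta> \<Omega> (s *\<^sub>R \<theta> + y) = \<beta> *\<^sub>R \<theta> + y"
proof -
  note c = component_interval_right_end[OF open_line_section[OF \<Omega>(2)] C]
  let ?x = "s *\<^sub>R \<theta> + y"
  let ?d = "exit_time \<theta> \<Omega> ?x"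
  have x: "?x \<in> \<Omega>" using c(2) s by (auto simp: line_section_def)
  have shift: "?x + t *\<^sub>R \<theta> = (s + t) *\<^sub>R \<theta> + y" for t by (simp add: algebra_simps)
  have "\<not> \<beta> - s < ?d"
  proof
    assume "\<beta> - s < ?d"
    then have "?x + (\<beta> - s) *\<^sub>R \<theta> \<in> \<Omega>"
      using less_exit_time_iff[OF \<Omega> \<theta> x, of "\<beta> - s"] s by auto
    then show False using c(3) by (simp add: shift line_section_def)
  qed
  moreover have "\<not> ?d < \<beta> - s"
  proof
    assume d: "?d < \<beta> - s"
    have "?x + t *\<^sub>R \<theta> \<in> \<Omega>" if "t \<in> {0..?d}" for t
      using subsetD[OF c(2), of "s + t"] that d s unfolding shift by (simp add: line_section_def)
    then show False using less_exit_time_iff[OF \<Omega> \<theta> x, of ?d] exit_time_pos[OF \<Omega> \<theta> x] by simp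
  qed
  ultimately have "?d = \<beta> - s" by simp
  then show ?thesis by (simp add: exit_point_def shift)
qed

text \<open>On the frontier these are the right end points of components; points of \<Omega> belong
  to it as well. The lengths 1 / (n + 1) make it a countable union.\<close>

definition exit_set :: "'a::euclidean_space \<Rightarrow> 'a set \<Rightarrow> 'a set" where
  "exit_set \<theta> \<Omega> = {z. \<exists>n::nat. \<forall>t\<in>{0<..1 / real (Suc n)}. z - t *\<^sub>R \<theta> \<in> \<Omega>}"

lemma exit_setI:
  assumes "d > 0" "\<And>t. 0 < t \<Longrightarrow> t \<le> d \<Longrightarrow> z - t *\<^sub>R \<theta> \<in> \<Omega>"
  shows "z \<in> exit_set \<theta> \<Omega>"
proof -
  obtain n where n: "1 / real (Suc n) < d" using nat_approx_posE[OF assms(1)] by blast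
  have "z - t *\<^sub>R \<theta> \<in> \<Omega>" if "t \<in> {0<..1 / real (Suc n)}" for t
    using assms(2)[of t] that n by simp
  then show ?thesis unfolding exit_set_def by blast
qed

text \<open>That a closed segment running backwards along \<theta> stays in \<Omega> is a lower
  bound for the exit time in direction -\<theta> at its starting point, an open condition. A segment
  missing its end point is a countable union of closed ones, so the set is a countable union of
  countable intersections of open sets.\<close>

lemma exit_set_borel:
  assumes \<Omega>: "bounded \<Omega>" "open \<Omega>" and \<theta>: "norm \<theta> = 1"
  shows "exit_set \<theta> \<Omega> \<in> sets borel"
proof -
  define V where "V = (\<lambda>c. {x \<in> \<Omega>. c < exit_time (- \<theta>) \<Omega> x})"
  define a where "a = (\<lambda>n. 1 / real (Suc n))"
  have a: "0 < a n" for n by (simp add: a_def)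
  have mem: "z - b *\<^sub>R \<theta> \<in> V (d - b) \<longleftrightarrow> (\<forall>t\<in>{b..d}. z - t *\<^sub>R \<theta> \<in> \<Omega>)" if "b \<le> d" for z b d
  proof -
    have "z - b *\<^sub>R \<theta> \<in> V (d - b) \<longleftrightarrow> z - b *\<^sub>R \<theta> \<in> \<Omega> \<and> (\<forall>t\<in>{0..d - b}. z - b *\<^sub>R \<theta> + t *\<^sub>R (- \<theta>) \<in> \<Omega>)"
    proof (cases "z - b *\<^sub>R \<theta> \<in> \<Omega>")
      case True
      have "norm (- \<theta>) = 1" "0 \<le> d - b" using \<theta> that by auto
      from less_exit_time_iff[OF \<Omega> this(1) True this(2)] True show ?thesis
        unfolding V_def by blast
    qed (simp add: V_def)
    also have "\<dots> \<longleftrightarrow> (\<forall>t\<in>{0..d - b}. z - (b + t) *\<^sub>R \<theta> \<in> \<Omega>)"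
    proof -
      have "z - b *\<^sub>R \<theta> + t *\<^sub>R (- \<theta>) = z - (b + t) *\<^sub>R \<theta>" for t by (simp add: algebra_simps)
      moreover have "0 \<in> {0..d - b}" using that by simp
      ultimately show ?thesis by (metis add.right_neutral)
    qed
    also have "\<dots> \<longleftrightarrow> (\<forall>t\<in>{b..d}. z - t *\<^sub>R \<theta> \<in> \<Omega>)"
    proof
      assume *: "\<forall>t\<in>{0..d - b}. z - (b + t) *\<^sub>R \<theta> \<in> \<Omega>"
      show "\<forall>t\<in>{b..d}. z - t *\<^sub>R \<theta> \<in> \<Omega>"
      proof
        fix t assume "t \<in> {b..d}"
        then show "z - t *\<^sub>R \<theta> \<in> \<Omega>" using *[rule_format, of "t - b"] by simp
      qed
    qed auto
    finally show ?thesis .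
  qed
  have "z \<in> exit_set \<theta> \<Omega> \<longleftrightarrow> (\<exists>n. \<forall>m\<in>{n..}. z - a m *\<^sub>R \<theta> \<in> V (a n - a m))" for z
  proof -
    have "(\<forall>t\<in>{0<..a n}. z - t *\<^sub>R \<theta> \<in> \<Omega>) \<longleftrightarrow> (\<forall>m\<in>{n..}. z - a m *\<^sub>R \<theta> \<in> V (a n - a m))" for n
    proof
      assume *: "\<forall>t\<in>{0<..a n}. z - t *\<^sub>R \<theta> \<in> \<Omega>"
      show "\<forall>m\<in>{n..}. z - a m *\<^sub>R \<theta> \<in> V (a n - a m)"
      proof
        fix m assume "m \<in> {n..}"
        then have "a m \<le> a n" by (simp add: a_def frac_le)
        then show "z - a m *\<^sub>R \<theta> \<in> V (a n - a m)" using * a[of m] by (subst mem) auto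
      qed
    next
      assume *: "\<forall>m\<in>{n..}. z - a m *\<^sub>R \<theta> \<in> V (a n - a m)"
      show "\<forall>t\<in>{0<..a n}. z - t *\<^sub>R \<theta> \<in> \<Omega>"
      proof
        fix t assume t: "t \<in> {0<..a n}"
        then obtain k where k: "a k < t" using nat_approx_posE[of t] unfolding a_def by auto
        \<comment> \<open>The index must be at least \<open>n\<close> for the hypothesis and at
          least \<open>k\<close> for \<open>t\<close> to lie in the closed segment.\<close>
        have le: "a (max k n) \<le> a k" "a (max k n) \<le> a n" by (auto simp: a_def frac_le)
        have "z - a (max k n) *\<^sub>R \<theta> \<in> V (a n - a (max k n))" using * by simp
        then show "z - t *\<^sub>R \<theta> \<in> \<Omega>" using t k le by (subst (asm) mem) auto
      qed
    qed
    then show ?thesis by (simp add: exit_set_def a_def)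
  qed
  then have eq: "exit_set \<theta> \<Omega> = (\<Union>n. \<Inter>m\<in>{n..}. (\<lambda>z. z - a m *\<^sub>R \<theta>) -` V (a n - a m))"
    by auto
  have "open ((\<lambda>z. z - b *\<^sub>R \<theta>) -` V c)" for b c
    unfolding V_def using open_less_exit_time[of \<Omega> "- \<theta>" c] \<Omega> \<theta>
    by (intro open_vimage continuous_intros) auto
  then show ?thesis
    unfolding eq by (intro sets.countable_UN sets.countable_INT' subsetI) auto
qed

text \<open>Converse direction to \<open>AE_line\<close>: a null set of lines sweeps out a null set
  of the space.\<close>

lemma AE_hyper_proj:
  fixes \<theta> :: "'a::euclidean_space"
  assumes \<theta>: "norm \<theta> = 1" and S: "S \<in> sets borel" and 0: "AE y in hyperplane_lborel \<theta>. y \<notin> S"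
  shows "AE x in lborel. hyper_proj \<theta> x \<notin> S"
proof -
  note [measurable] = S
  let ?H = "hyperplane_lborel \<theta>"
  obtain c where c: "0 < c" "c < \<infinity>" "\<And>h. h \<in> borel_measurable borel \<Longrightarrow>
      (\<integral>\<^sup>+ x. h x \<partial>lborel) = c * (\<integral>\<^sup>+ y. \<integral>\<^sup>+ s. h (s *\<^sub>R \<theta> + y) \<partial>lborel \<partial>?H)"
    using lborel_fubini_hyperplane[OF \<theta>] by blast
  have "AE y in ?H. (\<integral>\<^sup>+ s. indicator S (hyper_proj \<theta> (s *\<^sub>R \<theta> + y)) \<partial>lborel) = 0"
    using 0 AE_space by eventually_elim (simp add: space_hyperplane_lborel hyper_proj_line(2)[OF \<theta>])
  then have "(\<integral>\<^sup>+ y. \<integral>\<^sup>+ s. indicator S (hyper_proj \<theta> (s *\<^sub>R \<theta> + y)) \<partial>lborel \<partial>?H) = (\<integral>\<^sup>+ y. 0 \<partial>?H)"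
    by (rule nn_integral_cong_AE)
  then have "(\<integral>\<^sup>+ x. indicator S (hyper_proj \<theta> x) \<partial>lborel) = 0"
    by (subst c(3)) auto
  then have "AE x in lborel. indicator S (hyper_proj \<theta> x) = (0::ennreal)"
    by (subst (asm) nn_integral_0_iff_AE) auto
  then show ?thesis by eventually_elim (auto simp: indicator_def split: if_splits)
qed

text \<open>Boundary points that are not right end points of components form a \<open>\<mu>\<^sub>\<theta>\<close>-null set.\<close>

lemma negligible_directional_iff:
  assumes \<Omega>: "bounded \<Omega>" "open \<Omega>" and \<theta>: "norm \<theta> = 1"
  shows "negligible_for (directional_measure \<theta> \<Omega>) {z \<in> frontier \<Omega>. \<not> R z} \<longleftrightarrow>
    (AE y in hyperplane_lborel \<theta>. \<forall>\<alpha> \<beta>. {\<alpha><..<\<beta>} \<in> components (line_section \<theta> \<Omega> y) \<longrightarrow> R (\<beta> *\<^sub>R \<theta> + y))"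
    (is "?L \<longleftrightarrow> (AE y in ?H. ?Q y)")
proof
  assume ?L
  then obtain N where N: "N \<in> null_sets (directional_measure \<theta> \<Omega>)" "{z \<in> frontier \<Omega>. \<not> R z} \<subseteq> N"
    by (auto simp: negligible_for_def)
  then have Ns: "N \<in> sets (restrict_space borel (frontier \<Omega>))"
    by (auto simp: sets_directional_measure)
  have "(\<integral>\<^sup>+ x. indicator N (exit_point \<theta> \<Omega> x) \<partial>restrict_space lborel \<Omega>) = 0"
    using N(1) emeasure_directional_measure[OF \<Omega> \<theta> Ns] by (simp add: null_setsD1)
  moreover have "(\<lambda>x. indicator N (exit_point \<theta> \<Omega> x) :: ennreal) \<in> borel_measurable (restrict_space lborel \<Omega>)"
    by (rule measurable_compose[OF measurable_exit_point[OF \<Omega> \<theta>]]) (use Ns in simp)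
  ultimately have "AE x in restrict_space lborel \<Omega>. indicator N (exit_point \<theta> \<Omega> x) = (0::ennreal)"
    by (simp add: nn_integral_0_iff_AE)
  then have "AE x in lborel. x \<in> \<Omega> \<longrightarrow> exit_point \<theta> \<Omega> x \<notin> N"
    using \<Omega>(2) by (subst (asm) AE_restrict_space_iff) (auto simp: indicator_eq_0_iff)
  from AE_line[OF \<theta> this] show "AE y in ?H. ?Q y"
  proof eventually_elim
    case (elim y)
    show ?case
    proof (intro allI impI)
      fix \<alpha> \<beta> assume C: "{\<alpha><..<\<beta>} \<in> components (line_section \<theta> \<Omega> y)"
      note c = component_interval_right_end[OF open_line_section[OF \<Omega>(2)] C]
      \<comment> \<open>One good point of the component decides its end point, since all points of
        the component exit there.\<close>
      obtain s where s: "\<alpha> < s" "s < \<beta>" "s *\<^sub>R \<theta> + y \<in> \<Omega> \<longrightarrow> exit_point \<theta> \<Omega> (s *\<^sub>R \<theta> + y) \<notin> N"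
        using AE_lborel_interval_ex[OF elim c(1)] by blast
      moreover have "s *\<^sub>R \<theta> + y \<in> \<Omega>" using c(2) s by (auto simp: line_section_def)
      ultimately have "\<beta> *\<^sub>R \<theta> + y \<notin> N" using exit_point_component[OF \<Omega> \<theta> C s(1,2)] by simp
      then show "R (\<beta> *\<^sub>R \<theta> + y)" using N(2) frontier_component_end[OF \<Omega>(2) C] by blast
    qed
  qed
next
  assume "AE y in ?H. ?Q y"
  \<comment> \<open>The set of bad lines need not be Borel, so it is enclosed in a Borel null set,
    extended to a Borel set \<open>S\<close> of the space to be pulled back by the
    projection.\<close>
  then obtain N0 where N0: "{y \<in> space ?H. \<not> ?Q y} \<subseteq> N0" "N0 \<in> null_sets ?H"
    by (auto simp: eventually_ae_filter)
  then obtain S where S: "N0 = hyperplane \<theta> \<inter> S" "S \<in> sets borel"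
    by (auto simp: null_sets_def sets_hyperplane_lborel sets_restrict_space)
  have "AE y in ?H. y \<notin> S"
    using AE_not_in[OF N0(2)] AE_space by eventually_elim (auto simp: S space_hyperplane_lborel)
  then have ae: "AE x in lborel. hyper_proj \<theta> x \<notin> S" by (rule AE_hyper_proj[OF \<theta> S(2)])
  \<comment> \<open>A Borel cover of the bad boundary points: either no component ends there, or the
    line through the point is bad.\<close>
  define N where "N = frontier \<Omega> \<inter> (- exit_set \<theta> \<Omega> \<union> hyper_proj \<theta> -` S)"
  have "hyper_proj \<theta> -` S \<in> sets borel"
    using measurable_sets[OF measurable_hyper_proj S(2), of \<theta>] by simp
  moreover have "- exit_set \<theta> \<Omega> \<in> sets borel" using exit_set_borel[OF \<Omega> \<theta>] by (rule borel_comp)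
  ultimately have Ns: "N \<in> sets (restrict_space borel (frontier \<Omega>))"
    unfolding N_def sets_restrict_space by blast
  have "AE x in restrict_space lborel \<Omega>. indicator N (exit_point \<theta> \<Omega> x) = (0::ennreal)"
  proof (subst AE_restrict_space_iff)
    show "AE x in lborel. x \<in> \<Omega> \<longrightarrow> indicator N (exit_point \<theta> \<Omega> x) = (0::ennreal)"
      using ae
    proof eventually_elim
      case (elim x)
      show ?case
      proof
        assume x: "x \<in> \<Omega>"
        let ?d = "exit_time \<theta> \<Omega> x"
        \<comment> \<open>The segment from \<open>x\<close> to its exit point lies in \<Omega>
          except for its end, so exit points never fall into the first part of
          \<open>N\<close>.\<close>
        have "exit_point \<theta> \<Omega> x \<in> exit_set \<theta> \<Omega>"
        proof (rule exit_setI[OF exit_time_pos[OF \<Omega> \<theta> x]])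
          fix t assume t: "0 < t" "t \<le> ?d"
          then have "x + (?d - t) *\<^sub>R \<theta> \<in> \<Omega>"
            using less_exit_time_iff[OF \<Omega> \<theta> x, of "?d - t"] by auto
          then show "exit_point \<theta> \<Omega> x - t *\<^sub>R \<theta> \<in> \<Omega>" by (simp add: exit_point_def algebra_simps)
        qed
        moreover have "hyper_proj \<theta> (exit_point \<theta> \<Omega> x) = hyper_proj \<theta> x"
          unfolding exit_point_def by (rule hyper_proj_line(1)[OF \<theta>])
        ultimately show "indicator N (exit_point \<theta> \<Omega> x) = (0::ennreal)"
          using elim by (auto simp: N_def indicator_def)
      qed
    qed
  qed (use \<Omega>(2) in simp)
  then have "(\<integral>\<^sup>+ x. indicator N (exit_point \<theta> \<Omega> x) \<partial>restrict_space lborel \<Omega>) = (\<integral>\<^sup>+ x. 0 \<partial>restrict_space lborel \<Omega>)"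
    by (rule nn_integral_cong_AE)
  then have "N \<in> null_sets (directional_measure \<theta> \<Omega>)"
    using emeasure_directional_measure[OF \<Omega> \<theta> Ns] Ns by (simp add: null_sets_def sets_directional_measure)
  moreover have "{z \<in> frontier \<Omega>. \<not> R z} \<subseteq> N"
  proof
    fix z assume z: "z \<in> {z \<in> frontier \<Omega>. \<not> R z}"
    show "z \<in> N"
    proof (rule ccontr)
      assume "z \<notin> N"
      then have zE: "z \<in> exit_set \<theta> \<Omega>" and zS: "hyper_proj \<theta> z \<notin> S" using z by (auto simp: N_def)
      define y where "y = hyper_proj \<theta> z"
      define \<beta> where "\<beta> = z \<bullet> \<theta>"
      have zy: "\<beta> *\<^sub>R \<theta> + y = z" unfolding y_def \<beta>_def by (rule hyper_proj_line(4)[OF \<theta>])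
      have "y \<in> hyperplane \<theta>" unfolding y_def by (rule hyper_proj_line(5)[OF \<theta>])
      then have Q: "?Q y" using N0(1) zS S(1) by (auto simp: space_hyperplane_lborel y_def)
      obtain n where n: "\<And>t. t \<in> {0<..1 / real (Suc n)} \<Longrightarrow> z - t *\<^sub>R \<theta> \<in> \<Omega>"
        using zE unfolding exit_set_def by blast
      have "{\<beta> - 1 / real (Suc n)<..<\<beta>} \<subseteq> line_section \<theta> \<Omega> y"
      proof
        fix s assume s: "s \<in> {\<beta> - 1 / real (Suc n)<..<\<beta>}"
        have "z - (\<beta> - s) *\<^sub>R \<theta> \<in> \<Omega>" by (rule n) (use s in auto)
        then show "s \<in> line_section \<theta> \<Omega> y" by (simp add: line_section_def zy[symmetric] algebra_simps)
      qed
      moreover have "\<beta> \<notin> line_section \<theta> \<Omega> y"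
        using z \<Omega>(2) by (simp add: line_section_def zy frontier_def interior_open)
      ultimately obtain \<alpha> where "{\<alpha><..<\<beta>} \<in> components (line_section \<theta> \<Omega> y)"
        using component_interval_ex[OF open_line_section[OF \<Omega>(2)] bounded_line_section[OF \<Omega>(1) \<theta>]] by fastforce
      with Q have "R z" unfolding zy[symmetric] by blast
      then show False using z by simp
    qed
  qed
  ultimately show ?L unfolding negligible_for_def by blast
qed

text \<open>A line that misses \<Omega> has an empty section without components, so the condition is
  vacuous there. The set \<open>A\<close> can thus be replaced by almost every line of the whole
  hyperplane, and several such conditions can be combined.\<close>

lemma directional_trace_iff_AE:
  assumes \<theta>: "norm \<theta> = 1"
  shows "directional_trace \<theta> \<Omega> u g \<longleftrightarrow> g \<in> frontier \<Omega> \<rightarrow>\<^sub>E UNIV \<and>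
    (\<exists>u'. (AE x in lebesgue_on \<Omega>. u' x = u x) \<and>
      (AE y in hyperplane_lborel \<theta>. \<forall>\<alpha> \<beta>. {\<alpha><..<\<beta>} \<in> components (line_section \<theta> \<Omega> y) \<longrightarrow>
         (\<lambda>s. u' (s *\<^sub>R \<theta> + y)) \<in> H1_interval \<alpha> \<beta> \<and>
         g (\<beta> *\<^sub>R \<theta> + y) = end_trace \<alpha> \<beta> (\<lambda>s. u' (s *\<^sub>R \<theta> + y))))"
proof -
  define Q where "Q = (\<lambda>u' y. \<forall>\<alpha> \<beta>. {\<alpha><..<\<beta>} \<in> components (line_section \<theta> \<Omega> y) \<longrightarrow>
         (\<lambda>s. u' (s *\<^sub>R \<theta> + y)) \<in> H1_interval \<alpha> \<beta> \<and>
         g (\<beta> *\<^sub>R \<theta> + y) = end_trace \<alpha> \<beta> (\<lambda>s. u' (s *\<^sub>R \<theta> + y)))"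
  have sub: "hyper_proj \<theta> ` \<Omega> - A \<subseteq> space (hyperplane_lborel \<theta>)" for A
    using hyper_proj_line(5)[OF \<theta>] by (auto simp: space_hyperplane_lborel)
  have triv: "Q u' y" if y: "y \<in> hyperplane \<theta>" "y \<notin> hyper_proj \<theta> ` \<Omega>" for u' y
  proof -
    have "line_section \<theta> \<Omega> y = {}"
      unfolding line_section_def using y(2) hyper_proj_line(2)[OF \<theta> y(1)] by (metis (mono_tags, lifting) empty_Collect_eq image_eqI)
    then show ?thesis by (simp add: Q_def)
  qed
  have "(\<exists>A. A \<subseteq> hyper_proj \<theta> ` \<Omega> \<and> negligible_for (hyperplane_lborel \<theta>) (hyper_proj \<theta> ` \<Omega> - A) \<and> (\<forall>y\<in>A. Q u' y))
      \<longleftrightarrow> (AE y in hyperplane_lborel \<theta>. Q u' y)" for u'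
  proof
    assume "\<exists>A. A \<subseteq> hyper_proj \<theta> ` \<Omega> \<and> negligible_for (hyperplane_lborel \<theta>) (hyper_proj \<theta> ` \<Omega> - A) \<and> (\<forall>y\<in>A. Q u' y)"
    then obtain A where A: "\<And>y. y \<in> A \<Longrightarrow> Q u' y" "AE y in hyperplane_lborel \<theta>. y \<notin> hyper_proj \<theta> ` \<Omega> - A"
      using negligible_for_iff_AE[OF sub] by blast
    from A(2) AE_space show "AE y in hyperplane_lborel \<theta>. Q u' y"
      by eventually_elim (use A(1) triv in \<open>auto simp: space_hyperplane_lborel\<close>)
  next
    assume ae: "AE y in hyperplane_lborel \<theta>. Q u' y"
    \<comment> \<open>The largest admissible set.\<close>
    let ?A = "{y \<in> hyper_proj \<theta> ` \<Omega>. Q u' y}"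
    have "AE y in hyperplane_lborel \<theta>. y \<notin> hyper_proj \<theta> ` \<Omega> - ?A"
      using ae by eventually_elim auto
    then have "negligible_for (hyperplane_lborel \<theta>) (hyper_proj \<theta> ` \<Omega> - ?A)"
      using negligible_for_iff_AE[OF sub] by blast
    then show "\<exists>A. A \<subseteq> hyper_proj \<theta> ` \<Omega> \<and> negligible_for (hyperplane_lborel \<theta>) (hyper_proj \<theta> ` \<Omega> - A) \<and> (\<forall>y\<in>A. Q u' y)"
      by (intro exI[of _ ?A]) auto
  qed
  then show ?thesis
    unfolding directional_trace_def Q_def by (simp only: ex_simps)
qed

text \<open>The Borel representative \<open>w\<close> serves both as the representative required by
  the definition and as the integrand of the averages. On almost every line \<open>w\<close> is a
  constant plus a primitive on each component, which gives membership in \<open>H1_interval\<close>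
  and identifies the limit of the averages with the end value.\<close>

lemma ex_borel_directional_trace:
  fixes \<Omega> :: "'a::euclidean_space set"
  assumes \<Omega>: "bounded \<Omega>" "open \<Omega>" and \<theta>: "norm \<theta> = 1" and u: "u \<in> W_space \<theta> \<Omega>"
  shows "\<exists>g. directional_trace \<theta> \<Omega> u g \<and> g \<in> borel_measurable (restrict_space borel (frontier \<Omega>))"
proof -
  obtain v where uv: "u \<in> L2_space \<Omega>" "v \<in> L2_space \<Omega>" and weak: "weak_dir_deriv \<theta> \<Omega> u v"
    using u by (auto simp: W_space_def)
  have u_meas: "u \<in> borel_measurable (lebesgue_on \<Omega>)" and v_meas: "v \<in> borel_measurable (lebesgue_on \<Omega>)"
    using uv by (auto simp: L2_space_def)
  obtain w where w[measurable]: "w \<in> borel_measurable borel" and w': "AE x in lborel. x \<in> \<Omega> \<longrightarrow> w x = u x"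
    "\<And>x. x \<notin> \<Omega> \<Longrightarrow> w x = 0" "integrable lborel w" "integrable lborel (\<lambda>x. (w x)\<^sup>2)"
    using L2_space_borel_representative[OF uv(1) \<Omega>] by blast
  obtain z where z[measurable]: "z \<in> borel_measurable borel" and z': "AE x in lborel. x \<in> \<Omega> \<longrightarrow> z x = v x"
    "\<And>x. x \<notin> \<Omega> \<Longrightarrow> z x = 0" "integrable lborel z" "integrable lborel (\<lambda>x. (z x)\<^sup>2)"
    using L2_space_borel_representative[OF uv(2) \<Omega>] by blast
  have prim: "AE y in hyperplane_lborel \<theta>. \<forall>\<alpha> \<beta>. \<alpha> < \<beta> \<longrightarrow> {\<alpha><..<\<beta>} \<subseteq> line_section \<theta> \<Omega> y \<longrightarrow>
      (\<exists>c. AE s in lborel. s \<in> {\<alpha><..<\<beta>} \<longrightarrow> w (s *\<^sub>R \<theta> + y) = c + primitive (\<lambda>s. z (s *\<^sub>R \<theta> + y)) \<alpha> s)"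
    by (rule AE_line_primitive[OF \<theta> \<Omega>(2) u_meas v_meas weak w'(3,1) _ z'(3,1)]) (fact w'(2) z'(2))+
  \<comment> \<open>Averages of \<open>w\<close> over the segment of length 1 / (n + 1) that arrives
    at \<open>x\<close> in direction \<theta>, with the segment rescaled to ]0,1[.\<close>
  define m where "m = (\<lambda>n x. \<integral>r. w (x - (r / real (Suc n)) *\<^sub>R \<theta>) * indicator {0<..<1} r \<partial>lborel)"
  \<comment> \<open>Where the averages diverge, \<open>lim\<close> returns one fixed unspecified
    value, which keeps the function Borel.\<close>
  define g where "g = restrict (\<lambda>x. lim (\<lambda>n. m n x)) (frontier \<Omega>)"
  have "(\<lambda>x. lim (\<lambda>n. m n x)) \<in> borel_measurable borel"
    unfolding m_def by measurable
  then have "(\<lambda>x. lim (\<lambda>n. m n x)) \<in> borel_measurable (restrict_space borel (frontier \<Omega>))"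
    by (rule measurable_restrict_space1)
  then have g_meas: "g \<in> borel_measurable (restrict_space borel (frontier \<Omega>))"
    by (rule measurable_cong[THEN iffD1, rotated]) (simp add: g_def space_restrict_space)
  have "directional_trace \<theta> \<Omega> u g"
    unfolding directional_trace_iff_AE[OF \<theta>]
  proof (intro conjI exI[of _ w])
    show "g \<in> frontier \<Omega> \<rightarrow>\<^sub>E UNIV" by (simp add: g_def)
    show "AE x in lebesgue_on \<Omega>. w x = u x"
      using w'(1) \<Omega>(2) by (subst AE_lebesgue_on_iff) auto
    show "AE y in hyperplane_lborel \<theta>. \<forall>\<alpha> \<beta>. {\<alpha><..<\<beta>} \<in> components (line_section \<theta> \<Omega> y) \<longrightarrow>
         (\<lambda>s. w (s *\<^sub>R \<theta> + y)) \<in> H1_interval \<alpha> \<beta> \<and>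
         g (\<beta> *\<^sub>R \<theta> + y) = end_trace \<alpha> \<beta> (\<lambda>s. w (s *\<^sub>R \<theta> + y))"
      using prim
        AE_integrable_line[OF \<theta> w'(3)] AE_integrable_line[OF \<theta> w'(4)]
        AE_integrable_line[OF \<theta> z'(3)] AE_integrable_line[OF \<theta> z'(4)]
    proof eventually_elim
      case (elim y)
      show ?case
      proof (intro allI impI)
        fix \<alpha> \<beta> assume C: "{\<alpha><..<\<beta>} \<in> components (line_section \<theta> \<Omega> y)"
        note c = component_interval_right_end[OF open_line_section[OF \<Omega>(2)] C]
        let ?f = "\<lambda>s. w (s *\<^sub>R \<theta> + y)" and ?F = "primitive (\<lambda>s. z (s *\<^sub>R \<theta> + y)) \<alpha>"
        obtain k where k: "AE s in lborel. s \<in> {\<alpha><..<\<beta>} \<longrightarrow> ?f s = k + ?F s"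
          using elim(1) c(1,2) by blast
        have cont: "continuous_on {\<alpha>..\<beta>} (\<lambda>s. k + ?F s)"
          by (intro continuous_intros continuous_on_primitive elim)
        have "(\<lambda>n. m n (\<beta> *\<^sub>R \<theta> + y)) \<longlonglongrightarrow> k + ?F \<beta>"
          using end_average_tendsto[OF c(1) cont _ k] by (simp add: m_def algebra_simps)
        then have "g (\<beta> *\<^sub>R \<theta> + y) = k + ?F \<beta>"
          using frontier_component_end[OF \<Omega>(2) C] by (simp add: g_def limI)
        then show "?f \<in> H1_interval \<alpha> \<beta> \<and> g (\<beta> *\<^sub>R \<theta> + y) = end_trace \<alpha> \<beta> ?f"
          using H1_intervalI[OF c(1) elim(2-5) k] end_trace_eq[OF c(1) cont k] by simp
      qed
    qed
  qed
  with g_meas show ?thesis by blast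
qed

text \<open>Two traces may come with different representatives, but these agree a.e. on almost every
  line, hence have the same end values there. Conversely the representative that belongs to
  \<open>g\<close> also serves \<open>h\<close>. Both directions are thereby statements about right
  end points on almost every line.\<close>

lemma directional_trace_iff_negligible:
  fixes \<Omega> :: "'a::euclidean_space set"
  assumes \<Omega>: "bounded \<Omega>" "open \<Omega>" and \<theta>: "norm \<theta> = 1"
    and g: "directional_trace \<theta> \<Omega> u g" and h: "h \<in> frontier \<Omega> \<rightarrow>\<^sub>E UNIV"
  shows "directional_trace \<theta> \<Omega> u h \<longleftrightarrow>
    negligible_for (directional_measure \<theta> \<Omega>) {z \<in> frontier \<Omega>. h z \<noteq> g z}"
proof -
  obtain u1 where u1: "AE x in lebesgue_on \<Omega>. u1 x = u x"
    and ae1: "AE y in hyperplane_lborel \<theta>. \<forall>\<alpha> \<beta>. {\<alpha><..<\<beta>} \<in> components (line_section \<theta> \<Omega> y) \<longrightarrow>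
         (\<lambda>s. u1 (s *\<^sub>R \<theta> + y)) \<in> H1_interval \<alpha> \<beta> \<and>
         g (\<beta> *\<^sub>R \<theta> + y) = end_trace \<alpha> \<beta> (\<lambda>s. u1 (s *\<^sub>R \<theta> + y))"
    using g unfolding directional_trace_iff_AE[OF \<theta>] by blast
  have \<Omega>': "\<Omega> \<in> sets borel" using \<Omega>(2) by simp
  show ?thesis
    unfolding negligible_directional_iff[OF \<Omega> \<theta>]
  proof
    assume "directional_trace \<theta> \<Omega> u h"
    then obtain u2 where u2: "AE x in lebesgue_on \<Omega>. u2 x = u x"
      and ae2: "AE y in hyperplane_lborel \<theta>. \<forall>\<alpha> \<beta>. {\<alpha><..<\<beta>} \<in> components (line_section \<theta> \<Omega> y) \<longrightarrow>
         (\<lambda>s. u2 (s *\<^sub>R \<theta> + y)) \<in> H1_interval \<alpha> \<beta> \<and>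
         h (\<beta> *\<^sub>R \<theta> + y) = end_trace \<alpha> \<beta> (\<lambda>s. u2 (s *\<^sub>R \<theta> + y))"
      unfolding directional_trace_iff_AE[OF \<theta>] by blast
    have "AE x in lborel. x \<in> \<Omega> \<longrightarrow> u2 x = u1 x"
      using u1 u2 unfolding AE_lebesgue_on_iff[OF \<Omega>'] by eventually_elim simp
    from AE_line[OF \<theta> this] ae1 ae2
    show "AE y in hyperplane_lborel \<theta>. \<forall>\<alpha> \<beta>. {\<alpha><..<\<beta>} \<in> components (line_section \<theta> \<Omega> y) \<longrightarrow>
        h (\<beta> *\<^sub>R \<theta> + y) = g (\<beta> *\<^sub>R \<theta> + y)"
    proof eventually_elim
      case (elim y)
      show ?case
      proof (intro allI impI)
        fix \<alpha> \<beta> assume C: "{\<alpha><..<\<beta>} \<in> components (line_section \<theta> \<Omega> y)"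
        have "AE s in lborel. s \<in> {\<alpha><..<\<beta>} \<longrightarrow> u2 (s *\<^sub>R \<theta> + y) = u1 (s *\<^sub>R \<theta> + y)"
          using elim(1) by eventually_elim (use in_components_subset[OF C] in \<open>auto simp: line_section_def\<close>)
        then show "h (\<beta> *\<^sub>R \<theta> + y) = g (\<beta> *\<^sub>R \<theta> + y)"
          using elim(2,3) C end_trace_cong_AE by metis
      qed
    qed
  next
    assume "AE y in hyperplane_lborel \<theta>. \<forall>\<alpha> \<beta>. {\<alpha><..<\<beta>} \<in> components (line_section \<theta> \<Omega> y) \<longrightarrow>
        h (\<beta> *\<^sub>R \<theta> + y) = g (\<beta> *\<^sub>R \<theta> + y)"
    with ae1 have "AE y in hyperplane_lborel \<theta>. \<forall>\<alpha> \<beta>. {\<alpha><..<\<beta>} \<in> components (line_section \<theta> \<Omega> y) \<longrightarrow>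
         (\<lambda>s. u1 (s *\<^sub>R \<theta> + y)) \<in> H1_interval \<alpha> \<beta> \<and>
         h (\<beta> *\<^sub>R \<theta> + y) = end_trace \<alpha> \<beta> (\<lambda>s. u1 (s *\<^sub>R \<theta> + y))"
      by eventually_elim simp
    with u1 h show "directional_trace \<theta> \<Omega> u h"
      unfolding directional_trace_iff_AE[OF \<theta>] by blast
  qed
qed

theorem theorem3p3:
  fixes \<Omega> :: "'a::euclidean_space set" and \<theta> :: 'a and u :: "'a \<Rightarrow> real"
  assumes "\<Omega> \<noteq> {}" and "bounded \<Omega>" and "open \<Omega>"
    and "\<theta> \<in> sphere 0 1"
    and "u \<in> W_space \<theta> \<Omega>"
  shows "\<forall>\<eta>\<in>{\<theta>, - \<theta>}.
    (\<exists>g. directional_trace \<eta> \<Omega> u g \<and>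
         g \<in> borel_measurable (restrict_space borel (frontier \<Omega>))) \<and>
    (\<forall>g. directional_trace \<eta> \<Omega> u g \<and>
         g \<in> borel_measurable (restrict_space borel (frontier \<Omega>)) \<longrightarrow>
         (\<forall>h \<in> frontier \<Omega> \<rightarrow>\<^sub>E UNIV.
            directional_trace \<eta> \<Omega> u h \<longleftrightarrow>
            negligible_for (directional_measure \<eta> \<Omega>) {z \<in> frontier \<Omega>. h z \<noteq> g z})) \<and>
    (\<exists>g \<in> (frontier \<Omega> \<rightarrow>\<^sub>E UNIV) \<inter> borel_measurable (restrict_space borel (frontier \<Omega>)).
       trace_class \<eta> \<Omega> u = ae_eq_rel (directional_measure \<eta> \<Omega>) `` {g})"
proof
  fix \<eta> assume "\<eta> \<in> {\<theta>, - \<theta>}"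
  \<comment> \<open>The weak derivative in direction -\<theta> is the negative of the one in
    direction \<theta>, so a single argument covers both signs.\<close>
  then have \<eta>: "norm \<eta> = 1" and u: "u \<in> W_space \<eta> \<Omega>"
    using assms(4,5) W_space_uminus[of \<theta> \<Omega>] by auto
  note iff = directional_trace_iff_negligible[OF assms(2,3) \<eta>]
  obtain g where g: "directional_trace \<eta> \<Omega> u g" "g \<in> borel_measurable (restrict_space borel (frontier \<Omega>))"
    using ex_borel_directional_trace[OF assms(2,3) \<eta> u] by blast
  have dom: "h \<in> frontier \<Omega> \<rightarrow>\<^sub>E UNIV" if "directional_trace \<eta> \<Omega> u h" for h
    using that by (simp add: directional_trace_def)
  have "trace_class \<eta> \<Omega> u = ae_eq_rel (directional_measure \<eta> \<Omega>) `` {g}"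
  proof (rule set_eqI)
    fix h
    have "{z \<in> frontier \<Omega>. g z \<noteq> h z} = {z \<in> frontier \<Omega>. h z \<noteq> g z}" by auto
    then show "h \<in> trace_class \<eta> \<Omega> u \<longleftrightarrow> h \<in> ae_eq_rel (directional_measure \<eta> \<Omega>) `` {g}"
      using iff[OF g(1), of h] dom[of h] dom[OF g(1)]
      by (auto simp: trace_class_def ae_eq_rel_def space_directional_measure)
  qed
  then show "(\<exists>g. directional_trace \<eta> \<Omega> u g \<and>
         g \<in> borel_measurable (restrict_space borel (frontier \<Omega>))) \<and>
    (\<forall>g. directional_trace \<eta> \<Omega> u g \<and>
         g \<in> borel_measurable (restrict_space borel (frontier \<Omega>)) \<longrightarrow>
         (\<forall>h \<in> frontier \<Omega> \<rightarrow>\<^sub>E UNIV.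
            directional_trace \<eta> \<Omega> u h \<longleftrightarrow>
            negligible_for (directional_measure \<eta> \<Omega>) {z \<in> frontier \<Omega>. h z \<noteq> g z})) \<and>
    (\<exists>g \<in> (frontier \<Omega> \<rightarrow>\<^sub>E UNIV) \<inter> borel_measurable (restrict_space borel (frontier \<Omega>)).
       trace_class \<eta> \<Omega> u = ae_eq_rel (directional_measure \<eta> \<Omega>) `` {g})"
    using g dom[OF g(1)] iff by blast
qed

end
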